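(* Let $E$ be an arbitrary directed graph and $K$ any field. Then every purely infinite (two-sided) ideal $I$ of $L_K(E)$ is graded. Moreover, there exists a hereditary and saturated subset $H\subseteq E^0$ such that $I=I(H)$.
   Context: A directed graph $E=(E^0,E^1,s,r)$ consists of arbitrary sets $E^0$ (vertices), $E^1$ (edges) and maps $s,r:E^1\to E^0$ (source, range). A vertex $v$ is a sink if $s^{-1}(v)=\emptyset$, an infinite emitter if $s^{-1}(v)$ is infinite, and regular otherwise. A path is a vertex (length $0$) or a finite sequence of edges $e_1\cdots e_n$ with $r(e_i)=s(e_{i+1})$. Write $u\ge v$ if there is a path from $u$ to $v$. A set $H\subseteq E^0$ is hereditary if $v\in H$, $v\ge w$ imply $w\in H$; it is saturated if for every regular vertex $v$, $r(s^{-1}(v))\subseteq H$ implies $v\in H$. The Leavitt path algebra $L_K(E)$ is the $K$-algebra generated by $\{v: v\in E^0\}\cup\{e,e^*: e\in E^1\}$ subject to: $vw=\delta_{v,w}v$ for $v,w\in E^0$; $s(e)e=e\,r(e)=e$ and $r(e)e^*=e^*s(e)=e^*$ for $e\in E^1$; $e^*e'=\delta_{e,e'}r(e)$ for $e,e'\in E^1$; $v=\sum_{s(e)=v}ee^*$ for every regular vertex $v$. It is $\mathbb{Z}$-graded with $\deg v=0$, $\deg e=1$, $\deg e^*=-1$; an ideal is graded if it is generated (equivalently, spanned) by its homogeneous elements. $I(X)$ is the two-sided ideal generated by $X$. A ring $R$ (not necessarily unital) is purely infinite if (1) no quotient of $R$ is a division ring, and (2) whenever $a\in R$ and $b\in RaR$,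 there are $x,y\in R$ with $b=xay$. An ideal is purely infinite if it is so as a ring. *)

theory Defs
  imports
    "HOL-Algebra.QuotRing"
    "HOL-Library.Poly_Mapping"
    "Graph_Theory.Arc_Walk"
begin

section \<open>Rings that need not be unital\<close>

text \<open>
  The HOL-Algebra record of rings is used for its carrier, addition, zero and multiplication;
  its field for the unit is ignored, so that the quotient \<^term>\<open>R Quot I\<close> is available.
\<close>

locale rng = abelian_group R for R (structure) +
  assumes m_closed: "\<lbrakk>x \<in> carrier R; y \<in> carrier R\<rbrakk> \<Longrightarrow> x \<otimes> y \<in> carrier R"
    and m_assoc: "\<lbrakk>x \<in> carrier R; y \<in> carrier R; z \<in> carrier R\<rbrakk>
      \<Longrightarrow> (x \<otimes> y) \<otimes> z = x \<otimes> (y \<otimes> z)"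
    and l_distr: "\<lbrakk>x \<in> carrier R; y \<in> carrier R; z \<in> carrier R\<rbrakk>
      \<Longrightarrow> (x \<oplus> y) \<otimes> z = x \<otimes> z \<oplus> y \<otimes> z"
    and r_distr: "\<lbrakk>x \<in> carrier R; y \<in> carrier R; z \<in> carrier R\<rbrakk>
      \<Longrightarrow> z \<otimes> (x \<oplus> y) = z \<otimes> x \<oplus> z \<otimes> y"

definition rng_ideal :: "'a set \<Rightarrow> ('a, 'm) ring_scheme \<Rightarrow> bool" where
  "rng_ideal I R \<longleftrightarrow> additive_subgroup I R \<and>
     (\<forall>a\<in>I. \<forall>x\<in>carrier R. x \<otimes>\<^bsub>R\<^esub> a \<in> I \<and> a \<otimes>\<^bsub>R\<^esub> x \<in> I)"

definition rng_genideal :: "('a, 'm) ring_scheme \<Rightarrow> 'a set \<Rightarrow> 'a set" where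
  "rng_genideal R X = \<Inter>{I. rng_ideal I R \<and> X \<subseteq> I}"

text \<open>The unit of a division ring is asserted to exist, not read off the record.\<close>

definition rng_division :: "('a, 'm) ring_scheme \<Rightarrow> bool" where
  "rng_division D \<longleftrightarrow> rng D \<and>
     (\<exists>u\<in>carrier D. u \<noteq> \<zero>\<^bsub>D\<^esub> \<and>
        (\<forall>x\<in>carrier D. u \<otimes>\<^bsub>D\<^esub> x = x \<and> x \<otimes>\<^bsub>D\<^esub> u = x) \<and>
        (\<forall>x\<in>carrier D - {\<zero>\<^bsub>D\<^esub>}. \<exists>y\<in>carrier D. x \<otimes>\<^bsub>D\<^esub> y = u \<and> y \<otimes>\<^bsub>D\<^esub> x = u))"

definition rng_sandwich :: "('a, 'm) ring_scheme \<Rightarrow> 'a \<Rightarrow> 'a set" where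
  \<comment> \<open>the set \<open>RaR\<close> of finite sums of elements \<open>xay\<close>\<close>
  "rng_sandwich R a =
     {\<Oplus>\<^bsub>R\<^esub>i\<in>{..<n}. x i \<otimes>\<^bsub>R\<^esub> a \<otimes>\<^bsub>R\<^esub> y i | (n::nat) x y.
        (\<forall>i<n. x i \<in> carrier R \<and> y i \<in> carrier R)}"

definition purely_infinite :: "('a, 'm) ring_scheme \<Rightarrow> bool" where
  "purely_infinite R \<longleftrightarrow> rng R \<and>
     (\<forall>J. rng_ideal J R \<longrightarrow> \<not> rng_division (R Quot J)) \<and>
     (\<forall>a\<in>carrier R. \<forall>b\<in>rng_sandwich R a.
        \<exists>x\<in>carrier R. \<exists>y\<in>carrier R. b = x \<otimes>\<^bsub>R\<^esub> a \<otimes>\<^bsub>R\<^esub> y)"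


section \<open>Directed graphs\<close>

definition regular_vertex :: "('v, 'e) pre_digraph \<Rightarrow> 'v \<Rightarrow> bool" where
  "regular_vertex G v \<longleftrightarrow> v \<in> verts G \<and> out_arcs G v \<noteq> {} \<and> finite (out_arcs G v)"

definition hereditary :: "('v, 'e) pre_digraph \<Rightarrow> 'v set \<Rightarrow> bool" where
  "hereditary G H \<longleftrightarrow> (\<forall>v\<in>H. \<forall>w p. pre_digraph.awalk G v p w \<longrightarrow> w \<in> H)"

definition saturated :: "('v, 'e) pre_digraph \<Rightarrow> 'v set \<Rightarrow> bool" where
  "saturated G H \<longleftrightarrow>
     (\<forall>v. regular_vertex G v \<longrightarrow> head G ` out_arcs G v \<subseteq> H \<longrightarrow> v \<in> H)"


section \<open>Free algebras\<close>

text \<open>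
  Words form a monoid, written additively, so that \<open>'g free_word \<Rightarrow>\<^sub>0 'k\<close> is the free unital
  \<open>'k\<close>-algebra on the type \<open>'g\<close>, with the convolution product.
\<close>

datatype 'g free_word = Word (letters: "'g list")

instantiation free_word :: (type) monoid_add
begin

definition zero_free_word :: "'a free_word" where
  "0 = Word []"

definition plus_free_word :: "'a free_word \<Rightarrow> 'a free_word \<Rightarrow> 'a free_word" where
  "u + v = Word (letters u @ letters v)"

instance
  by standard (auto simp: zero_free_word_def plus_free_word_def)

end

text \<open>
  The free algebra without unit on a set of generators: combinations of nonempty words.
\<close>

definition free_rng :: "'g set \<Rightarrow> ('g free_word \<Rightarrow>\<^sub>0 'k::field) ring" where
  "free_rng X = \<lparr>carrier = {p. \<forall>w\<in>Poly_Mapping.keys p. letters w \<noteq> [] \<and> set (letters w) \<subseteq> X},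
     mult = (*), one = undefined, zero = 0, add = (+)\<rparr>"

definition gen :: "'g \<Rightarrow> ('g free_word \<Rightarrow>\<^sub>0 'k::field)" where
  "gen x = Poly_Mapping.single (Word [x]) 1"

text \<open>
  The algebra ideal generated by a set of relations. Closure under scalars has to be demanded
  since the free algebra has no unit.
\<close>

definition free_genideal ::
    "'g set \<Rightarrow> ('g free_word \<Rightarrow>\<^sub>0 'k::field) set \<Rightarrow> ('g free_word \<Rightarrow>\<^sub>0 'k) set" where
  "free_genideal X S = \<Inter>{J. rng_ideal J (free_rng X) \<and>
     (\<forall>c. \<forall>p\<in>J. Poly_Mapping.single 0 c * p \<in> J) \<and> S \<subseteq> J}"


section \<open>Leavitt path algebras\<close>

datatype ('v, 'e) lpa_gen = Vertex 'v | Edge 'e | Ghost 'e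

definition lpa_gens :: "('v, 'e) pre_digraph \<Rightarrow> ('v, 'e) lpa_gen set" where
  "lpa_gens G = Vertex ` verts G \<union> Edge ` arcs G \<union> Ghost ` arcs G"

definition lpa_relators ::
    "('v, 'e) pre_digraph \<Rightarrow> (('v, 'e) lpa_gen free_word \<Rightarrow>\<^sub>0 'k::field) set" where
  "lpa_relators G =
     {gen (Vertex v) * gen (Vertex w) - (if v = w then gen (Vertex v) else 0) | v w.
        v \<in> verts G \<and> w \<in> verts G}
   \<union> {gen (Vertex (tail G e)) * gen (Edge e) - gen (Edge e) | e. e \<in> arcs G}
   \<union> {gen (Edge e) * gen (Vertex (head G e)) - gen (Edge e) | e. e \<in> arcs G}
   \<union> {gen (Vertex (head G e)) * gen (Ghost e) - gen (Ghost e) | e. e \<in> arcs G}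
   \<union> {gen (Ghost e) * gen (Vertex (tail G e)) - gen (Ghost e) | e. e \<in> arcs G}
   \<union> {gen (Ghost e) * gen (Edge f) - (if e = f then gen (Vertex (head G e)) else 0) | e f.
        e \<in> arcs G \<and> f \<in> arcs G}
   \<union> {gen (Vertex v) - (\<Sum>e\<in>out_arcs G v. gen (Edge e) * gen (Ghost e)) | v.
        regular_vertex G v}"

definition lpa_rel_ideal ::
    "('v, 'e) pre_digraph \<Rightarrow> (('v, 'e) lpa_gen free_word \<Rightarrow>\<^sub>0 'k::field) set" where
  "lpa_rel_ideal G = free_genideal (lpa_gens G) (lpa_relators G)"

type_synonym ('v, 'e, 'k) lpa = "(('v, 'e) lpa_gen free_word \<Rightarrow>\<^sub>0 'k) set"

definition leavitt_path_algebra ::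
    "('v, 'e) pre_digraph \<Rightarrow> ('v, 'e, 'k::field) lpa ring" where
  "leavitt_path_algebra G = free_rng (lpa_gens G) Quot lpa_rel_ideal G"

definition lpa_class ::
    "('v, 'e) pre_digraph \<Rightarrow> (('v, 'e) lpa_gen free_word \<Rightarrow>\<^sub>0 'k::field) \<Rightarrow> ('v, 'e, 'k) lpa" where
  "lpa_class G p = lpa_rel_ideal G +>\<^bsub>free_rng (lpa_gens G)\<^esub> p"

definition lpa_vertex :: "('v, 'e) pre_digraph \<Rightarrow> 'v \<Rightarrow> ('v, 'e, 'k::field) lpa" where
  "lpa_vertex G v = lpa_class G (gen (Vertex v))"

fun gen_degree :: "('v, 'e) lpa_gen \<Rightarrow> int" where
  "gen_degree (Vertex v) = 0"
| "gen_degree (Edge e) = 1"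
| "gen_degree (Ghost e) = -1"

definition lpa_component :: "('v, 'e) pre_digraph \<Rightarrow> int \<Rightarrow> ('v, 'e, 'k::field) lpa set" where
  "lpa_component G n = lpa_class G `
     {p \<in> carrier (free_rng (lpa_gens G)).
        \<forall>w\<in>Poly_Mapping.keys p. sum_list (map gen_degree (letters w)) = n}"

definition graded_ideal :: "('v, 'e) pre_digraph \<Rightarrow> ('v, 'e, 'k::field) lpa set \<Rightarrow> bool" where
  "graded_ideal G I \<longleftrightarrow> rng_ideal I (leavitt_path_algebra G) \<and>
     I = rng_genideal (leavitt_path_algebra G) (I \<inter> (\<Union>n. lpa_component G n))"


section \<open>Well-definedness\<close>

text \<open>
  The relators lie in the free algebra, so the family of ideals intersected in \<open>lpa_rel_ideal\<close> is
  nonempty, and the Leavitt path algebra and its ideals are rings.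
\<close>

lemma rng_free_rng: "rng (free_rng X :: ('g free_word \<Rightarrow>\<^sub>0 'k::field) ring)"
proof -
  let ?F = "free_rng X :: ('g free_word \<Rightarrow>\<^sub>0 'k) ring"
  have car: "p \<in> carrier ?F \<longleftrightarrow> (\<forall>w\<in>Poly_Mapping.keys p. letters w \<noteq> [] \<and> set (letters w) \<subseteq> X)" for p
    by (simp add: free_rng_def)
  have ops: "p \<oplus>\<^bsub>?F\<^esub> q = p + q" "p \<otimes>\<^bsub>?F\<^esub> q = p * q" "\<zero>\<^bsub>?F\<^esub> = 0" for p q
    by (simp_all add: free_rng_def)
  have zero: "0 \<in> carrier ?F" by (simp add: car)
  have add: "p + q \<in> carrier ?F" if "p \<in> carrier ?F" "q \<in> carrier ?F" for p q
    using that Poly_Mapping.keys_add[of p q] unfolding car by blast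
  have um: "- p \<in> carrier ?F" if "p \<in> carrier ?F" for p
    using that unfolding car by simp
  have mult: "p * q \<in> carrier ?F" if "p \<in> carrier ?F" "q \<in> carrier ?F" for p q
    unfolding car
  proof
    fix w assume "w \<in> Poly_Mapping.keys (p * q)"
    then obtain u v where "w = u + v" "u \<in> Poly_Mapping.keys p" "v \<in> Poly_Mapping.keys q"
      using keys_mult[of p q] by blast
    then show "letters w \<noteq> [] \<and> set (letters w) \<subseteq> X"
      using that unfolding car by (auto simp: plus_free_word_def)
  qed
  have "abelian_group ?F"
  proof (rule abelian_groupI)
    show "\<exists>y\<in>carrier ?F. y \<oplus>\<^bsub>?F\<^esub> x = \<zero>\<^bsub>?F\<^esub>" if "x \<in> carrier ?F" for x
      using um[OF that] by (intro bexI[of _ "- x"]) (simp_all add: ops)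
  qed (simp_all add: ops add zero ac_simps)
  moreover have "rng_axioms ?F"
    by unfold_locales (simp_all add: ops mult algebra_simps)
  ultimately show ?thesis by (simp add: rng_def)
qed

lemma rng_ideal_imp_rng:
  fixes R (structure)
  assumes "rng R" "rng_ideal I R"
  shows "rng (R\<lparr>carrier := I\<rparr>)"
proof -
  interpret rng R by fact
  interpret additive_subgroup I R using assms(2) by (simp add: rng_ideal_def)
  have sub: "I \<subseteq> carrier R" using a_subset by simp
  have "abelian_group (R\<lparr>carrier := I\<rparr>)"
  proof (rule abelian_groupI)
    fix x assume "x \<in> carrier (R\<lparr>carrier := I\<rparr>)"
    then show "\<exists>y\<in>carrier (R\<lparr>carrier := I\<rparr>). y \<oplus>\<^bsub>R\<lparr>carrier := I\<rparr>\<^esub> x = \<zero>\<^bsub>R\<lparr>carrier := I\<rparr>\<^esub>"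
      using sub a_inv_closed l_neg by (intro bexI[of _ "\<ominus> x"]) auto
  qed (use sub in \<open>auto simp: a_ac subset_iff\<close>)
  moreover have "rng_axioms (R\<lparr>carrier := I\<rparr>)"
    using assms(2) sub unfolding rng_axioms_def rng_ideal_def
    by (auto simp: subset_iff m_assoc l_distr r_distr)
  ultimately show ?thesis by (simp add: rng_def)
qed

lemma rng_Quot:
  fixes R (structure)
  assumes "rng R" "rng_ideal I R"
  shows "rng (R Quot I)"
proof -
  interpret rng R by fact
  interpret abelian_subgroup I R
    using assms(2) by (intro abelian_subgroupI3 abelian_group_axioms) (simp add: rng_ideal_def)
  have sub: "I \<subseteq> carrier R" using a_subset by simp
  have id: "x \<otimes> a \<in> I" "a \<otimes> x \<in> I" if "a \<in> I" "x \<in> carrier R" for a x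
    using assms(2) that by (auto simp: rng_ideal_def)
  have carE: "\<exists>x\<in>carrier R. A = I +> x" if "A \<in> carrier (R Quot I)" for A
    using that by (auto simp: FactRing_def A_RCOSETS_def')
  have carI: "I +> x \<in> carrier (R Quot I)" if "x \<in> carrier R" for x
    using that by (auto simp: FactRing_def A_RCOSETS_def')
  have addq: "(I +> x) \<oplus>\<^bsub>R Quot I\<^esub> (I +> y) = I +> (x \<oplus> y)"
    if "x \<in> carrier R" "y \<in> carrier R" for x y
    using that by (simp add: FactRing_def a_rcos_sum)
  have multq: "(I +> x) \<otimes>\<^bsub>R Quot I\<^esub> (I +> y) = I +> (x \<otimes> y)"
    if xy: "x \<in> carrier R" "y \<in> carrier R" for x y
  proof -
    have "I +> (a \<otimes> b) = I +> (x \<otimes> y)" if ab: "a \<in> I +> x" "b \<in> I +> y" for a b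
    proof -
      obtain i j where i: "i \<in> I" "a = i \<oplus> x" and j: "j \<in> I" "b = j \<oplus> y"
        using ab by (auto simp: a_r_coset_def')
      have c: "i \<in> carrier R" "j \<in> carrier R" using i j sub by auto
      have "a \<otimes> b = (i \<otimes> j \<oplus> i \<otimes> y \<oplus> x \<otimes> j) \<oplus> x \<otimes> y"
        using c xy by (simp add: i j l_distr r_distr m_closed a_ac)
      moreover have "i \<otimes> j \<oplus> i \<otimes> y \<oplus> x \<otimes> j \<in> I"
        using id i j c xy by simp
      ultimately have "a \<otimes> b \<in> I +> (x \<otimes> y)" by (auto simp: a_r_coset_def')
      then show ?thesis using a_repr_independence[of "a \<otimes> b" I "x \<otimes> y"] xy m_closed a_subgroup by simp
    qed
    then have "(\<Union>a\<in>I +> x. \<Union>b\<in>I +> y. I +> (a \<otimes> b))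
        = (\<Union>a\<in>I +> x. \<Union>b\<in>I +> y. I +> (x \<otimes> y))"
      by (intro SUP_cong refl) blast
    also have "\<dots> = I +> (x \<otimes> y)"
      using a_rcos_self[OF xy(1)] a_rcos_self[OF xy(2)] by blast
    finally show ?thesis by (simp add: FactRing_def rcoset_mult_def)
  qed
  have zq: "\<zero>\<^bsub>R Quot I\<^esub> = I +> \<zero>" using sub by (simp add: FactRing_def a_coset_add_zero)
  have "abelian_group (R Quot I)"
  proof (rule abelian_groupI)
    fix A assume "A \<in> carrier (R Quot I)"
    then obtain x where "x \<in> carrier R" "A = I +> x" using carE by blast
    then show "\<exists>y\<in>carrier (R Quot I). y \<oplus>\<^bsub>R Quot I\<^esub> A = \<zero>\<^bsub>R Quot I\<^esub>"
      by (intro bexI[of _ "I +> (\<ominus> x)"]) (auto simp: addq zq l_neg intro: carI)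
  qed (auto dest!: carE simp: addq zq carI a_ac)
  moreover have "rng_axioms (R Quot I)"
    unfolding rng_axioms_def
    by (auto dest!: carE simp: addq multq carI m_closed m_assoc l_distr r_distr)
  ultimately show ?thesis by (simp add: rng_def)
qed

lemma lpa_relators_carrier:
  assumes "wf_digraph G"
  shows "lpa_relators G \<subseteq> carrier (free_rng (lpa_gens G))"
proof -
  let ?F = "free_rng (lpa_gens G) :: (('a, 'b) lpa_gen free_word \<Rightarrow>\<^sub>0 'c) ring"
  interpret G: wf_digraph G by fact
  interpret rng ?F by (rule rng_free_rng)
  have add: "p + q \<in> carrier ?F" and mult: "p * q \<in> carrier ?F" 
    if "p \<in> carrier ?F" "q \<in> carrier ?F" for p q
    using a_closed[OF that] m_closed[OF that] by (simp_all add: free_rng_def)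
  have zero: "0 \<in> carrier ?F" by (simp add: free_rng_def)
  have diff: "p - q \<in> carrier ?F" if "p \<in> carrier ?F" "q \<in> carrier ?F" for p q
  proof -
    have "- q \<in> carrier ?F" using that(2) by (simp add: free_rng_def)
    then show ?thesis using add[OF that(1), of "- q"] by (simp only: add_uminus_conv_diff)
  qed
  have sum: "sum f A \<in> carrier ?F" if "\<And>x. x \<in> A \<Longrightarrow> f x \<in> carrier ?F" for f and A :: "'b set"
    using that by (induction A rule: infinite_finite_induct) (auto intro: add zero)
  have gen: "gen x \<in> carrier ?F" if "x \<in> lpa_gens G" for x
    using that by (simp add: free_rng_def gen_def)
  have gens: "gen (Vertex v) \<in> carrier ?F" if "v \<in> verts G" for v
    using that by (intro gen) (simp add: lpa_gens_def)
  have gens2: "gen (Edge e) \<in> carrier ?F" "gen (Ghost e) \<in> carrier ?F" if "e \<in> arcs G" for e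
    by (intro gen; use that in \<open>simp add: lpa_gens_def\<close>)+
  show ?thesis
    unfolding lpa_relators_def
    by (auto intro!: diff mult sum gens gens2 zero simp: regular_vertex_def out_arcs_def)
qed

lemma rng_ideal_lpa_rel_ideal:
  assumes "wf_digraph G"
  shows "rng_ideal (lpa_rel_ideal G) (free_rng (lpa_gens G))"
proof -
  let ?F = "free_rng (lpa_gens G) :: (('a, 'b) lpa_gen free_word \<Rightarrow>\<^sub>0 'c) ring"
  let ?\<J> = "{J. rng_ideal J ?F \<and>
     (\<forall>c. \<forall>p\<in>J. Poly_Mapping.single 0 c * p \<in> J) \<and> lpa_relators G \<subseteq> J}"
  interpret rng ?F by (rule rng_free_rng)
  have "Poly_Mapping.single 0 c * p \<in> carrier ?F" if "p \<in> carrier ?F" for c p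
    using that keys_mult[of "Poly_Mapping.single 0 c" p]
    by (fastforce simp: free_rng_def split: if_splits)
  moreover have "rng_ideal (carrier ?F) ?F"
    using add.subgroup_self m_closed by (simp add: rng_ideal_def additive_subgroup_def)
  ultimately have ne: "carrier ?F \<in> ?\<J>"
    using lpa_relators_carrier[OF assms] by auto
  have sub: "subgroup J (add_monoid ?F)" if "J \<in> ?\<J>" for J
    using that by (auto simp: rng_ideal_def additive_subgroup_def)
  have "subgroup (\<Inter>?\<J>) (add_monoid ?F)"
    by (rule add.subgroups_Inter[OF sub]) (use ne in blast)+
  then show ?thesis
    unfolding lpa_rel_ideal_def free_genideal_def rng_ideal_def
    by (auto simp: additive_subgroup_def rng_ideal_def)
qed

lemma rng_leavitt_path_algebra:
  "wf_digraph G \<Longrightarrow> rng (leavitt_path_algebra G)"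
  unfolding leavitt_path_algebra_def
  by (intro rng_Quot rng_free_rng rng_ideal_lpa_rel_ideal)
end

(*
  Let H be the set of vertices in I and J = I(H). If I were larger than J, the usual reduction
  (multiplying by ghost paths) would produce, modulo J, one of two elements of I: the gap
  q = v - sum e e^* over the finitely many edges e from v that remain outside H, or a polynomial
  v + sum k_c c in closed paths at a vertex v. Choosing the latter with the fewest terms forces the
  cycle through v to have no exit. In both cases a corner of the algebra modulo J is commutative: it
  consists of the scalars in the first case and of Laurent polynomials in the second.

  Such a corner w contradicts pure infiniteness as soon as some u in I and in the corner is not
  quasi-regular. Take an ideal M that is maximal with w - u in M and w not in M; modulo M the corner is
  a field and w lies in I. Either w is a unit modulo M, so that I has a division ring as a
  quotient, or I contains, modulo M, two orthogonal copies of w, whose sum is no product x w y.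
*)
theory Submission
  imports Defs "HOL-Library.Sublist"
begin

section \<open>Two-sided ideals\<close>

text \<open>An ideal generated by vertices is graded, and a graded ideal may still need, besides
  vertices, the gaps at vertices with infinitely many edges of which finitely many, at least one,
  end outside \<open>H\<close>. The two outcomes of the reduction, gap and polynomial, are these two
  obstructions. They also explain the Cohn setting: modulo \<open>J\<close> the relation at a vertex
  that is regular in the graph outside \<open>H\<close> may fail, and the gap measures the failure.

  An element that is not quasi-regular is easily found at a gap, where \<open>u = q\<close> makes
  \<open>w - u\<close> zero. At a cycle \<open>c\<close> the obstacle is that Laurent polynomials
  have many units, the powers of the cycle; the choice \<open>u = y c\<close>, with \<open>y\<close>
  the polynomial in \<open>I\<close>, forces two extreme terms in \<open>w - u\<close>. They can be
  compared degree by degree because \<open>J\<close> is graded.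

  Passing to \<open>M\<close> loses the grading but uses only an abstract corner, so this half is
  done for an arbitrary ring. The computations are congruences in one free unital algebra: carrier
  conditions disappear, and complements such as \<open>1 - w\<close> make sense although neither
  \<open>I\<close> nor the Leavitt path algebra need have a unit.\<close>

locale two_sided_ideal =
  fixes J :: "'a::ring_1 set"
  assumes zero: "0 \<in> J"
    and add: "\<lbrakk>x \<in> J; y \<in> J\<rbrakk> \<Longrightarrow> x + y \<in> J"
    and lmult: "x \<in> J \<Longrightarrow> a * x \<in> J"
    and rmult: "x \<in> J \<Longrightarrow> x * a \<in> J"
begin


definition eqv :: "'a \<Rightarrow> 'a \<Rightarrow> bool" (infix \<open>\<approx>\<close> 50) where
  "x \<approx> y \<longleftrightarrow> x - y \<in> J"

lemma uminus: "x \<in> J \<Longrightarrow> - x \<in> J"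
  using lmult[of x "-1"] by simp

lemma diff: "\<lbrakk>x \<in> J; y \<in> J\<rbrakk> \<Longrightarrow> x - y \<in> J"
  using add[of x "- y"] uminus by simp

lemma sum: "(\<And>i. i \<in> A \<Longrightarrow> f i \<in> J) \<Longrightarrow> sum f A \<in> J"
  by (induction A rule: infinite_finite_induct) (auto intro: zero add)

lemma eqv_refl [simp, intro]: "x \<approx> x"
  by (simp add: eqv_def zero)

lemma eqv_sym: "x \<approx> y \<Longrightarrow> y \<approx> x"
  using uminus[of "x - y"] by (simp add: eqv_def)

lemma eqv_trans [trans]: "x \<approx> y \<Longrightarrow> y \<approx> z \<Longrightarrow> x \<approx> z"
  using add[of "x - y" "y - z"] by (simp add: eqv_def)

lemma eqv_add: "x \<approx> x' \<Longrightarrow> y \<approx> y' \<Longrightarrow> x + y \<approx> x' + y'"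
  using add[of "x - x'" "y - y'"] by (simp add: eqv_def algebra_simps)

lemma eqv_diff: "x \<approx> x' \<Longrightarrow> y \<approx> y' \<Longrightarrow> x - y \<approx> x' - y'"
  using diff[of "x - x'" "y - y'"] by (simp add: eqv_def algebra_simps)

lemma eqv_lmult: "x \<approx> y \<Longrightarrow> a * x \<approx> a * y"
  using lmult[of "x - y" a] by (simp add: eqv_def algebra_simps)

lemma eqv_rmult: "x \<approx> y \<Longrightarrow> x * a \<approx> y * a"
  using rmult[of "x - y" a] by (simp add: eqv_def algebra_simps)

lemma eqv_mult: "x \<approx> x' \<Longrightarrow> y \<approx> y' \<Longrightarrow> x * y \<approx> x' * y'"
  by (meson eqv_lmult eqv_rmult eqv_trans)

lemma eqv_sum: "(\<And>i. i \<in> A \<Longrightarrow> f i \<approx> g i) \<Longrightarrow> sum f A \<approx> sum g A"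
  using sum[of A "\<lambda>i. f i - g i"] by (simp add: eqv_def sum_subtractf)

lemma mem_iff_eqv_zero: "x \<in> J \<longleftrightarrow> x \<approx> 0"
  by (simp add: eqv_def)

lemma mem_cong: "x \<approx> y \<Longrightarrow> x \<in> J \<longleftrightarrow> y \<in> J"
  using mem_iff_eqv_zero eqv_sym eqv_trans by blast

end

definition ideal_gen :: "'a::ring_1 set \<Rightarrow> 'a set" where
  "ideal_gen S = \<Inter>{M. two_sided_ideal M \<and> S \<subseteq> M}"

lemma two_sided_ideal_gen: "two_sided_ideal (ideal_gen S)"
  by unfold_locales
    (auto simp: ideal_gen_def intro: two_sided_ideal.zero two_sided_ideal.add
      two_sided_ideal.lmult two_sided_ideal.rmult)

lemma ideal_gen_superset: "S \<subseteq> ideal_gen S"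
  unfolding ideal_gen_def by blast

lemma ideal_gen_minimal: "two_sided_ideal M \<Longrightarrow> S \<subseteq> M \<Longrightarrow> ideal_gen S \<subseteq> M"
  unfolding ideal_gen_def by blast

lemma two_sided_ideal_Union_chain:
  assumes "\<And>M. M \<in> C \<Longrightarrow> two_sided_ideal M" "C \<noteq> {}" "subset.chain UNIV C"
  shows "two_sided_ideal (\<Union>C)"
proof
  fix x y assume "x \<in> \<Union>C" "y \<in> \<Union>C"
  then obtain M N where MN: "M \<in> C" "N \<in> C" "x \<in> M" "y \<in> N" by blast
  then have "M \<subseteq> N \<or> N \<subseteq> M" using assms(3) by (auto simp: subset.chain_def)
  then show "x + y \<in> \<Union>C"
    using MN assms(1) two_sided_ideal.add by (metis Union_iff subsetD)
qed (use assms in \<open>auto intro: two_sided_ideal.zero two_sided_ideal.lmult two_sided_ideal.rmult\<close>)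

text \<open>The corner at \<open>v\<close> of the ambient ring modulo \<open>J\<close>. The inner
  \<open>v\<close> stands for the two adjacent ones in \<open>(v * x * v) * (v * y * v)\<close>, so
  the second assumption is commutativity of the corner.\<close>

locale commutative_corner = two_sided_ideal J for J :: "'a::ring_1 set" +
  fixes v :: 'a
  assumes idem: "v * v \<approx> v"
    and corner_comm: "v * x * v * y * v \<approx> v * y * v * x * v"
begin


lemma commutative_corner_mono:
  assumes "two_sided_ideal M" "J \<subseteq> M"
  shows "commutative_corner M v"
proof -
  interpret M: two_sided_ideal M by fact
  show ?thesis
    using idem corner_comm assms(2) by unfold_locales (auto simp: eqv_def M.eqv_def)
qed

text \<open>The elements \<open>m\<close> with every \<open>v * a * m * b * v\<close> in the right
  ideal of \<open>w\<close> modulo \<open>J\<close> form a two-sided ideal. Commutativity of the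
  corner moves \<open>w\<close> to the front, so \<open>w\<close> belongs to it; hence so does
  \<open>v\<close>.\<close>

lemma corner_inverse:
  assumes w: "v * w * v \<approx> w" and v: "v \<in> ideal_gen (insert w J)"
  shows "\<exists>z. w * z \<approx> v"
proof -
  define N where "N = {m. \<forall>a b. \<exists>z. v * a * m * b * v \<approx> w * z}"
  have "two_sided_ideal N"
  proof
    show "0 \<in> N" unfolding N_def by (auto intro!: exI[of _ 0])
    show "x + y \<in> N" if x: "x \<in> N" and y: "y \<in> N" for x y
      unfolding N_def
    proof (intro CollectI allI)
      fix a b
      obtain z z' where "v * a * x * b * v \<approx> w * z" "v * a * y * b * v \<approx> w * z'"
        using x y unfolding N_def by blast
      from eqv_add[OF this] have "v * a * (x + y) * b * v \<approx> w * (z + z')"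
        by (simp add: algebra_simps)
      then show "\<exists>z. v * a * (x + y) * b * v \<approx> w * z" by blast
    qed
    fix x c assume x: "x \<in> N"
    show "c * x \<in> N"
      unfolding N_def
    proof (intro CollectI allI)
      fix a b
      have "\<exists>z. v * (a * c) * x * b * v \<approx> w * z" using x unfolding N_def by blast
      then show "\<exists>z. v * a * (c * x) * b * v \<approx> w * z" by (simp add: mult.assoc)
    qed
    show "x * c \<in> N"
      unfolding N_def
    proof (intro CollectI allI)
      fix a b
      have "\<exists>z. v * a * x * (c * b) * v \<approx> w * z" using x unfolding N_def by blast
      then show "\<exists>z. v * a * (x * c) * b * v \<approx> w * z" by (simp add: mult.assoc)
    qed
  qed
  moreover have "w \<in> N"
    unfolding N_def
  proof (intro CollectI allI)
    fix a b
    have "v * a * w * b * v \<approx> v * a * (v * w * v) * b * v"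
      by (intro eqv_rmult eqv_lmult eqv_sym[OF w])
    also have "\<dots> = (v * a * v * w * v) * (b * v)" by (simp add: mult.assoc)
    also have "\<dots> \<approx> (v * w * v * a * v) * (b * v)" by (rule eqv_rmult[OF corner_comm])
    also have "\<dots> = (v * w * v) * (a * v * b * v)" by (simp add: mult.assoc)
    also have "\<dots> \<approx> w * (a * v * b * v)" by (rule eqv_rmult[OF w])
    finally show "\<exists>z. v * a * w * b * v \<approx> w * z" by blast
  qed
  moreover have "J \<subseteq> N"
  proof
    fix x assume "x \<in> J"
    then have "v * a * x * b * v \<approx> w * 0" for a b
      by (simp add: eqv_def lmult rmult)
    then show "x \<in> N" unfolding N_def by blast
  qed
  ultimately have "v \<in> N" using ideal_gen_minimal[of N "insert w J"] v by blast
  then obtain z where "v * 1 * v * 1 * v \<approx> w * z" unfolding N_def by blast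
  moreover have "v * v * v \<approx> v" by (rule eqv_trans[OF eqv_rmult[OF idem] idem])
  ultimately have "w * z \<approx> v" by (metis eqv_sym eqv_trans mult.right_neutral)
  then show ?thesis ..
qed

end

section \<open>Commutative corners of purely infinite ideals\<close>

text \<open>Maximality among the ideals that avoid \<open>v\<close> has two effects: the corner
  becomes a field, and every nonzero element of the quotient leaves a nonzero trace in the
  corner.\<close>

locale maximal_corner = commutative_corner +
  assumes not_mem: "v \<notin> J"
    and maximal: "\<lbrakk>two_sided_ideal N; J \<subseteq> N; v \<notin> N\<rbrakk> \<Longrightarrow> N \<subseteq> J"
begin

text \<open>The elements without trace in the corner form an ideal that contains \<open>J\<close>
  but not \<open>v\<close>, so maximality puts it inside \<open>J\<close>.\<close>

lemma mem_if_corners_mem: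
  assumes "\<And>a b. v * a * m * b * v \<in> J"
  shows "m \<in> J"
proof -
  define N where "N = {m. \<forall>a b. v * a * m * b * v \<in> J}"
  have "two_sided_ideal N"
  proof
    fix x c assume x: "x \<in> N"
    have "v * (a * c) * x * b * v \<in> J" "v * a * x * (c * b) * v \<in> J" for a b
      using x unfolding N_def by blast+
    then show "c * x \<in> N" "x * c \<in> N"
      by (simp_all add: N_def mult.assoc)
  qed (auto simp: N_def zero distrib_left distrib_right intro: add)
  moreover have "J \<subseteq> N"
    by (auto simp: N_def intro: lmult rmult)
  moreover have "v \<notin> N"
  proof
    assume "v \<in> N"
    then have "v * 1 * v * 1 * v \<in> J" unfolding N_def by blast
    moreover have "v * v * v \<approx> v" by (rule eqv_trans[OF eqv_rmult[OF idem] idem])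
    ultimately show False using not_mem mem_cong by simp
  qed
  ultimately have "N \<subseteq> J" by (rule maximal)
  then show ?thesis using assms unfolding N_def by blast
qed

lemma corner_right_inverse:
  assumes "v * w * v \<approx> w" "w \<notin> J"
  shows "\<exists>z. w * z \<approx> v"
proof (rule corner_inverse[OF assms(1)])
  show "v \<in> ideal_gen (insert w J)"
  proof (rule ccontr)
    assume "v \<notin> ideal_gen (insert w J)"
    then have "ideal_gen (insert w J) \<subseteq> J"
      using ideal_gen_superset[of "insert w J"] by (intro maximal two_sided_ideal_gen) auto
    then show False using ideal_gen_superset[of "insert w J"] assms(2) by auto
  qed
qed

lemma corner_left_inverse:
  assumes w: "v * w * v \<approx> w" "w \<notin> J"
  shows "\<exists>z. v * z * v * w \<approx> v"
proof -
  obtain z where z: "w * z \<approx> v" using corner_right_inverse[OF w] by blast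
  have "v * z * v * w \<approx> v * z * v * (v * w * v)" by (intro eqv_lmult eqv_sym[OF w(1)])
  also have "\<dots> = v * z * (v * v) * w * v" by (simp add: mult.assoc)
  also have "\<dots> \<approx> v * z * v * w * v" by (intro eqv_rmult eqv_lmult idem)
  also have "\<dots> \<approx> v * w * v * z * v" by (rule corner_comm)
  also have "\<dots> \<approx> w * z * v" by (intro eqv_rmult w)
  also have "\<dots> \<approx> v * v" by (intro eqv_rmult z)
  also have "\<dots> \<approx> v" by (rule idem)
  finally show ?thesis ..
qed

text \<open>Testing on corners shows that right multiplication by \<open>v\<close> is injective on
  the quotient. Both identities hold after multiplication by \<open>v\<close>, which is then
  cancelled.\<close>

lemma unit_if_absorbing:
  assumes absorb: "\<And>x. x * v \<approx> v * x * v"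
  shows "v * x \<approx> x" "x * v \<approx> x"
proof -
  have mem: "t \<in> J" if "t * v \<in> J" for t
  proof (rule mem_if_corners_mem)
    fix a b
    have "v * a * t * b * v = (v * a * t) * (b * v)" by (simp add: mult.assoc)
    also have "\<dots> \<approx> (v * a * t) * (v * b * v)" by (rule eqv_lmult[OF absorb])
    also have "\<dots> = v * a * (t * v) * b * v" by (simp add: mult.assoc)
    finally show "v * a * t * b * v \<in> J"
      using mem_cong lmult[OF that] rmult by blast
  qed
  have "(v * x - x) * v \<in> J"
    using eqv_sym[OF absorb[of x]] by (simp add: eqv_def algebra_simps)
  then show "v * x \<approx> x" using mem by (simp add: eqv_def)
  have "x * v * v \<approx> x * v"
    using eqv_lmult[OF idem] by (simp add: mult.assoc)
  then have "(x * v - x) * v \<in> J"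
    by (simp add: eqv_def algebra_simps)
  then show "x * v \<approx> x" using mem by (simp add: eqv_def)
qed

text \<open>The Peirce component \<open>x' = (1 - v) x v\<close> is nonzero, so some corner element
  built from it is invertible. The inverse, cut off on the right by \<open>1 - v\<close>, yields
  \<open>y\<close>. Then \<open>x' * y\<close> is an idempotent orthogonal to \<open>v\<close> and
  equivalent to it: the second copy of \<open>v\<close>.\<close>

lemma orthogonal_factors:
  assumes "\<not> x * v \<approx> v * x * v"
  shows "\<exists>x' y. v * x' \<approx> 0 \<and> x' * v \<approx> x' \<and> y * v \<approx> 0 \<and> v * y \<approx> y \<and> y * x' \<approx> v"
proof -
  define x' where "x' = x * v - v * x * v"
  have vx': "v * x' \<approx> 0"
  proof -
    have "v * x' = (v - v * v) * (x * v)" by (simp add: x'_def algebra_simps)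
    moreover have "v - v * v \<approx> v - v" by (intro eqv_diff idem eqv_refl)
    ultimately show ?thesis using rmult mem_iff_eqv_zero by fastforce
  qed
  have x'v: "x' * v \<approx> x'"
  proof -
    have "x' * v = (x - v * x) * (v * v)" by (simp add: x'_def algebra_simps)
    also have "\<dots> \<approx> (x - v * x) * v" by (rule eqv_lmult[OF idem])
    finally show ?thesis by (simp add: x'_def algebra_simps)
  qed
  have "x' \<notin> J" using assms by (simp add: x'_def eqv_def)
  then obtain a b where ab: "v * a * x' * b * v \<notin> J" using mem_if_corners_mem by blast
  define w where "w = v * a * x' * v"
  have wv: "v * w * v \<approx> w"
  proof -
    have "v * w * v = (v * v) * (a * x' * (v * v))" by (simp add: w_def mult.assoc)
    also have "\<dots> \<approx> v * (a * x' * v)" by (intro eqv_mult eqv_lmult idem)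
    finally show ?thesis by (simp add: w_def mult.assoc)
  qed
  have "v * a * x' * b * v \<approx> v * a * (x' * v) * b * v"
    by (intro eqv_rmult eqv_lmult eqv_sym[OF x'v])
  also have "\<dots> = w * (b * v)" by (simp add: w_def mult.assoc)
  finally have "w \<notin> J" using ab rmult mem_cong by blast
  then obtain z where z: "v * z * v * w \<approx> v" using corner_left_inverse[OF wv] by blast
  define y0 where "y0 = v * z * v * a"
  define y where "y = y0 - y0 * v"
  have "y * v = y0 * (v - v * v)" by (simp add: y_def algebra_simps)
  moreover have "v - v * v \<approx> v - v" by (intro eqv_diff idem eqv_refl)
  ultimately have yv: "y * v \<approx> 0" using lmult mem_iff_eqv_zero by fastforce
  have "v * y0 = (v * v) * (z * v * a)" by (simp add: y0_def mult.assoc)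
  also have "\<dots> \<approx> v * (z * v * a)" by (rule eqv_rmult[OF idem])
  finally have vy0: "v * y0 \<approx> y0" by (simp add: y0_def mult.assoc)
  then have vy: "v * y \<approx> y"
    using eqv_diff[OF vy0 eqv_rmult[OF vy0, of v]] by (simp add: y_def algebra_simps)
  have "y * x' = y0 * x' - y0 * (v * x')" by (simp add: y_def algebra_simps)
  also have "\<dots> \<approx> y0 * (x' * v) - y0 * 0"
    by (intro eqv_diff eqv_lmult vx' eqv_sym[OF x'v])
  also have "\<dots> = v * z * v * (a * x' * v)" by (simp add: y0_def mult.assoc)
  also have "\<dots> \<approx> v * z * (v * v) * (a * x' * v)"
    by (intro eqv_rmult eqv_lmult eqv_sym[OF idem])
  also have "\<dots> = v * z * v * w" by (simp add: w_def mult.assoc)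
  also note z
  finally show ?thesis using vx' x'v yv vy by blast
qed

text \<open>Compressed to the two copies of \<open>v\<close>, the sum \<open>v + x * y\<close>
  becomes the identity 2 by 2 matrix over the corner, and \<open>s * v * t\<close> a column
  \<open>(a, b)\<close> times a row \<open>(c, d)\<close>. This is impossible over a commutative
  ring: \<open>a c = 1\<close> and \<open>a d = 0\<close> give \<open>b d = b (c a) d = 0\<close>,
  against \<open>b d = 1\<close>. The facts \<open>pq\<close>, \<open>pr\<close> and
  \<open>wr\<close> are these three entries.\<close>

lemma orthogonal_sum_not_simple_product:
  assumes vx: "v * x \<approx> 0" "x * v \<approx> x" and y: "y * v \<approx> 0" "v * y \<approx> y" and yx: "y * x \<approx> v"
  shows "\<not> s * v * t \<approx> v + x * y"
proof
  assume st: "s * v * t \<approx> v + x * y"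
  have vv: "v * v * v \<approx> v" by (rule eqv_trans[OF eqv_rmult[OF idem] idem])
  have pq: "v * s * v * t * v \<approx> v"
  proof -
    have "v * s * v * t * v = v * (s * v * t) * v" by (simp add: mult.assoc)
    also have "\<dots> \<approx> v * (v + x * y) * v" by (intro eqv_rmult eqv_lmult st)
    also have "\<dots> = v * v * v + v * x * (y * v)" by (simp add: algebra_simps)
    also have "\<dots> \<approx> v + v * x * 0" by (intro eqv_add vv eqv_lmult y)
    finally show ?thesis by simp
  qed
  have pr: "v * s * v * t * x \<approx> 0"
  proof -
    have "v * s * v * t * x = v * (s * v * t) * x" by (simp add: mult.assoc)
    also have "\<dots> \<approx> v * (v + x * y) * x" by (intro eqv_rmult eqv_lmult st)
    also have "\<dots> = v * (v * x) + (v * x) * (y * x)" by (simp add: algebra_simps)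
    also have "\<dots> \<approx> v * 0 + 0 * (y * x)" by (intro eqv_add eqv_lmult eqv_rmult vx)
    finally show ?thesis by simp
  qed
  have wr: "y * s * v * t * x \<approx> v"
  proof -
    have "y * s * v * t * x = y * (s * v * t) * x" by (simp add: mult.assoc)
    also have "\<dots> \<approx> y * (v + x * y) * x" by (intro eqv_rmult eqv_lmult st)
    also have "\<dots> = y * (v * x) + (y * x) * (y * x)" by (simp add: algebra_simps)
    also have "\<dots> \<approx> y * 0 + v * v" by (intro eqv_add eqv_lmult eqv_mult vx yx)
    also have "\<dots> \<approx> v" using idem by simp
    finally show ?thesis .
  qed
  have "v \<approx> y * s * v * t * x" by (rule eqv_sym[OF wr])
  also have "\<dots> = y * s * v * (t * x)" by (simp add: mult.assoc)
  also have "\<dots> \<approx> y * s * (v * t * v * s * v) * (t * x)"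
    by (intro eqv_rmult eqv_lmult eqv_sym[OF eqv_trans[OF corner_comm pq]])
  also have "\<dots> = y * s * v * t * (v * s * v * t * x)" by (simp add: mult.assoc)
  also have "\<dots> \<approx> y * s * v * t * 0" by (rule eqv_lmult[OF pr])
  finally show False using not_mem mem_iff_eqv_zero by simp
qed

end

lemma (in commutative_corner) ex_maximal_corner:
  assumes K: "two_sided_ideal K" "J \<subseteq> K" "v \<notin> K"
  obtains M where "K \<subseteq> M" "maximal_corner M v"
proof -
  define S where "S = {M. two_sided_ideal M \<and> K \<subseteq> M \<and> v \<notin> M}"
  have "\<exists>M\<in>S. \<forall>X\<in>S. M \<subseteq> X \<longrightarrow> X = M"
  proof (rule subset_Zorn_nonempty)
    show "S \<noteq> {}" using K by (auto simp: S_def)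
    show "\<Union>C \<in> S" if C: "C \<noteq> {}" "subset.chain S C" for C
    proof -
      have "C \<subseteq> S" "subset.chain UNIV C" using C(2) by (auto simp: subset.chain_def)
      then have "two_sided_ideal (\<Union>C)"
        by (intro two_sided_ideal_Union_chain C(1)) (auto simp: S_def)
      moreover have "K \<subseteq> \<Union>C" "v \<notin> \<Union>C" using \<open>C \<subseteq> S\<close> C(1) by (auto simp: S_def)
      ultimately show ?thesis by (simp add: S_def)
    qed
  qed
  then obtain M where M: "M \<in> S" and max: "\<And>X. X \<in> S \<Longrightarrow> M \<subseteq> X \<Longrightarrow> X = M" by blast
  then have idM: "two_sided_ideal M" "J \<subseteq> M" "K \<subseteq> M" "v \<notin> M" using K by (auto simp: S_def)
  interpret M: commutative_corner M v by (rule commutative_corner_mono) fact+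
  have "maximal_corner M v"
    by unfold_locales (use idM max in \<open>auto simp: S_def\<close>)
  then show thesis using idM that by blast
qed

text \<open>
  The two defining conditions of a purely infinite ring, for the ideal \<open>I / P\<close> of the quotient by an
  ideal \<open>P\<close>; only sums of two terms are used.
\<close>

locale purely_infinite_ideal = P: two_sided_ideal P + I: two_sided_ideal I
  for P I :: "'a::ring_1 set" +
  assumes no_division_quotient:
      "\<lbrakk>two_sided_ideal M; P \<subseteq> M; u \<in> I; u \<notin> M;
        \<And>x. x \<in> I \<Longrightarrow> u * x - x \<in> M; \<And>x. x \<in> I \<Longrightarrow> x * u - x \<in> M;
        \<And>x. \<lbrakk>x \<in> I; x \<notin> M\<rbrakk> \<Longrightarrow> \<exists>y\<in>I. x * y - u \<in> M \<and> y * x - u \<in> M\<rbrakk> \<Longrightarrow> False"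
    and sandwich: "\<lbrakk>a \<in> I; x \<in> I; y \<in> I; x' \<in> I; y' \<in> I\<rbrakk>
      \<Longrightarrow> \<exists>s\<in>I. \<exists>t\<in>I. s * a * t - (x * a * y + x' * a * y') \<in> P"
begin

text \<open>
  Otherwise some maximal ideal makes the corner at \<open>v\<close> a field with unit \<open>v = u\<close>. Either \<open>v\<close> is then a
  unit of the whole quotient, so that \<open>I\<close> has a division ring as a quotient, or some sum of
  two elements of \<open>I v I\<close> has rank two over the corner and is no product \<open>s v t\<close>.
\<close>

lemma commutative_corner_quasi_regular:
  assumes J: "commutative_corner J v" and PJ: "P \<subseteq> J"
    and u: "u \<in> I" "v * u - u \<in> J" "u * v - u \<in> J"
  shows "\<exists>z. (v - u) * z - v \<in> J"
proof -
  interpret commutative_corner J v by fact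
  have vu: "v * (v - u) * v \<approx> v - u"
  proof -
    have "v * (v - u) * v = (v * v) * v - (v * u) * v" by (simp add: algebra_simps)
    also have "\<dots> \<approx> v * v - u * v" by (intro eqv_diff eqv_rmult idem) (use u in \<open>simp add: eqv_def\<close>)
    also have "\<dots> \<approx> v - u" by (intro eqv_diff idem) (use u in \<open>simp add: eqv_def\<close>)
    finally show ?thesis .
  qed
  have "v \<in> ideal_gen (insert (v - u) J)"
  proof (rule ccontr)
    assume "v \<notin> ideal_gen (insert (v - u) J)"
    then obtain M where M: "ideal_gen (insert (v - u) J) \<subseteq> M" "maximal_corner M v"
      using ex_maximal_corner two_sided_ideal_gen ideal_gen_superset by (metis insert_subset)
    then have JM: "J \<subseteq> M" and vuM: "v - u \<in> M"
      using ideal_gen_superset[of "insert (v - u) J"] by auto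
    interpret M: maximal_corner M v by (rule M)
    have v_eq: "M.eqv v u" using vuM by (simp add: M.eqv_def)
    have uM: "u \<notin> M" using M.mem_cong[OF v_eq] M.not_mem by simp
    show False
    proof (cases "\<forall>x. M.eqv (x * v) (v * x * v)")
      case True
      then have unit: "M.eqv (v * x) x" "M.eqv (x * v) x" for x
        using M.unit_if_absorbing by blast+
      then have unit_u: "M.eqv (u * x) x" "M.eqv (x * u) x" for x
        by (meson M.eqv_lmult M.eqv_rmult M.eqv_sym M.eqv_trans v_eq)+
      have "\<exists>y\<in>I. x * y - u \<in> M \<and> y * x - u \<in> M" if xI: "x \<in> I" and xM: "x \<notin> M" for x
      proof -
        have x: "M.eqv (v * x * v) x" by (meson M.eqv_rmult M.eqv_trans unit)
        obtain z where z: "M.eqv (x * z) v" using M.corner_right_inverse[OF x xM] by blast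
        obtain y where y: "M.eqv (v * y * v * x) v" using M.corner_left_inverse[OF x xM] by blast
        \<comment> \<open>The inverse has to lie in \<open>I\<close>, hence \<open>u * z\<close> in
          place of \<open>z\<close>.\<close>
        have "M.eqv (x * (u * z)) (x * z)" by (intro M.eqv_lmult unit_u)
        then have r: "M.eqv (x * (u * z)) u" using z v_eq M.eqv_trans by blast
        define y' where "y' = v * y * v"
        \<comment> \<open>The left inverse \<open>y'\<close> and the right inverse
          \<open>u * z\<close> agree modulo \<open>M\<close>, so \<open>u * z\<close> is inverse on
          both sides.\<close>
        have "M.eqv (u * z) (v * (u * z))" by (intro M.eqv_sym[OF unit(1)])
        also have "M.eqv \<dots> ((y' * x) * (u * z))"
          unfolding y'_def by (intro M.eqv_rmult M.eqv_sym[OF y])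
        also have "\<dots> = y' * (x * (u * z))" by (simp add: mult.assoc)
        also have "M.eqv \<dots> (y' * u)" by (intro M.eqv_lmult r)
        also have "M.eqv \<dots> y'" by (rule unit_u)
        finally have "M.eqv (u * z * x) (y' * x)" by (rule M.eqv_rmult)
        also have "M.eqv \<dots> v" unfolding y'_def by (rule y)
        also note v_eq
        finally show ?thesis using r u(1) I.rmult by (auto simp: M.eqv_def intro!: bexI[of _ "u * z"])
      qed
      then show False
        using no_division_quotient[OF M.two_sided_ideal_axioms _ u(1) uM] PJ JM unit_u
        by (auto simp: M.eqv_def)
    next
      case False
      then obtain x y where x: "M.eqv (v * x) 0" "M.eqv (x * v) x"
        and y: "M.eqv (y * v) 0" "M.eqv (v * y) y" and yx: "M.eqv (y * x) v"
        using M.orthogonal_factors by blast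
      \<comment> \<open>The factors \<open>x\<close> and \<open>y\<close> need not lie in
        \<open>I\<close>. Multiplied by \<open>u\<close>, which is \<open>v\<close> modulo
        \<open>M\<close>, they do, and the sum still reduces to \<open>v + x * y\<close>.\<close>
      obtain s t where "s * u * t - (u * u * u + (x * u) * u * (u * y)) \<in> P"
        using sandwich[of u u u "x * u" "u * y"] u(1) I.lmult I.rmult by blast
      then have "M.eqv (s * u * t) (u * u * u + (x * u) * u * (u * y))"
        using PJ JM by (auto simp: M.eqv_def)
      moreover have "M.eqv (s * v * t) (s * u * t)" by (intro M.eqv_rmult M.eqv_lmult v_eq)
      moreover have "M.eqv (u * u * u + (x * u) * u * (u * y)) (v * v * v + (x * v) * v * (v * y))"
        by (intro M.eqv_add M.eqv_mult M.eqv_refl M.eqv_sym[OF v_eq])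
      moreover have "M.eqv (v * v * v + (x * v) * v * (v * y)) (v + x * y)"
        by (intro M.eqv_add M.eqv_mult y M.eqv_trans[OF M.eqv_rmult[OF M.idem] M.idem]
              M.eqv_trans[OF M.eqv_rmult[OF x(2)] x(2)])
      ultimately have "M.eqv (s * v * t) (v + x * y)" by (meson M.eqv_trans)
      then show False using M.orthogonal_sum_not_simple_product[OF x y yx] by blast
    qed
  qed
  from corner_inverse[OF vu this] show ?thesis by (simp add: eqv_def)
qed

end

section \<open>Free algebras and their grading\<close>

lemma sum_single_keys: "(\<Sum>w\<in>Poly_Mapping.keys p. Poly_Mapping.single w (Poly_Mapping.lookup p w)) = p"
  by (intro poly_mapping_eqI)
    (auto simp: lookup_sum lookup_single when_def in_keys_iff sum.delta)

lemma poly_mapping_single_induct [case_names single add]: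
  fixes p :: "'a \<Rightarrow>\<^sub>0 'b::comm_monoid_add"
  assumes single: "\<And>w c. Q (Poly_Mapping.single w c)"
    and add: "\<And>p q. Q p \<Longrightarrow> Q q \<Longrightarrow> Q (p + q)"
  shows "Q p"
proof -
  have "Q (\<Sum>w\<in>A. Poly_Mapping.single w (Poly_Mapping.lookup p w))" for A
    using single[of undefined 0]
    by (induction A rule: infinite_finite_induct) (auto intro: add single)
  from this[of "Poly_Mapping.keys p"] show ?thesis by (simp add: sum_single_keys)
qed

abbreviation scalar :: "'k \<Rightarrow> ('g free_word \<Rightarrow>\<^sub>0 'k::field)" where
  "scalar c \<equiv> Poly_Mapping.single 0 c"

lemma scalar_mult [simp]: "scalar (a * b) = scalar a * scalar b"
  by (simp add: mult_single)

lemma scalar_commute: "p * scalar c = scalar c * p"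
  by (induction p rule: poly_mapping_single_induct)
    (simp_all add: mult_single algebra_simps)

lemma scalar_commute': "x * (scalar c * y) = scalar c * (x * y)"
  by (metis scalar_commute mult.assoc)

lemma single_word:
  "Poly_Mapping.single (Word xs) (c::'k::field) = scalar c * prod_list (map gen xs)"
proof -
  have "prod_list (map gen xs) = Poly_Mapping.single (Word xs) (1::'k)"
    by (induction xs)
      (simp_all add: gen_def mult_single plus_free_word_def flip: zero_free_word_def)
  then show ?thesis by (simp add: mult_single)
qed

text \<open>Serves twice: for homogeneous components, and for discarding words that use letters
  foreign to the given graph.\<close>

definition restrict_words :: "'g free_word set \<Rightarrow> ('g free_word \<Rightarrow>\<^sub>0 'k::field) \<Rightarrow> ('g free_word \<Rightarrow>\<^sub>0 'k)" where
  "restrict_words A = Poly_Mapping.mapp (\<lambda>w c. if w \<in> A then c else 0)"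

lemma lookup_restrict_words:
  "Poly_Mapping.lookup (restrict_words A p) w = (if w \<in> A then Poly_Mapping.lookup p w else 0)"
  by (simp add: restrict_words_def lookup_mapp when_def in_keys_iff)

lemma restrict_words_add: "restrict_words A (p + q) = restrict_words A p + restrict_words A q"
  by (intro poly_mapping_eqI) (simp add: lookup_restrict_words lookup_add)

lemma restrict_words_zero [simp]: "restrict_words A 0 = 0"
  by (intro poly_mapping_eqI) (simp add: lookup_restrict_words)

lemma restrict_words_diff: "restrict_words A (p - q) = restrict_words A p - restrict_words A q"
  by (intro poly_mapping_eqI) (simp add: lookup_restrict_words lookup_minus)

lemma restrict_words_sum: "restrict_words A (\<Sum>i\<in>S. f i) = (\<Sum>i\<in>S. restrict_words A (f i))"
  by (induction S rule: infinite_finite_induct) (simp_all add: restrict_words_add)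

lemma restrict_words_single:
  "restrict_words A (Poly_Mapping.single w c) = (if w \<in> A then Poly_Mapping.single w c else 0)"
  by (intro poly_mapping_eqI) (auto simp: lookup_restrict_words lookup_single when_def)

lemma keys_restrict_words: "Poly_Mapping.keys (restrict_words A p) = Poly_Mapping.keys p \<inter> A"
  by (auto simp: in_keys_iff lookup_restrict_words split: if_splits)

lemma restrict_words_idem: "Poly_Mapping.keys p \<subseteq> A \<Longrightarrow> restrict_words A p = p"
  by (intro poly_mapping_eqI) (auto simp: lookup_restrict_words in_keys_iff)

section \<open>The grading by word degree\<close>

definition word_degree :: "('v, 'e) lpa_gen free_word \<Rightarrow> int" where
  "word_degree w = sum_list (map gen_degree (letters w))"

lemma word_degree_add: "word_degree (u + w) = word_degree u + word_degree w"
  by (simp add: word_degree_def plus_free_word_def)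

lemma word_degree_zero [simp]: "word_degree 0 = 0"
  by (simp add: word_degree_def zero_free_word_def)

definition hcomp :: "int \<Rightarrow> (('v, 'e) lpa_gen free_word \<Rightarrow>\<^sub>0 'k::field) \<Rightarrow> (('v, 'e) lpa_gen free_word \<Rightarrow>\<^sub>0 'k)" where
  "hcomp d = restrict_words {w. word_degree w = d}"

definition homogeneous :: "int \<Rightarrow> (('v, 'e) lpa_gen free_word \<Rightarrow>\<^sub>0 'k::field) \<Rightarrow> bool" where
  "homogeneous d p \<longleftrightarrow> (\<forall>w\<in>Poly_Mapping.keys p. word_degree w = d)"

lemma hcomp_add: "hcomp d (p + q) = hcomp d p + hcomp d q"
  and hcomp_diff: "hcomp d (p - q) = hcomp d p - hcomp d q"
  and hcomp_sum: "hcomp d (\<Sum>i\<in>S. f i) = (\<Sum>i\<in>S. hcomp d (f i))"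
  and hcomp_zero [simp]: "hcomp d 0 = 0"
  by (simp_all add: hcomp_def restrict_words_add restrict_words_diff restrict_words_sum)

lemma hcomp_homogeneous: "homogeneous m p \<Longrightarrow> hcomp d p = (if d = m then p else 0)"
  by (intro poly_mapping_eqI)
    (auto simp: hcomp_def lookup_restrict_words homogeneous_def in_keys_iff)

lemma hcomp_homogeneous_mult:
  assumes "homogeneous m p"
  shows "hcomp d (p * q) = p * hcomp (d - m) q"
proof -
  have *: "hcomp d (Poly_Mapping.single u c * q) = Poly_Mapping.single u c * hcomp (d - m) q"
    if "word_degree u = m" for u c
    by (induction q rule: poly_mapping_single_induct)
      (use that in \<open>auto simp: hcomp_add distrib_left mult_single word_degree_add
         hcomp_def restrict_words_single restrict_words_add\<close>)
  define f where "f w = Poly_Mapping.single w (Poly_Mapping.lookup p w)" for w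
  have "hcomp d ((\<Sum>w\<in>Poly_Mapping.keys p. f w) * q) = (\<Sum>w\<in>Poly_Mapping.keys p. f w) * hcomp (d - m) q"
    unfolding sum_distrib_right hcomp_sum
    using assms by (intro sum.cong refl) (auto simp: f_def * homogeneous_def)
  then show ?thesis unfolding f_def sum_single_keys .
qed

lemma sum_hcomp:
  assumes "finite D" "word_degree ` Poly_Mapping.keys p \<subseteq> D"
  shows "(\<Sum>d\<in>D. hcomp d p) = p"
proof (rule poly_mapping_eqI)
  fix w
  have "Poly_Mapping.lookup (\<Sum>d\<in>D. hcomp d p) w
      = (\<Sum>d\<in>D. if d = word_degree w then Poly_Mapping.lookup p w else 0)"
    by (auto simp: lookup_sum hcomp_def lookup_restrict_words intro!: sum.cong)
  also have "\<dots> = Poly_Mapping.lookup p w"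
    using assms by (auto simp: sum.delta' not_in_keys_iff_lookup_eq_zero[symmetric])
  finally show "Poly_Mapping.lookup (\<Sum>d\<in>D. hcomp d p) w = Poly_Mapping.lookup p w" .
qed

lemma hcomp_eq_zero: "d \<notin> word_degree ` Poly_Mapping.keys p \<Longrightarrow> hcomp d p = 0"
  by (intro poly_mapping_eqI) (auto simp: hcomp_def lookup_restrict_words in_keys_iff)

lemma homogeneous_add: "homogeneous d p \<Longrightarrow> homogeneous d q \<Longrightarrow> homogeneous d (p + q)"
  using Poly_Mapping.keys_add[of p q] unfolding homogeneous_def by blast

lemma homogeneous_mult:
  assumes "homogeneous d p" "homogeneous d' q"
  shows "homogeneous (d + d') (p * q)"
  using assms keys_mult[of p q] unfolding homogeneous_def
  by (fastforce simp: word_degree_add)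

lemma homogeneous_scalar: "homogeneous 0 (scalar c)"
  by (simp add: homogeneous_def)

lemma homogeneous_gen: "homogeneous (gen_degree g) (gen g)"
  by (simp add: homogeneous_def gen_def word_degree_def)

text \<open>Under the hypothesis the words in \<open>A\<close> span a subspace closed under products
  and the remaining words span a two-sided ideal, so the projection is multiplicative.\<close>

lemma restrict_words_mult:
  assumes A: "\<And>u w. u + w \<in> A \<longleftrightarrow> u \<in> A \<and> w \<in> A"
  shows "restrict_words A (p * q) = restrict_words A p * restrict_words A q"
proof (induction p rule: poly_mapping_single_induct)
  case (single u c)
  show ?case
    by (induction q rule: poly_mapping_single_induct)
      (auto simp: mult_single restrict_words_single restrict_words_add distrib_left A)
qed (simp add: restrict_words_add distrib_right)

lemma hcomp_mult_homogeneous: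
  assumes "homogeneous m q"
  shows "hcomp d (p * q) = hcomp (d - m) p * q"
proof -
  have *: "hcomp d (p * Poly_Mapping.single u c) = hcomp (d - m) p * Poly_Mapping.single u c"
    if "word_degree u = m" for u c
    by (induction p rule: poly_mapping_single_induct)
      (use that in \<open>auto simp: hcomp_add distrib_right mult_single word_degree_add
         hcomp_def restrict_words_single restrict_words_add\<close>)
  define f where "f w = Poly_Mapping.single w (Poly_Mapping.lookup q w)" for w
  have "hcomp d (p * (\<Sum>w\<in>Poly_Mapping.keys q. f w)) = hcomp (d - m) p * (\<Sum>w\<in>Poly_Mapping.keys q. f w)"
    unfolding sum_distrib_left hcomp_sum
    using assms by (intro sum.cong refl) (auto simp: f_def * homogeneous_def)
  then show ?thesis unfolding f_def sum_single_keys .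
qed

lemma homogeneous_single: "homogeneous (word_degree w) (Poly_Mapping.single w c)"
  by (simp add: homogeneous_def)

lemma homogeneous_zero [simp]: "homogeneous d 0"
  by (simp add: homogeneous_def)

lemma homogeneous_diff: "homogeneous d p \<Longrightarrow> homogeneous d q \<Longrightarrow> homogeneous d (p - q)"
  using keys_diff[of p q] unfolding homogeneous_def by blast

lemma homogeneous_sum: "(\<And>i. i \<in> A \<Longrightarrow> homogeneous d (f i)) \<Longrightarrow> homogeneous d (sum f A)"
  by (induction A rule: infinite_finite_induct) (simp_all add: homogeneous_add)

text \<open>The tool for proving ideals graded: once the components of all generators lie in the
  ideal, its graded part contains the generators and hence the whole ideal.\<close>

lemma two_sided_ideal_graded_part:
  assumes "two_sided_ideal M"
  shows "two_sided_ideal {x. \<forall>d. hcomp d x \<in> M}"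
proof -
  interpret M: two_sided_ideal M by fact
  show ?thesis
  proof
    fix x a assume x: "x \<in> {x. \<forall>d. hcomp d x \<in> M}"
    have "hcomp d (a * x) \<in> M \<and> hcomp d (x * a) \<in> M" for d
    proof (induction a rule: poly_mapping_single_induct)
      case (single w c)
      show ?case
        unfolding hcomp_homogeneous_mult[OF homogeneous_single] hcomp_mult_homogeneous[OF homogeneous_single]
        using x by (auto intro: M.lmult M.rmult)
    qed (auto simp: distrib_left distrib_right hcomp_add intro: M.add)
    then show "a * x \<in> {x. \<forall>d. hcomp d x \<in> M}" "x * a \<in> {x. \<forall>d. hcomp d x \<in> M}" by blast+
  qed (auto simp: hcomp_add M.zero intro: M.add)
qed

lemma homogeneous_relator:
  assumes "r \<in> lpa_relators G"
  obtains d where "homogeneous d r"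
proof -
  note hg = homogeneous_gen
  have vv: "homogeneous 0 (gen (Vertex v) * gen (Vertex w))" for v w
    using homogeneous_mult[OF hg[of "Vertex v"] hg[of "Vertex w"]] by simp
  have ve: "homogeneous 1 (gen (Vertex v) * gen (Edge e))" "homogeneous 1 (gen (Edge e) * gen (Vertex v))" for v e
    using homogeneous_mult[OF hg[of "Vertex v"] hg[of "Edge e"]]
      homogeneous_mult[OF hg[of "Edge e"] hg[of "Vertex v"]] by simp_all
  have vg: "homogeneous (-1) (gen (Vertex v) * gen (Ghost e))" "homogeneous (-1) (gen (Ghost e) * gen (Vertex v))" for v e
    using homogeneous_mult[OF hg[of "Vertex v"] hg[of "Ghost e"]]
      homogeneous_mult[OF hg[of "Ghost e"] hg[of "Vertex v"]] by simp_all
  have eg: "homogeneous 0 (gen (Edge e) * gen (Ghost f))" "homogeneous 0 (gen (Ghost f) * gen (Edge e))" for e f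
    using homogeneous_mult[OF hg[of "Edge e"] hg[of "Ghost f"]]
      homogeneous_mult[OF hg[of "Ghost f"] hg[of "Edge e"]] by simp_all
  have v: "homogeneous 0 (gen (Vertex v))" and e: "homogeneous 1 (gen (Edge e))"
    and g: "homogeneous (-1) (gen (Ghost e))" for v e
    using hg[of "Vertex v"] hg[of "Edge e"] hg[of "Ghost e"] by simp_all
  have "homogeneous 0 r \<or> homogeneous 1 r \<or> homogeneous (-1) r"
    using assms unfolding lpa_relators_def
    by (elim UnE CollectE exE conjE) (auto intro!: homogeneous_diff homogeneous_sum vv ve vg eg v e g)
  then show thesis using that by blast
qed

section \<open>Paths in quotients of Cohn path algebras\<close>

lemma (in two_sided_ideal) eqv_mid: "a * b \<approx> c \<Longrightarrow> (x * a) * (b * y) \<approx> x * c * y"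
  using eqv_rmult[OF eqv_lmult[of "a * b" c x], of y] by (simp add: mult.assoc)

text \<open>The subspace spanned by \<open>S\<close> together with \<open>J\<close>. The inductive
  form serves arguments along a linear combination; \<open>jspan_family\<close> recovers
  coefficients where terms have to be compared.\<close>

inductive_set jspan :: "('g free_word \<Rightarrow>\<^sub>0 'k::field) set \<Rightarrow> ('g free_word \<Rightarrow>\<^sub>0 'k) set \<Rightarrow> ('g free_word \<Rightarrow>\<^sub>0 'k) set"
  for J S where
  mem: "x \<in> J \<Longrightarrow> x \<in> jspan J S"
| step: "\<lbrakk>m \<in> S; x \<in> jspan J S\<rbrakk> \<Longrightarrow> scalar c * m + x \<in> jspan J S"

locale free_ideal = two_sided_ideal J for J :: "('g free_word \<Rightarrow>\<^sub>0 'k::field) set"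
begin

lemma jspan_zero: "0 \<in> jspan J S"
  by (simp add: jspan.mem zero)

lemma jspan_add: "\<lbrakk>x \<in> jspan J S; y \<in> jspan J S\<rbrakk> \<Longrightarrow> x + y \<in> jspan J S"
proof (induction x rule: jspan.induct)
  case (mem x)
  from mem(2,1) show ?case
  proof (induction y rule: jspan.induct)
    case (step m y c)
    have "scalar c * m + (x + y) \<in> jspan J S" by (intro jspan.step step)+
    then show ?case by (simp add: algebra_simps)
  qed (simp add: jspan.mem add)
next
  case (step m x c)
  have "scalar c * m + (x + y) \<in> jspan J S" by (intro jspan.step step)
  then show ?case by (simp add: algebra_simps)
qed

lemma jspan_cong: "x \<approx> y \<Longrightarrow> y \<in> jspan J S \<Longrightarrow> x \<in> jspan J S"
  using jspan_add[OF jspan.mem, of "x - y" y S] by (simp add: eqv_def)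

lemma jspan_base: "m \<in> S \<Longrightarrow> m \<in> jspan J S"
  using jspan.step[OF _ jspan_zero, of m S 1] by simp

text \<open>Multiplication by \<open>a\<close> and \<open>b\<close> is linear and preserves
  \<open>J\<close>, so it suffices to check the spanning set. Most later membership proofs reduce to
  monomials in this way.\<close>

lemma jspan_bind:
  assumes "\<And>m. m \<in> S \<Longrightarrow> a * m * b \<in> jspan J S'" "x \<in> jspan J S"
  shows "a * x * b \<in> jspan J S'"
  using assms(2)
proof (induction x rule: jspan.induct)
  case (mem x)
  then show ?case by (simp add: jspan.mem lmult rmult)
next
  case (step m x c)
  have sc: "scalar c * z \<in> jspan J S'" if "z \<in> jspan J S'" for z
    using that
  proof (induction z rule: jspan.induct)
    case (step m' z d)
    have "scalar (c * d) * m' + scalar c * z \<in> jspan J S'" by (intro jspan.step step)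
    then show ?case by (simp add: algebra_simps)
  qed (simp add: jspan.mem lmult)
  have "a * (scalar c * m + x) * b = scalar c * (a * m * b) + a * x * b"
    by (simp add: algebra_simps scalar_commute')
  then show ?case using jspan_add[OF sc[OF assms(1)[OF step(1)]] step.IH] by simp
qed

lemma jspan_lmult: "(\<And>m. m \<in> S \<Longrightarrow> a * m \<in> jspan J S') \<Longrightarrow> x \<in> jspan J S \<Longrightarrow> a * x \<in> jspan J S'"
  using jspan_bind[of S a 1] by simp

lemma jspan_rmult: "(\<And>m. m \<in> S \<Longrightarrow> m * a \<in> jspan J S') \<Longrightarrow> x \<in> jspan J S \<Longrightarrow> x * a \<in> jspan J S'"
  using jspan_bind[of S 1 a] by simp

lemma jspan_subset: "(\<And>m. m \<in> S \<Longrightarrow> m \<in> jspan J S') \<Longrightarrow> x \<in> jspan J S \<Longrightarrow> x \<in> jspan J S'"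
  using jspan_bind[of S 1 1] by simp

lemma jspan_scalar: "x \<in> jspan J S \<Longrightarrow> scalar c * x \<in> jspan J S"
proof (rule jspan_lmult)
  show "scalar c * m \<in> jspan J S" if "m \<in> S" for m
    using jspan.step[OF that jspan_zero, of c] by simp
qed

lemma jspan_sum: "(\<And>i. i \<in> A \<Longrightarrow> f i \<in> jspan J S) \<Longrightarrow> sum f A \<in> jspan J S"
  by (induction A rule: infinite_finite_induct) (auto intro: jspan_zero jspan_add)

text \<open>The induction may meet an index twice, so coefficients are merged, and those that cancel
  are dropped at the end. Distinct indices stay apart even where \<open>f\<close> takes equal
  values.\<close>

lemma jspan_family:
  assumes "x \<in> jspan J (f ` X)"
  obtains A k where "finite A" "A \<subseteq> X" "\<forall>i\<in>A. k i \<noteq> 0"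
    "x \<approx> (\<Sum>i\<in>A. scalar (k i) * f i)"
proof -
  have "\<exists>A k. finite A \<and> A \<subseteq> X \<and> x \<approx> (\<Sum>i\<in>A. scalar (k i) * f i)"
    using assms
  proof (induction x rule: jspan.induct)
    case (mem x)
    then show ?case by (intro exI[of _ "{}"]) (simp add: eqv_def)
  next
    case (step m x c)
    obtain A k where A: "finite A" "A \<subseteq> X" "x \<approx> (\<Sum>i\<in>A. scalar (k i) * f i)"
      using step.IH by auto
    obtain j where j: "j \<in> X" "m = f j" using step.hyps(1) by auto
    \<comment> \<open>At a new index the old value of \<open>k\<close> is arbitrary and has to be
      overwritten, not increased.\<close>
    define k' where "k' = (if j \<in> A then k(j := k j + c) else k(j := c))"
    have "(\<Sum>i\<in>insert j A. scalar (k' i) * f i) = scalar (k' j) * f j + (\<Sum>i\<in>A - {j}. scalar (k' i) * f i)"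
      using A by (simp add: sum.insert_remove)
    also have "(\<Sum>i\<in>A - {j}. scalar (k' i) * f i) = (\<Sum>i\<in>A - {j}. scalar (k i) * f i)"
      by (intro sum.cong) (auto simp: k'_def)
    also have "scalar (k' j) * f j + \<dots> = scalar c * f j + (\<Sum>i\<in>A. scalar (k i) * f i)"
    proof (cases "j \<in> A")
      case True
      then show ?thesis using sum.remove[OF A(1) True, of "\<lambda>i. scalar (k i) * f i"]
        by (simp add: k'_def single_add algebra_simps)
    qed (simp add: k'_def)
    finally have "scalar c * m + x \<approx> (\<Sum>i\<in>insert j A. scalar (k' i) * f i)"
      using eqv_add[OF eqv_refl A(3), of "scalar c * m"] by (simp add: j)
    then show ?case using A j by (intro exI[of _ "insert j A"] exI[of _ k'] conjI) auto
  qed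
  then obtain A k where A: "finite A" "A \<subseteq> X" "x \<approx> (\<Sum>i\<in>A. scalar (k i) * f i)" by auto
  show thesis
  proof (rule that[of "{i\<in>A. k i \<noteq> 0}" k])
    have "(\<Sum>i\<in>A. scalar (k i) * f i) = (\<Sum>i\<in>{i\<in>A. k i \<noteq> 0}. scalar (k i) * f i)"
      using A(1) by (intro sum.mono_neutral_right) auto
    then show "x \<approx> (\<Sum>i\<in>{i\<in>A. k i \<noteq> 0}. scalar (k i) * f i)" using A(3) by simp
  qed (use A(1,2) in auto)
qed

end

text \<open>The element of a real path, closed by its end vertex; \<open>v\<close> matters only for
  the empty path. The ghost path \<open>gpath\<close> is its image under the involution that
  exchanges edges and ghost edges.\<close>

primrec rpath :: "('v, 'e) pre_digraph \<Rightarrow> 'v \<Rightarrow> 'e list \<Rightarrow> (('v, 'e) lpa_gen free_word \<Rightarrow>\<^sub>0 'k::field)" where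
  "rpath G v [] = gen (Vertex v)"
| "rpath G v (e # p) = gen (Edge e) * rpath G (head G e) p"

primrec gpath :: "('v, 'e) pre_digraph \<Rightarrow> 'v \<Rightarrow> 'e list \<Rightarrow> (('v, 'e) lpa_gen free_word \<Rightarrow>\<^sub>0 'k::field)" where
  "gpath G v [] = gen (Vertex v)"
| "gpath G v (e # p) = gpath G (head G e) p * gen (Ghost e)"

lemma homogeneous_rpath: "homogeneous (int (length p)) (rpath G u p)"
proof (induction p arbitrary: u)
  case Nil
  then show ?case using homogeneous_gen[of "Vertex u"] by simp
next
  case (Cons e p)
  then show ?case using homogeneous_mult[OF homogeneous_gen[of "Edge e"] Cons] by simp
qed

lemma homogeneous_scalar_mult: "homogeneous d x \<Longrightarrow> homogeneous d (scalar c * x)"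
  by (metis add_0 homogeneous_mult homogeneous_scalar)

text \<open>
  An ideal modulo which the free algebra is a quotient of the Cohn path algebra of the graph: the
  relation at regular vertices is not imposed.
\<close>

locale cohn_ideal = wf_digraph G + free_ideal J
  for G :: "('v, 'e) pre_digraph" and J :: "(('v, 'e) lpa_gen free_word \<Rightarrow>\<^sub>0 'k::field) set" +
  assumes vertex_vertex: "gen (Vertex v) * gen (Vertex w) \<approx> (if v = w then gen (Vertex v) else 0)"
    and tail_edge: "gen (Vertex (tail G e)) * gen (Edge e) \<approx> gen (Edge e)"
    and edge_head: "gen (Edge e) * gen (Vertex (head G e)) \<approx> gen (Edge e)"
    and head_ghost: "gen (Vertex (head G e)) * gen (Ghost e) \<approx> gen (Ghost e)"
    and ghost_tail: "gen (Ghost e) * gen (Vertex (tail G e)) \<approx> gen (Ghost e)"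
    and ghost_edge: "\<lbrakk>e \<in> arcs G; f \<in> arcs G\<rbrakk>
      \<Longrightarrow> gen (Ghost e) * gen (Edge f) \<approx> (if e = f then gen (Vertex (head G e)) else 0)"
    and outside: "v \<notin> verts G \<Longrightarrow> gen (Vertex v) \<in> J" "e \<notin> arcs G \<Longrightarrow> gen (Edge e) \<in> J"
      "e \<notin> arcs G \<Longrightarrow> gen (Ghost e) \<in> J"
begin

abbreviation "V v \<equiv> gen (Vertex v) :: ('v, 'e) lpa_gen free_word \<Rightarrow>\<^sub>0 'k"
abbreviation "E e \<equiv> gen (Edge e) :: ('v, 'e) lpa_gen free_word \<Rightarrow>\<^sub>0 'k"
abbreviation "E' e \<equiv> gen (Ghost e) :: ('v, 'e) lpa_gen free_word \<Rightarrow>\<^sub>0 'k"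
abbreviation "rp u p \<equiv> rpath G u p :: ('v, 'e) lpa_gen free_word \<Rightarrow>\<^sub>0 'k"
abbreviation "gp u p \<equiv> gpath G u p :: ('v, 'e) lpa_gen free_word \<Rightarrow>\<^sub>0 'k"

lemma vertex_idem: "V v * V v \<approx> V v"
  using vertex_vertex[of v v] by simp

lemma vertex_orth: "v \<noteq> w \<Longrightarrow> V v * V w \<approx> 0"
  using vertex_vertex[of v w] by simp

lemma source_rp: "awalk u p w \<Longrightarrow> V u * rp u p \<approx> rp u p"
  using eqv_rmult[OF tail_edge] by (cases p) (auto simp: vertex_idem awalk_Cons_iff mult.assoc[symmetric])

lemma rp_target: "awalk u p w \<Longrightarrow> rp u p * V w \<approx> rp u p"
  by (induction p arbitrary: u) (auto simp: awalk_Nil_iff vertex_idem awalk_Cons_iff mult.assoc intro: eqv_lmult)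

lemma gp_source: "awalk u p w \<Longrightarrow> gp u p * V u \<approx> gp u p"
  using eqv_lmult[OF ghost_tail] by (cases p) (auto simp: vertex_idem awalk_Cons_iff mult.assoc)

lemma target_gp: "awalk u p w \<Longrightarrow> V w * gp u p \<approx> gp u p"
  by (induction p arbitrary: u)
    (auto simp: awalk_Nil_iff vertex_idem awalk_Cons_iff mult.assoc[symmetric] intro: eqv_rmult)

lemma rp_append: "\<lbrakk>awalk u p w; awalk w q x\<rbrakk> \<Longrightarrow> rp u p * rp w q \<approx> rp u (p @ q)"
proof (induction p arbitrary: u)
  case Nil
  then show ?case using source_rp by (simp add: awalk_Nil_iff)
next
  case (Cons e p)
  then show ?case by (simp add: awalk_Cons_iff mult.assoc eqv_lmult)
qed

lemma gp_append: "\<lbrakk>awalk u p w; awalk w q x\<rbrakk> \<Longrightarrow> gp w q * gp u p \<approx> gp u (p @ q)"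
proof (induction p arbitrary: u)
  case Nil
  then show ?case using gp_source by (simp add: awalk_Nil_iff)
next
  case (Cons e p)
  then show ?case by (simp add: awalk_Cons_iff eqv_rmult flip: mult.assoc)
qed

lemma gp_rp: "awalk u p w \<Longrightarrow> gp u p * rp u p \<approx> V w"
proof (induction p arbitrary: u)
  case Nil
  then show ?case by (simp add: awalk_Nil_iff vertex_idem)
next
  case (Cons e p)
  then have e: "e \<in> arcs G" and p: "awalk (head G e) p w" by (auto simp: awalk_Cons_iff)
  have "gp u (e # p) * rp u (e # p) \<approx> gp (head G e) p * V (head G e) * rp (head G e) p"
    using ghost_edge[OF e e] by (auto intro: eqv_mid)
  also have "\<dots> \<approx> gp (head G e) p * rp (head G e) p"
    by (intro eqv_rmult gp_source[OF p])
  also have "\<dots> \<approx> V w" by (rule Cons.IH[OF p])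
  finally show ?case .
qed

lemma gp_rp_append:
  assumes "awalk u p w" "awalk w q x"
  shows "gp u p * rp u (p @ q) \<approx> rp w q" "gp u (p @ q) * rp u p \<approx> gp w q"
proof -
  have "gp u p * rp u (p @ q) \<approx> gp u p * (rp u p * rp w q)"
    by (intro eqv_lmult eqv_sym[OF rp_append[OF assms]])
  also have "\<dots> = (gp u p * rp u p) * rp w q" by (simp add: mult.assoc)
  also have "\<dots> \<approx> V w * rp w q" by (intro eqv_rmult gp_rp assms)
  also have "\<dots> \<approx> rp w q" by (rule source_rp) fact
  finally show "gp u p * rp u (p @ q) \<approx> rp w q" .
  have "gp u (p @ q) * rp u p \<approx> gp w q * gp u p * rp u p"
    by (intro eqv_rmult eqv_sym[OF gp_append[OF assms]])
  also have "\<dots> = gp w q * (gp u p * rp u p)" by (simp add: mult.assoc)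
  also have "\<dots> \<approx> gp w q * V w" by (intro eqv_lmult gp_rp assms)
  also have "\<dots> \<approx> gp w q" by (rule gp_source) fact
  finally show "gp u (p @ q) * rp u p \<approx> gp w q" .
qed

lemma vertex_rp_orth: "awalk u p w \<Longrightarrow> v \<noteq> u \<Longrightarrow> V v * rp u p \<approx> 0"
proof -
  assume a: "awalk u p w" "v \<noteq> u"
  have "V v * rp u p \<approx> V v * (V u * rp u p)" by (intro eqv_lmult eqv_sym[OF source_rp[OF a(1)]])
  also have "\<dots> = (V v * V u) * rp u p" by (simp add: mult.assoc)
  also have "\<dots> \<approx> 0 * rp u p" by (intro eqv_rmult vertex_orth a)
  finally show ?thesis by simp
qed

lemma gp_vertex_orth: "awalk u p w \<Longrightarrow> v \<noteq> u \<Longrightarrow> gp u p * V v \<approx> 0"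
proof -
  assume a: "awalk u p w" "v \<noteq> u"
  have "gp u p * V v \<approx> gp u p * V u * V v" by (intro eqv_rmult eqv_sym[OF gp_source[OF a(1)]])
  also have "\<dots> = gp u p * (V u * V v)" by (simp add: mult.assoc)
  also have "\<dots> \<approx> gp u p * 0" using a by (intro eqv_lmult vertex_orth) auto
  finally show ?thesis by simp
qed

lemma rp_vertex_orth: "awalk u p w \<Longrightarrow> v \<noteq> w \<Longrightarrow> rp u p * V v \<approx> 0"
proof -
  assume a: "awalk u p w" "v \<noteq> w"
  have "rp u p * V v \<approx> rp u p * V w * V v" by (intro eqv_rmult eqv_sym[OF rp_target[OF a(1)]])
  also have "\<dots> = rp u p * (V w * V v)" by (simp add: mult.assoc)
  also have "\<dots> \<approx> rp u p * 0" using a by (intro eqv_lmult vertex_orth) auto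
  finally show ?thesis by simp
qed

lemma gp_rp_sources_orth:
  assumes "awalk u p w" "awalk u' q w'" "u \<noteq> u'"
  shows "gp u p * rp u' q \<approx> 0"
proof -
  have "gp u p * rp u' q \<approx> gp u p * V u * rp u' q" by (intro eqv_rmult eqv_sym[OF gp_source[OF assms(1)]])
  also have "\<dots> = gp u p * (V u * rp u' q)" by (simp add: mult.assoc)
  also have "\<dots> \<approx> gp u p * 0" by (intro eqv_lmult vertex_rp_orth[OF assms(2)] assms)
  finally show ?thesis by simp
qed

text \<open>Common initial edges cancel one by one. At the first difference the product of a ghost
  edge with another edge is 0.\<close>

lemma gp_rp_incomparable:
  "\<lbrakk>awalk u p w; awalk u q x; \<not> prefix p q; \<not> prefix q p\<rbrakk> \<Longrightarrow> gp u p * rp u q \<approx> 0"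
proof (induction p arbitrary: u q)
  case (Cons e p)
  then obtain f q' where q: "q = f # q'" by (cases q) auto
  have e: "e \<in> arcs G" "awalk (head G e) p w" and f: "f \<in> arcs G" "awalk (head G f) q' x"
    using Cons.prems by (auto simp: q awalk_Cons_iff)
  have 1: "gp u (e # p) * rp u q \<approx> gp (head G e) p * (if e = f then V (head G e) else 0) * rp (head G f) q'"
    using eqv_mid[OF ghost_edge[OF e(1) f(1)]] by (simp add: q)
  show ?case
  proof (cases "e = f")
    case True
    note 1
    also have "gp (head G e) p * (if e = f then V (head G e) else 0) * rp (head G f) q'
        \<approx> gp (head G e) p * rp (head G f) q'"
      using eqv_rmult[OF gp_source[OF e(2)]] True by simp
    also have "\<dots> \<approx> 0"
      using Cons.IH[OF e(2)] f(2) Cons.prems(3,4) True by (simp add: q)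
    finally show ?thesis .
  qed (use 1 in simp)
qed simp

definition monomials :: "(('v, 'e) lpa_gen free_word \<Rightarrow>\<^sub>0 'k) set" where
  "monomials = {rp u p * gp v q | u p v q w. awalk u p w \<and> awalk v q w}"

lemma monomialI: "awalk u p w \<Longrightarrow> awalk v q w \<Longrightarrow> rp u p * gp v q \<in> jspan J monomials"
  by (intro jspan_base) (unfold monomials_def, blast)

lemma gen_in_span: "gen g \<in> jspan J monomials"
proof (cases g)
  case (Vertex v)
  show ?thesis
  proof (cases "v \<in> verts G")
    case True
    then have "rp v [] * gp v [] \<in> jspan J monomials" by (intro monomialI) (auto simp: awalk_Nil_iff)
    then show ?thesis using eqv_sym[OF vertex_idem] by (auto simp: Vertex intro: jspan_cong)
  qed (simp add: Vertex jspan.mem outside)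
next
  case (Edge e)
  show ?thesis
  proof (cases "e \<in> arcs G")
    case True
    then have "rp (tail G e) [e] * gp (head G e) [] \<in> jspan J monomials"
      by (intro monomialI) (auto simp: awalk_simps)
    moreover have "E e \<approx> (E e * V (head G e)) * V (head G e)"
      by (meson edge_head eqv_rmult eqv_sym eqv_trans)
    ultimately show ?thesis by (auto simp: Edge intro: jspan_cong)
  qed (simp add: Edge jspan.mem outside)
next
  case (Ghost e)
  show ?thesis
  proof (cases "e \<in> arcs G")
    case True
    then have "rp (head G e) [] * gp (tail G e) [e] \<in> jspan J monomials"
      by (intro monomialI) (auto simp: awalk_simps)
    moreover have "E' e \<approx> V (head G e) * (V (head G e) * E' e)"
      by (meson head_ghost eqv_lmult eqv_sym eqv_trans)
    ultimately show ?thesis by (auto simp: Ghost intro: jspan_cong)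
  qed (simp add: Ghost jspan.mem outside)
qed

text \<open>A vertex fixes or kills the real path and an edge prolongs or kills it. A ghost edge
  cancels the first edge of the real path or kills it; if the real path is trivial, the ghost edge
  joins the ghost part instead.\<close>

lemma gen_mult_monomial:
  assumes p: "awalk u p w" and q: "awalk v q w"
  shows "gen g * (rp u p * gp v q) \<in> jspan J monomials"
proof (cases g)
  case (Vertex x)
  have "V x * rp u p \<approx> (if x = u then rp u p else 0)"
    using source_rp[OF p] vertex_rp_orth[OF p, of x] by auto
  from eqv_rmult[OF this, of "gp v q"] show ?thesis
    using monomialI[OF p q] jspan_zero
    by (auto simp: Vertex mult.assoc split: if_splits intro: jspan_cong)
next
  case (Edge e)
  consider "e \<notin> arcs G" | "e \<in> arcs G" "head G e = u" | "head G e \<noteq> u" by blast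
  then show ?thesis
  proof cases
    case 1
    then show ?thesis by (simp add: Edge jspan.mem outside rmult)
  next
    case 2
    then have "awalk (tail G e) (e # p) w" using p by (simp add: awalk_Cons_iff)
    from monomialI[OF this q] show ?thesis using 2 by (simp add: Edge mult.assoc)
  next
    case 3
    have "E e * (rp u p * gp v q) \<approx> E e * V (head G e) * (rp u p * gp v q)"
      by (intro eqv_rmult eqv_sym[OF edge_head])
    also have "\<dots> = E e * (V (head G e) * rp u p) * gp v q" by (simp add: mult.assoc)
    also have "\<dots> \<approx> E e * 0 * gp v q" using 3 by (intro eqv_rmult eqv_lmult vertex_rp_orth[OF p])
    finally show ?thesis using jspan_zero by (auto simp: Edge intro: jspan_cong)
  qed
next
  case (Ghost e)
  show ?thesis
  proof (cases p)
    case Nil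
    then have u: "u = w" "u \<in> verts G" using p by (auto simp: awalk_Nil_iff)
    consider "e \<notin> arcs G" | "e \<in> arcs G" "tail G e = u" | "tail G e \<noteq> u" by blast
    then show ?thesis
    proof cases
      case 1
      then show ?thesis by (simp add: Ghost jspan.mem outside rmult)
    next
      case 2
      then have e: "awalk w [e] (head G e)" using u by (auto simp: awalk_simps)
      then have qe: "awalk v (q @ [e]) (head G e)" using q by auto
      have "E' e * (V u * gp v q) = (E' e * V (tail G e)) * gp v q" by (simp add: 2 mult.assoc)
      also have "\<dots> \<approx> E' e * gp v q" by (intro eqv_rmult ghost_tail)
      also have "\<dots> \<approx> V (head G e) * (V (head G e) * E' e) * gp v q"
        by (intro eqv_rmult) (meson head_ghost eqv_lmult eqv_sym eqv_trans)
      also have "\<dots> = V (head G e) * (gp w [e] * gp v q)" by (simp add: mult.assoc)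
      also have "\<dots> \<approx> V (head G e) * gp v (q @ [e])" by (intro eqv_lmult gp_append[OF q e])
      finally have "E' e * (V u * gp v q) \<approx> rp (head G e) [] * gp v (q @ [e])" by simp
      moreover have "rp (head G e) [] * gp v (q @ [e]) \<in> jspan J monomials"
        using 2 by (intro monomialI[OF _ qe]) (auto simp: awalk_Nil_iff)
      ultimately show ?thesis by (simp add: Ghost Nil jspan_cong)
    next
      case 3
      have "E' e * (V u * gp v q) \<approx> (E' e * V (tail G e)) * (V u * gp v q)"
        by (intro eqv_rmult eqv_sym[OF ghost_tail])
      also have "\<dots> \<approx> E' e * 0 * gp v q" using 3 by (intro eqv_mid vertex_orth)
      finally show ?thesis using jspan_zero by (auto simp: Ghost Nil intro: jspan_cong)
    qed
  next
    case (Cons f p')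
    then have f: "f \<in> arcs G" "awalk (head G f) p' w" using p by (auto simp: awalk_Cons_iff)
    show ?thesis
    proof (cases "e \<in> arcs G")
      case True
      have *: "E' e * (rp u p * gp v q) = (E' e * E f) * (rp (head G f) p' * gp v q)"
        by (simp add: Cons mult.assoc)
      show ?thesis
      proof (cases "e = f")
        case True
        note *
        also have "(E' e * E f) * (rp (head G f) p' * gp v q) \<approx> V (head G f) * (rp (head G f) p' * gp v q)"
          using ghost_edge[OF f(1) f(1)] True by (auto intro: eqv_rmult)
        also have "\<dots> = (V (head G f) * rp (head G f) p') * gp v q" by (simp add: mult.assoc)
        also have "\<dots> \<approx> rp (head G f) p' * gp v q" by (intro eqv_rmult source_rp[OF f(2)])
        finally show ?thesis using monomialI[OF f(2) q] by (simp add: Ghost jspan_cong)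
      next
        case False
        have "(E' e * E f) * (rp (head G f) p' * gp v q) \<approx> 0 * (rp (head G f) p' * gp v q)"
          using ghost_edge[OF True f(1)] False by (intro eqv_rmult) simp
        then show ?thesis using * jspan_zero by (auto simp: Ghost intro: jspan_cong)
      qed
    qed (simp add: Ghost jspan.mem outside rmult)
  qed
qed

lemma word_in_span: "xs \<noteq> [] \<Longrightarrow> prod_list (map gen xs) \<in> jspan J monomials"
proof (induction xs)
  case (Cons g xs)
  show ?case
  proof (cases "xs = []")
    case False
    have "gen g * m \<in> jspan J monomials" if "m \<in> monomials" for m
      using that gen_mult_monomial by (auto simp: monomials_def)
    from jspan_lmult[OF this Cons.IH[OF False]] show ?thesis by simp
  qed (use gen_in_span in simp)
qed simp

text \<open>The hypothesis excludes the empty word, the unit of the free algebra, which the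
  induction over nonempty words does not reach.\<close>

lemma span_monomials:
  assumes "Poly_Mapping.lookup x 0 = 0"
  shows "x \<in> jspan J monomials"
proof -
  have "Poly_Mapping.single w c \<in> jspan J monomials" if "w \<in> Poly_Mapping.keys x" for w c
  proof -
    obtain xs where "w = Word xs" by (cases w)
    moreover have "xs \<noteq> []"
      using that assms \<open>w = Word xs\<close> by (auto simp: in_keys_iff zero_free_word_def)
    ultimately show ?thesis by (simp add: single_word jspan_scalar word_in_span)
  qed
  then have "(\<Sum>w\<in>Poly_Mapping.keys x. Poly_Mapping.single w (Poly_Mapping.lookup x w)) \<in> jspan J monomials"
    by (intro jspan_sum) blast
  then show ?thesis by (simp add: sum_single_keys)
qed


text \<open>A monomial is fixed by one vertex on each side and killed by all others, so the finitely
  many vertices met in a combination add up to a unit for it. Allowing every larger \<open>B\<close>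
  lets the induction combine two such sets.\<close>

lemma local_units:
  assumes "Poly_Mapping.lookup x 0 = 0"
  shows "\<exists>A. finite A \<and> (\<forall>B. finite B \<longrightarrow> A \<subseteq> B \<longrightarrow> x * (\<Sum>v\<in>B. V v) \<approx> x \<and> (\<Sum>v\<in>B. V v) * x \<approx> x)"
  using span_monomials[OF assms]
proof (induction x rule: jspan.induct)
  case (mem x)
  have "x * s \<approx> x" "s * x \<approx> x" for s
    using mem by (simp_all add: eqv_def diff lmult rmult)
  then show ?case by (intro exI[of _ "{}"]) simp
next
  case (step m x c)
  obtain A where A: "finite A" and unit: "\<And>B. finite B \<Longrightarrow> A \<subseteq> B \<Longrightarrow> x * (\<Sum>v\<in>B. V v) \<approx> x \<and> (\<Sum>v\<in>B. V v) * x \<approx> x"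
    using step.IH by auto
  obtain u p v q w where m: "m = rp u p * gp v q" and p: "awalk u p w" and q: "awalk v q w"
    using step.hyps(1) unfolding monomials_def by auto
  have r: "m * V y \<approx> (if y = v then m else 0)" for y
    using eqv_lmult[OF gp_source[OF q], of "rp u p"] eqv_lmult[OF gp_vertex_orth[OF q], of y "rp u p"]
    by (auto simp: m mult.assoc)
  have l: "V y * m \<approx> (if y = u then m else 0)" for y
    using eqv_rmult[OF source_rp[OF p], of "gp v q"] eqv_rmult[OF vertex_rp_orth[OF p], of y "gp v q"]
    by (auto simp: m mult.assoc)
  show ?case
  proof (intro exI[of _ "insert u (insert v A)"] conjI allI impI)
    fix B assume B: "finite B" "insert u (insert v A) \<subseteq> B"
    then have x: "x * (\<Sum>v\<in>B. V v) \<approx> x" "(\<Sum>v\<in>B. V v) * x \<approx> x" using unit by auto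
    have "m * (\<Sum>v\<in>B. V v) \<approx> (\<Sum>y\<in>B. if y = v then m else 0)"
      unfolding sum_distrib_left by (intro eqv_sum r)
    then have mr: "m * (\<Sum>v\<in>B. V v) \<approx> m" using B by (simp add: sum.delta')
    have "(\<Sum>v\<in>B. V v) * m \<approx> (\<Sum>y\<in>B. if y = u then m else 0)"
      unfolding sum_distrib_right by (intro eqv_sum l)
    then have ml: "(\<Sum>v\<in>B. V v) * m \<approx> m" using B by (simp add: sum.delta')
    show "(scalar c * m + x) * (\<Sum>v\<in>B. V v) \<approx> scalar c * m + x"
      using eqv_add[OF eqv_lmult[OF mr, of "scalar c"] x(1)] by (simp add: distrib_right mult.assoc)
    show "(\<Sum>v\<in>B. V v) * (scalar c * m + x) \<approx> scalar c * m + x"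
      using eqv_add[OF eqv_lmult[OF ml, of "scalar c"] x(2)]
      by (simp add: distrib_left scalar_commute')
  qed (use A in simp)
qed

end

section \<open>Gap idempotents, and coefficients isolated by ghost paths\<close>

context free_ideal
begin

lemma jspan_singleton: "x \<in> jspan J {m} \<Longrightarrow> \<exists>c. x \<approx> scalar c * m"
proof (induction x rule: jspan.induct)
  case (mem x)
  then show ?case by (intro exI[of _ 0]) (simp add: eqv_def)
next
  case (step m' x c)
  then obtain d where "x \<approx> scalar d * m" by auto
  from eqv_add[OF eqv_refl this, of "scalar c * m"] step.hyps(1)
  show ?case by (intro exI[of _ "c + d"]) (simp add: single_add distrib_right)
qed

lemma jspan_null: "(\<And>m. m \<in> S \<Longrightarrow> m \<in> J) \<Longrightarrow> x \<in> jspan J S \<Longrightarrow> x \<in> J"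
proof -
  assume S: "\<And>m. m \<in> S \<Longrightarrow> m \<in> J"
  assume "x \<in> jspan J S"
  then show "x \<in> J" by (induction x rule: jspan.induct) (auto intro: add lmult S)
qed

end

text \<open>At a sink this is the vertex itself. At an infinite emitter the sum has the default
  value 0, hence the finiteness assumptions below.\<close>

definition gap :: "('v, 'e) pre_digraph \<Rightarrow> 'v \<Rightarrow> (('v, 'e) lpa_gen free_word \<Rightarrow>\<^sub>0 'k::field)" where
  "gap G v = gen (Vertex v) - (\<Sum>e\<in>out_arcs G v. gen (Edge e) * gen (Ghost e))"

context cohn_ideal
begin

abbreviation "q v \<equiv> gap G v :: ('v, 'e) lpa_gen free_word \<Rightarrow>\<^sub>0 'k"

definition paths_to :: "'v \<Rightarrow> (('v, 'e) lpa_gen free_word \<Rightarrow>\<^sub>0 'k) set" where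
  "paths_to v = (\<lambda>(u, p). rp u p) ` {(u, p). awalk u p v}"

definition closed_paths :: "'v \<Rightarrow> (('v, 'e) lpa_gen free_word \<Rightarrow>\<^sub>0 'k) set" where
  "closed_paths v = rp v ` {c. awalk v c v \<and> c \<noteq> []}"

text \<open>The bound on the ghost part is the measure of the induction that removes ghost
  edges.\<close>

definition bounded_monomials :: "nat \<Rightarrow> (('v, 'e) lpa_gen free_word \<Rightarrow>\<^sub>0 'k) set" where
  "bounded_monomials n = {rp u p * gp v q | u p v q w. awalk u p w \<and> awalk v q w \<and> length q \<le> n}"

lemma paths_to_target: "b \<in> jspan J (paths_to v) \<Longrightarrow> b * V v \<approx> b"
proof (induction b rule: jspan.induct)
  case (mem x)
  then show ?case by (simp add: eqv_def diff rmult)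
next
  case (step m x c)
  then have "m * V v \<approx> m" using rp_target by (auto simp: paths_to_def)
  from eqv_add[OF eqv_lmult[OF this, of "scalar c"] step.IH] show ?case
    by (simp add: distrib_right mult.assoc)
qed

text \<open>In the product of the sum with \<open>E e\<close> only the term of \<open>e\<close>
  survives, so the sum fixes \<open>E e\<close> just as \<open>V v\<close> does, and the difference
  kills it. The second claim is the mirror image.\<close>

lemma gap_edge:
  assumes fin: "finite (out_arcs G v)" and e: "e \<in> out_arcs G v"
  shows "q v * E e \<approx> 0" "E' e * q v \<approx> 0"
proof -
  have e': "e \<in> arcs G" "tail G e = v" using e by auto
  have "(\<Sum>f\<in>out_arcs G v. E f * E' f) * E e \<approx> (\<Sum>f\<in>out_arcs G v. if f = e then E e * V (head G e) else 0)"
    unfolding sum_distrib_right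
  proof (rule eqv_sum)
    fix f assume "f \<in> out_arcs G v"
    then have "E' f * E e \<approx> (if f = e then V (head G e) else 0)"
      using ghost_edge[of f e] e' by (auto split: if_splits)
    from eqv_lmult[OF this, of "E f"]
    show "E f * E' f * E e \<approx> (if f = e then E e * V (head G e) else 0)"
      by (simp add: mult.assoc split: if_splits)
  qed
  also have "\<dots> = E e * V (head G e)" using fin e by (simp add: sum.delta')
  also have "\<dots> \<approx> E e" by (rule edge_head)
  finally have "V v * E e - (\<Sum>f\<in>out_arcs G v. E f * E' f) * E e \<approx> E e - E e"
    using tail_edge[of e] e' by (intro eqv_diff) auto
  then show "q v * E e \<approx> 0" by (simp add: gap_def left_diff_distrib)
  have "E' e * (\<Sum>f\<in>out_arcs G v. E f * E' f) \<approx> (\<Sum>f\<in>out_arcs G v. if f = e then V (head G e) * E' e else 0)"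
    unfolding sum_distrib_left
  proof (rule eqv_sum)
    fix f assume "f \<in> out_arcs G v"
    then have "E' e * E f \<approx> (if f = e then V (head G e) else 0)"
      using ghost_edge[of e f] e' by (auto split: if_splits)
    from eqv_rmult[OF this, of "E' f"]
    show "E' e * (E f * E' f) \<approx> (if f = e then V (head G e) * E' e else 0)"
      by (simp add: mult.assoc split: if_splits)
  qed
  also have "\<dots> = V (head G e) * E' e" using fin e by (simp add: sum.delta')
  also have "\<dots> \<approx> E' e" by (rule head_ghost)
  finally have "E' e * V v - E' e * (\<Sum>f\<in>out_arcs G v. E f * E' f) \<approx> E' e - E' e"
    using ghost_tail[of e] e' by (intro eqv_diff) auto
  then show "E' e * q v \<approx> 0" by (simp add: gap_def right_diff_distrib)
qed

lemma gap_vertex: "V v * q v \<approx> q v" "q v * V v \<approx> q v"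
proof -
  have "V v * (\<Sum>e\<in>out_arcs G v. E e * E' e) \<approx> (\<Sum>e\<in>out_arcs G v. E e * E' e)"
    unfolding sum_distrib_left
  proof (rule eqv_sum)
    fix e assume "e \<in> out_arcs G v"
    then show "V v * (E e * E' e) \<approx> E e * E' e"
      using eqv_rmult[OF tail_edge[of e]] by (auto simp: mult.assoc)
  qed
  then show "V v * q v \<approx> q v"
    using eqv_diff[OF vertex_idem] by (simp add: gap_def right_diff_distrib)
  have "(\<Sum>e\<in>out_arcs G v. E e * E' e) * V v \<approx> (\<Sum>e\<in>out_arcs G v. E e * E' e)"
    unfolding sum_distrib_right
  proof (rule eqv_sum)
    fix e assume "e \<in> out_arcs G v"
    then show "E e * E' e * V v \<approx> E e * E' e"
      using eqv_lmult[OF ghost_tail[of e]] by (auto simp: mult.assoc)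
  qed
  then show "q v * V v \<approx> q v"
    using eqv_diff[OF vertex_idem] by (simp add: gap_def left_diff_distrib)
qed

lemma gap_rp:
  assumes fin: "finite (out_arcs G v)" and p: "awalk u p w" and ne: "p \<noteq> [] \<or> u \<noteq> v"
  shows "q v * rp u p \<approx> 0"
proof (cases "u = v")
  case True
  then obtain e p' where e: "p = e # p'" "e \<in> out_arcs G v"
    using ne p by (cases p) (auto simp: awalk_Cons_iff)
  have "(q v * E e) * rp (head G e) p' \<approx> 0 * rp (head G e) p'"
    by (intro eqv_rmult gap_edge fin e)
  then show ?thesis by (simp add: e mult.assoc)
next
  case False
  have "q v * rp u p \<approx> (q v * V v) * rp u p" by (intro eqv_rmult eqv_sym[OF gap_vertex(2)])
  also have "\<dots> = q v * (V v * rp u p)" by (simp add: mult.assoc)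
  also have "\<dots> \<approx> q v * 0" using False by (intro eqv_lmult vertex_rp_orth[OF p]) auto
  finally show ?thesis by simp
qed

lemma gp_gap:
  assumes fin: "finite (out_arcs G v)" and p: "awalk u p w" and ne: "p \<noteq> [] \<or> u \<noteq> v"
  shows "gp u p * q v \<approx> 0"
proof (cases "u = v")
  case True
  then obtain e p' where e: "p = e # p'" "e \<in> out_arcs G v"
    using ne p by (cases p) (auto simp: awalk_Cons_iff)
  have "gp (head G e) p' * (E' e * q v) \<approx> gp (head G e) p' * 0"
    by (intro eqv_lmult gap_edge fin e)
  then show ?thesis by (simp add: e mult.assoc)
next
  case False
  have "gp u p * q v \<approx> gp u p * (V v * q v)" by (intro eqv_lmult eqv_sym[OF gap_vertex(1)])
  also have "\<dots> = (gp u p * V v) * q v" by (simp add: mult.assoc)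
  also have "\<dots> \<approx> 0 * q v" using False by (intro eqv_rmult gp_vertex_orth[OF p]) auto
  finally show ?thesis by simp
qed

lemma gap_idem:
  assumes "finite (out_arcs G v)"
  shows "q v * q v \<approx> q v"
proof -
  have "q v * (\<Sum>e\<in>out_arcs G v. E e * E' e) \<approx> (\<Sum>e\<in>out_arcs G v. 0)"
    unfolding sum_distrib_left
  proof (rule eqv_sum)
    fix e assume "e \<in> out_arcs G v"
    from eqv_rmult[OF gap_edge(1)[OF assms this], of "E' e"]
    show "q v * (E e * E' e) \<approx> 0" by (simp add: mult.assoc)
  qed
  moreover have "q v * q v = q v * V v - q v * (\<Sum>e\<in>out_arcs G v. E e * E' e)"
    by (subst (2) gap_def) (simp add: right_diff_distrib)
  ultimately show ?thesis using eqv_diff[OF gap_vertex(2)] by fastforce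
qed

text \<open>Between two copies of \<open>q v\<close> every monomial with a nontrivial real or ghost
  part vanishes, so only \<open>V v * V v\<close> contributes. The constant term of \<open>x\<close>
  is split off since monomials span only elements without one.\<close>

lemma gap_corner:
  assumes fin: "finite (out_arcs G v)"
  shows "\<exists>c. q v * x * q v \<approx> scalar c * q v"
proof -
  define c where "c = Poly_Mapping.lookup x 0"
  have "x - scalar c \<in> jspan J monomials"
    by (rule span_monomials) (simp add: c_def lookup_minus)
  then have "q v * (x - scalar c) * q v \<in> jspan J {q v}"
  proof (rule jspan_bind[rotated])
    fix m assume "m \<in> monomials"
    then obtain u p u' p' w where m: "m = rp u p * gp u' p'" and p: "awalk u p w" "awalk u' p' w"
      unfolding monomials_def by blast
    have *: "q v * m * q v = (q v * rp u p) * (gp u' p' * q v)" by (simp add: m mult.assoc)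
    show "q v * m * q v \<in> jspan J {q v}"
    proof (cases "p = [] \<and> u = v \<and> p' = [] \<and> u' = v")
      case True
      have "(q v * V v) * (V v * q v) \<approx> q v"
        by (rule eqv_trans[OF eqv_mult[OF gap_vertex(2) gap_vertex(1)] gap_idem[OF fin]])
      then show ?thesis unfolding * using True by (auto intro: jspan_cong jspan_base)
    next
      case False
      have "(q v * rp u p) * (gp u' p' * q v) \<approx> 0"
      proof (cases "p = [] \<and> u = v")
        case True
        then have "gp u' p' * q v \<approx> 0" using False by (intro gp_gap[OF fin p(2)]) auto
        from eqv_lmult[OF this] show ?thesis by simp
      next
        case False
        then have "q v * rp u p \<approx> 0" by (intro gap_rp[OF fin p(1)]) auto
        from eqv_rmult[OF this] show ?thesis by simp
      qed
      then show ?thesis unfolding * using jspan_zero by (rule jspan_cong)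
    qed
  qed
  then obtain d where d: "q v * (x - scalar c) * q v \<approx> scalar d * q v" using jspan_singleton by blast
  have "q v * x * q v = q v * (x - scalar c) * q v + scalar c * (q v * q v)"
    by (simp add: algebra_simps scalar_commute')
  also have "\<dots> \<approx> scalar d * q v + scalar c * q v"
    by (intro eqv_add d eqv_lmult gap_idem[OF fin])
  finally show ?thesis by (intro exI[of _ "d + c"]) (simp add: single_add distrib_right)
qed

lemma commutative_corner_gap:
  assumes fin: "finite (out_arcs G v)"
  shows "commutative_corner J (q v)"
proof unfold_locales
  show "q v * q v \<approx> q v" by (rule gap_idem[OF fin])
  fix x y
  obtain c d where c: "q v * x * q v \<approx> scalar c * q v" and d: "q v * y * q v \<approx> scalar d * q v"
    using gap_corner[OF fin] by meson
  have "q v * x * q v * y * q v \<approx> scalar c * q v * y * q v" by (intro eqv_rmult c)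
  also have "\<dots> = scalar c * (q v * y * q v)" by (simp add: mult.assoc)
  also have "\<dots> \<approx> scalar c * (scalar d * q v)" by (intro eqv_lmult d)
  also have "\<dots> = scalar d * (scalar c * q v)" by (simp add: mult.commute flip: mult.assoc scalar_mult)
  also have "\<dots> \<approx> scalar d * (q v * x * q v)" by (intro eqv_lmult eqv_sym[OF c])
  also have "\<dots> = scalar d * q v * x * q v" by (simp add: mult.assoc)
  also have "\<dots> \<approx> q v * y * q v * x * q v" by (intro eqv_rmult eqv_sym[OF d])
  finally show "q v * x * q v * y * q v \<approx> q v * y * q v * x * q v" .
qed

text \<open>The ghost of a shortest path \<open>p\<close> in \<open>b\<close> turns \<open>p\<close>
  into \<open>V v\<close>, a proper prolongation of \<open>p\<close> into a nonempty closed path,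
  and any other path into 0: by minimality none is a proper initial segment of
  \<open>p\<close>.\<close>

lemma ghost_of_shortest_path:
  assumes b: "b \<in> jspan J (paths_to v)" "b \<notin> J"
  obtains u p k where "awalk u p v" "k \<noteq> 0" "gp u p * b - scalar k * V v \<in> jspan J (closed_paths v)"
proof -
  obtain A k where A: "finite A" "A \<subseteq> {(u, p). awalk u p v}" and k: "\<forall>i\<in>A. k i \<noteq> 0"
    and bA: "b \<approx> (\<Sum>i\<in>A. scalar (k i) * (case i of (u, p) \<Rightarrow> rp u p))"
    by (rule jspan_family[OF b(1)[unfolded paths_to_def]])
  have "A \<noteq> {}"
  proof
    assume "A = {}"
    with bA have "b \<approx> 0" by simp
    then show False using b(2) mem_iff_eqv_zero by blast
  qed
  then obtain i0 where "i0 \<in> A" by blast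
  then obtain i where i: "i \<in> A" and min: "\<And>j. j \<in> A \<Longrightarrow> length (snd i) \<le> length (snd j)"
    using ex_has_least_nat[of "\<lambda>i. i \<in> A" i0 "\<lambda>j. length (snd j)"] by blast
  obtain u p where up: "i = (u, p)" by (cases i)
  have p: "awalk u p v" using A(2) i up by auto
  have "gp u p * (\<Sum>i\<in>A - {i}. scalar (k i) * (case i of (u, p) \<Rightarrow> rp u p)) \<in> jspan J (closed_paths v)"
    unfolding sum_distrib_left
  proof (rule jspan_sum)
    fix j assume j: "j \<in> A - {i}"
    obtain u' p' where up': "j = (u', p')" by (cases j)
    have p': "awalk u' p' v" using A(2) j up' by auto
    have "gp u p * rp u' p' \<in> jspan J (closed_paths v)"
    proof (cases "u = u' \<and> prefix p p'")
      case True
      then obtain r where r: "p' = p @ r" "u' = u" by (auto simp: prefix_def)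
      then have "r \<noteq> []" using j up up' by auto
      moreover have "awalk v r v" using p p' awalk_ends_eqD by (auto simp: r)
      ultimately show ?thesis
        using gp_rp_append(1)[OF p \<open>awalk v r v\<close>] by (auto simp: r closed_paths_def intro: jspan_cong jspan_base)
    next
      case False
      have "gp u p * rp u' p' \<approx> 0"
      proof (cases "u = u'")
        case True
        have "\<not> prefix p' p"
        proof
          assume "prefix p' p"
          then have "p' = p" using min[of j] j up up' by (auto simp: prefix_def)
          then show False using False True by simp
        qed
        then show ?thesis using gp_rp_incomparable p p' False True by blast
      qed (rule gp_rp_sources_orth[OF p p'])
      then show ?thesis using jspan_cong jspan_zero by blast
    qed
    then show "gp u p * (scalar (k j) * (case j of (u, p) \<Rightarrow> rp u p)) \<in> jspan J (closed_paths v)"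
      by (simp add: up' scalar_commute' jspan_scalar)
  qed
  moreover have "gp u p * b - scalar (k i) * V v \<approx>
      gp u p * (\<Sum>i\<in>A. scalar (k i) * (case i of (u, p) \<Rightarrow> rp u p)) - scalar (k i) * (gp u p * rp u p)"
    by (intro eqv_diff eqv_lmult bA eqv_sym[OF gp_rp[OF p]])
  moreover have "gp u p * (\<Sum>i\<in>A. scalar (k i) * (case i of (u, p) \<Rightarrow> rp u p)) - scalar (k i) * (gp u p * rp u p)
      = gp u p * (\<Sum>i\<in>A - {i}. scalar (k i) * (case i of (u, p) \<Rightarrow> rp u p))"
    using sum.remove[OF A(1) i, of "\<lambda>i. scalar (k i) * (case i of (u, p) \<Rightarrow> rp u p)"]
    by (simp add: up distrib_left scalar_commute')
  ultimately have "gp u p * b - scalar (k i) * V v \<in> jspan J (closed_paths v)"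
    using jspan_cong by simp
  then show thesis using that p k i by blast
qed

text \<open>
  The terms other than those without ghost edges end in one of finitely many
  ghost edges, so that they are fixed by a finite part of the sum of the elements \<open>e e\<^sup>*\<close>.
\<close>

lemma split_ghost_terms:
  assumes "x \<in> jspan J (bounded_monomials n)"
  shows "\<exists>b A. b \<in> jspan J (paths_to v) \<and> finite A \<and> A \<subseteq> out_arcs G v \<and>
    (\<forall>B. finite B \<longrightarrow> A \<subseteq> B \<longrightarrow> B \<subseteq> out_arcs G v \<longrightarrow>
       (x * V v - b) * (\<Sum>e\<in>B. E e * E' e) \<approx> x * V v - b)"
  using assms
proof (induction x rule: jspan.induct)
  case (mem x)
  have "(x * V v - 0) * s \<approx> x * V v - 0" for s
    using mem by (simp add: eqv_def diff rmult)
  then show ?case by (intro exI[of _ 0] exI[of _ "{}"]) (simp add: jspan_zero)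
next
  case (step m x c)
  obtain b A where b: "b \<in> jspan J (paths_to v)" "finite A" "A \<subseteq> out_arcs G v" and
    stable: "\<And>B. finite B \<Longrightarrow> A \<subseteq> B \<Longrightarrow> B \<subseteq> out_arcs G v \<Longrightarrow>
       (x * V v - b) * (\<Sum>e\<in>B. E e * E' e) \<approx> x * V v - b"
    using step.IH by auto
  obtain u p v' r w where m: "m = rp u p * gp v' r" and p: "awalk u p w" and r: "awalk v' r w"
    using step.hyps(1) unfolding bounded_monomials_def by auto
  have "\<exists>a A'. a \<in> jspan J (paths_to v) \<and> finite A' \<and> A' \<subseteq> out_arcs G v \<and>
     (\<forall>B. finite B \<longrightarrow> A' \<subseteq> B \<longrightarrow> B \<subseteq> out_arcs G v \<longrightarrow>
       (m * V v - a) * (\<Sum>e\<in>B. E e * E' e) \<approx> m * V v - a)"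
  proof (cases "v' = v \<and> r \<noteq> []")
    case False
    \<comment> \<open>Either \<open>V v\<close> kills the monomial or the monomial is a real path to
      \<open>v\<close>. In both cases \<open>a\<close> can absorb it up to \<open>J\<close>.\<close>
    have "\<exists>a. a \<in> jspan J (paths_to v) \<and> m * V v - a \<in> J"
    proof (cases "v' = v")
      case True
      then have w: "r = []" "w = v" using False r by (auto simp: awalk_Nil_iff)
      have "m * V v = rp u p * V v * V v" by (simp add: m w True)
      also have "\<dots> \<approx> rp u p * V v" using p w by (intro eqv_rmult rp_target) simp
      also have "\<dots> \<approx> rp u p" using p w by (intro rp_target) simp
      finally show ?thesis using p w unfolding eqv_def
        by (intro exI[of _ "rp u p"]) (auto simp: paths_to_def intro!: jspan_base)
    next
      case False
      have "m * V v \<approx> 0"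
        using eqv_lmult[OF gp_vertex_orth[OF r, of v], of "rp u p"] False by (auto simp: m mult.assoc)
      then show ?thesis using jspan_zero by (intro exI[of _ 0]) (simp add: eqv_def)
    qed
    then obtain a where a: "a \<in> jspan J (paths_to v)" "m * V v - a \<in> J" by blast
    have "(m * V v - a) * s \<approx> m * V v - a" for s
      using a(2) by (simp add: eqv_def diff rmult)
    then show ?thesis using a(1) by (intro exI[of _ a] exI[of _ "{}"]) simp
  next
    case True
    then obtain f r' where f: "r = f # r'" "f \<in> arcs G" "tail G f = v"
      using r by (cases r) (auto simp: awalk_Cons_iff)
    \<comment> \<open>Modulo \<open>J\<close> the monomial is \<open>y * E' f\<close>, and the
      single term \<open>E f * E' f\<close> already fixes it from the right; the other terms of the
      sum contribute 0.\<close>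
    define y where "y = rp u p * gp (head G f) r'"
    have mV: "m * V v \<approx> y * E' f"
      using eqv_lmult[OF ghost_tail[of f], of y] by (simp add: m f y_def mult.assoc)
    have "(m * V v - 0) * (\<Sum>e\<in>B. E e * E' e) \<approx> m * V v - 0"
      if B: "finite B" "{f} \<subseteq> B" "B \<subseteq> out_arcs G v" for B
    proof -
      have "m * V v * (\<Sum>e\<in>B. E e * E' e) \<approx> y * E' f * (\<Sum>e\<in>B. E e * E' e)"
        by (intro eqv_rmult mV)
      also have "\<dots> = (\<Sum>e\<in>B. (y * E' f) * (E e * E' e))"
        by (simp add: sum_distrib_left)
      also have "\<dots> \<approx> (\<Sum>e\<in>B. if e = f then y * V (head G f) * E' f else 0)"
      proof (rule eqv_sum)
        fix e assume "e \<in> B"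
        then have "E' f * E e \<approx> (if f = e then V (head G f) else 0)"
          using B f by (intro ghost_edge) auto
        from eqv_mid[OF this, of y "E' e"]
        show "y * E' f * (E e * E' e) \<approx> (if e = f then y * V (head G f) * E' f else 0)"
          by (auto split: if_splits)
      qed
      also have "\<dots> = y * (V (head G f) * E' f)" using B by (simp add: sum.delta' mult.assoc)
      also have "\<dots> \<approx> y * E' f" by (intro eqv_lmult head_ghost)
      also have "\<dots> \<approx> m * V v" by (rule eqv_sym[OF mV])
      finally show ?thesis by simp
    qed
    then show ?thesis using f jspan_zero by (intro exI[of _ 0] exI[of _ "{f}"]) auto
  qed
  then obtain a A' where a: "a \<in> jspan J (paths_to v)" "finite A'" "A' \<subseteq> out_arcs G v" and
    stable': "\<And>B. finite B \<Longrightarrow> A' \<subseteq> B \<Longrightarrow> B \<subseteq> out_arcs G v \<Longrightarrow>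
       (m * V v - a) * (\<Sum>e\<in>B. E e * E' e) \<approx> m * V v - a"
    by auto
  show ?case
  proof (intro exI[of _ "scalar c * a + b"] exI[of _ "A' \<union> A"] conjI allI impI)
    show "scalar c * a + b \<in> jspan J (paths_to v)" using a b by (intro jspan_add jspan_scalar)
    fix B assume "finite B" "A' \<union> A \<subseteq> B" "B \<subseteq> out_arcs G v"
    then have "scalar c * ((m * V v - a) * (\<Sum>e\<in>B. E e * E' e)) + (x * V v - b) * (\<Sum>e\<in>B. E e * E' e)
      \<approx> scalar c * (m * V v - a) + (x * V v - b)"
      by (intro eqv_add eqv_lmult stable stable') auto
    then show "((scalar c * m + x) * V v - (scalar c * a + b)) * (\<Sum>e\<in>B. E e * E' e)
      \<approx> (scalar c * m + x) * V v - (scalar c * a + b)"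
      by (simp only: left_diff_distrib distrib_right right_diff_distrib mult.assoc diff_add_eq
          add_diff_eq diff_diff_eq2 diff_diff_eq add.commute add.left_commute)
  qed (use a b in auto)
qed

end

section \<open>Reduction to closed paths\<close>

lemma (in free_ideal) jspan_commute:
  assumes "\<And>m m'. \<lbrakk>m \<in> S; m' \<in> S'\<rbrakk> \<Longrightarrow> m * m' \<approx> m' * m" "x \<in> jspan J S" "y \<in> jspan J S'"
  shows "x * y \<approx> y * x"
  using assms(2)
proof (induction x rule: jspan.induct)
  case (mem x)
  then show ?case by (simp add: eqv_def diff lmult rmult)
next
  case (step m x c)
  from assms(3) have "m * y \<approx> y * m"
  proof (induction y rule: jspan.induct)
    case (mem y)
    then show ?case by (simp add: eqv_def diff lmult rmult)
  next
    case (step m' y d)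
    from eqv_add[OF eqv_lmult[OF assms(1)[OF \<open>m \<in> S\<close> step.hyps(1)], of "scalar d"] step.IH]
    show ?case by (simp add: distrib_left distrib_right scalar_commute' mult.assoc)
  qed
  from eqv_add[OF eqv_lmult[OF this, of "scalar c"] step.IH]
  show ?case by (simp add: distrib_left distrib_right scalar_commute' mult.assoc)
qed

lemma (in free_ideal) scalar_cancel:
  assumes "k \<noteq> 0" "scalar k * x \<in> J"
  shows "x \<in> J"
proof -
  have "scalar (inverse k) * (scalar k * x) \<in> J" by (rule lmult) fact
  moreover have "scalar (inverse k) * (scalar k * x) = scalar (inverse k * k) * x"
    by (simp add: mult.assoc)
  ultimately show ?thesis using assms(1) by (simp del: scalar_mult)
qed

text \<open>
  The situation \<open>J = I(H) \<subseteq> I\<close> over the graph of the vertices outside \<open>H\<close>, with the conclusion of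
  the lemma on commutative corners as the only trace of pure infiniteness.
\<close>

locale graded_cohn_ideal = cohn_ideal G J + I: two_sided_ideal I
  for G :: "('v, 'e) pre_digraph" and J I :: "(('v, 'e) lpa_gen free_word \<Rightarrow>\<^sub>0 'k::field) set" +
  assumes subset: "J \<subseteq> I"
    and graded: "x \<in> J \<Longrightarrow> hcomp d x \<in> J"
    and vertex_not_mem: "v \<in> verts G \<Longrightarrow> gen (Vertex v) \<notin> I"
    and no_constant_term: "x \<in> I \<Longrightarrow> Poly_Mapping.lookup x 0 = 0"
    and quasi_regular: "\<lbrakk>commutative_corner J w; u \<in> I; w * u - u \<in> J; u * w - u \<in> J\<rbrakk>
      \<Longrightarrow> \<exists>z. (w - u) * z - w \<in> J"
begin

lemma eqv_I: "x \<approx> y \<Longrightarrow> x \<in> I \<longleftrightarrow> y \<in> I"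
  using subset I.add[of "x - y" y] I.diff[of x "x - y"] by (auto simp: eqv_def)

lemma I_scalar_cancel: "k \<noteq> 0 \<Longrightarrow> scalar k * x \<in> I \<Longrightarrow> x \<in> I"
  using free_ideal.scalar_cancel[of I] I.two_sided_ideal_axioms by (auto simp: free_ideal_def)

lemma hcomp_closed_paths: "y \<in> jspan J (closed_paths v) \<Longrightarrow> hcomp 0 y \<in> J"
proof (induction y rule: jspan.induct)
  case (step m x c)
  then obtain p where p: "p \<noteq> []" "m = rp v p" by (auto simp: closed_paths_def)
  have "hcomp 0 (scalar c * m) = 0"
    using hcomp_homogeneous[OF homogeneous_scalar_mult[OF homogeneous_rpath[of p G v], of c], of 0] p
    by simp
  then show ?case using step.IH by (simp add: hcomp_add)
qed (rule graded)

text \<open>Nonempty closed paths have positive degree, so the degree 0 component is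
  \<open>scalar k * V v\<close> modulo \<open>J\<close>. It lies in \<open>J\<close>, which is
  graded and contains no vertex of the graph.\<close>

lemma constant_coefficient_zero:
  assumes "v \<in> verts G" "scalar k * V v + y \<in> J" "y \<in> jspan J (closed_paths v)"
  shows "k = 0"
proof (rule ccontr)
  assume k: "k \<noteq> 0"
  have "homogeneous 0 (scalar k * V v)"
    using homogeneous_scalar_mult[OF homogeneous_gen[of "Vertex v"], of k] by simp
  then have "hcomp 0 (scalar k * V v + y) = scalar k * V v + hcomp 0 y"
    by (simp add: hcomp_add hcomp_homogeneous)
  then have "scalar k * V v + hcomp 0 y \<in> J" using graded[OF assms(2), of 0] by simp
  from diff[OF this hcomp_closed_paths[OF assms(3)]] have "scalar k * V v \<in> J" by simp
  then show False using scalar_cancel[OF k] vertex_not_mem[OF assms(1)] subset by blast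
qed

text \<open>Quasi-regularity of \<open>q v\<close> inside its own corner: the element to be inverted
  is \<open>q v - q v\<close>, so the corner has to vanish.\<close>

lemma gap_mem:
  assumes "finite (out_arcs G v)" "q v \<in> I"
  shows "q v \<in> J"
proof -
  have "q v * q v - q v \<in> J" using gap_idem[OF assms(1)] by (simp add: eqv_def)
  then obtain z where "(q v - q v) * z - q v \<in> J"
    using quasi_regular[OF commutative_corner_gap[OF assms(1)] assms(2)] by blast
  then show ?thesis using uminus by fastforce
qed

text \<open>A ghost path reduces a nonzero \<open>b\<close> to a multiple of \<open>V v\<close> plus
  closed paths, and \<open>q v\<close> kills the latter. Thus \<open>b * q v\<close> in
  \<open>I\<close> puts a nonzero multiple of \<open>q v\<close> into \<open>I\<close>, and
  \<open>gap_mem\<close> applies.\<close>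

lemma gap_cancel:
  assumes fin: "finite (out_arcs G v)" and b: "b \<in> jspan J (paths_to v)" and I: "b * q v \<in> I"
  shows "b * q v \<in> J"
proof (cases "b \<in> J")
  case False
  obtain u p k where k: "k \<noteq> 0" and y: "gp u p * b - scalar k * V v \<in> jspan J (closed_paths v)"
    using ghost_of_shortest_path[OF b False] by metis
  define y where "y = gp u p * b - scalar k * V v"
  have "q v * y \<in> jspan J {}"
    using _ y[folded y_def]
  proof (rule jspan_lmult)
    fix m assume "m \<in> closed_paths v"
    then show "q v * m \<in> jspan J {}"
      using gap_rp[OF fin] by (auto simp: closed_paths_def mem_iff_eqv_zero intro!: jspan.mem)
  qed
  then have qy: "q v * y \<in> J" using jspan_null by blast
  have "q v * (gp u p * b) * q v = q v * y * q v + scalar k * (q v * V v * q v)"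
    by (simp add: y_def algebra_simps scalar_commute')
  also have "\<dots> \<approx> 0 * q v + scalar k * (q v * q v)"
    using qy by (intro eqv_add eqv_rmult eqv_lmult gap_vertex) (simp add: mem_iff_eqv_zero)
  also have "\<dots> \<approx> scalar k * q v" using eqv_lmult[OF gap_idem[OF fin]] by simp
  finally have "q v * (gp u p * b) * q v \<approx> scalar k * q v" .
  moreover have "q v * (gp u p * b) * q v \<in> I"
    using I.lmult[OF I, of "q v * gp u p"] by (simp add: mult.assoc)
  ultimately have "scalar k * q v \<in> I" using eqv_I by blast
  then have "q v \<in> J" using I_scalar_cancel[OF k] gap_mem[OF fin] by blast
  then show ?thesis by (rule lmult)
qed (rule rmult)

text \<open>Reduce \<open>b\<close> to \<open>scalar k * V v\<close> plus closed paths and multiply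
  by \<open>E' e\<close> on the left and \<open>E e\<close> on the right. Closed paths that begin
  with \<open>e\<close> are rotated to closed paths at the head of \<open>e\<close>, the others die.
  The result lies in \<open>J\<close> with constant coefficient \<open>k\<close>, which is
  impossible.\<close>

lemma edge_cancel:
  assumes b: "b \<in> jspan J (paths_to v)" and e: "e \<in> out_arcs G v" and J: "b * E e \<in> J"
  shows "b \<in> J"
proof (rule ccontr)
  assume "b \<notin> J"
  then obtain u p k where k: "k \<noteq> 0" and y: "gp u p * b - scalar k * V v \<in> jspan J (closed_paths v)"
    using ghost_of_shortest_path[OF b] by metis
  define y where "y = gp u p * b - scalar k * V v"
  have e': "e \<in> arcs G" "tail G e = v" using e by auto
  have y': "E' e * y * E e \<in> jspan J (closed_paths (head G e))"
    using _ y[folded y_def]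
  proof (rule jspan_bind)
    fix m assume "m \<in> closed_paths v"
    then obtain f c where m: "m = E f * rp (head G f) c" and f: "f \<in> arcs G" "awalk (head G f) c v"
      by (auto simp: closed_paths_def neq_Nil_conv awalk_Cons_iff)
    have *: "E' e * m * E e = (E' e * E f) * (rp (head G f) c * E e)" by (simp add: m mult.assoc)
    have "(E' e * E f) * (rp (head G f) c * E e) \<approx> (if e = f then V (head G e) else 0) * (rp (head G f) c * E e)"
      by (intro eqv_rmult ghost_edge e' f)
    moreover have "(if e = f then V (head G e) else 0) * (rp (head G f) c * E e) \<in> jspan J (closed_paths (head G e))"
    proof (cases "e = f")
      case True
      have ve: "awalk v [e] (head G e)" using e' by (auto simp: awalk_simps)
      have "V (head G e) * (rp (head G f) c * E e) = (V (head G f) * rp (head G f) c) * E e"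
        using True by (simp add: mult.assoc)
      also have "\<dots> \<approx> rp (head G f) c * E e" by (intro eqv_rmult source_rp[OF f(2)])
      also have "\<dots> \<approx> rp (head G f) c * rp v [e]"
        using eqv_sym[OF edge_head] by (auto intro: eqv_lmult)
      also have "\<dots> \<approx> rp (head G f) (c @ [e])" by (rule rp_append[OF f(2) ve])
      finally have "V (head G e) * (rp (head G f) c * E e) \<approx> rp (head G f) (c @ [e])" .
      moreover have "rp (head G f) (c @ [e]) \<in> closed_paths (head G e)"
        using f ve True unfolding closed_paths_def by (intro image_eqI[of _ _ "c @ [e]"]) auto
      ultimately show ?thesis using True jspan_base jspan_cong by simp
    qed (simp add: jspan_zero)
    ultimately show "E' e * m * E e \<in> jspan J (closed_paths (head G e))"
      unfolding * by (rule jspan_cong)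
  qed
  have "E' e * gp u p * (b * E e) = scalar k * (E' e * V v * E e) + E' e * y * E e"
    by (simp add: y_def algebra_simps scalar_commute')
  also have "\<dots> \<approx> scalar k * (E' e * E e) + E' e * y * E e"
    using ghost_tail[of e] e' by (intro eqv_add eqv_lmult eqv_rmult eqv_refl) auto
  also have "\<dots> \<approx> scalar k * V (head G e) + E' e * y * E e"
    using ghost_edge[OF e'(1) e'(1)] by (intro eqv_add eqv_lmult eqv_refl) simp
  finally have "scalar k * V (head G e) + E' e * y * E e \<in> J"
    using mem_cong lmult[OF J] by blast
  then have "k = 0" using e' y' by (intro constant_coefficient_zero) auto
  then show False using k by simp
qed

lemma ex_vertex_right:
  assumes "x \<in> I" "x \<notin> J"
  shows "\<exists>v. x * V v \<notin> J"
proof (rule ccontr)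
  assume "\<nexists>v. x * V v \<notin> J"
  then have all: "x * V v \<in> J" for v by blast
  obtain A where A: "finite A" "\<And>B. \<lbrakk>finite B; A \<subseteq> B\<rbrakk> \<Longrightarrow> x * (\<Sum>v\<in>B. V v) \<approx> x"
    using local_units[OF no_constant_term[OF assms(1)]] by blast
  have "x * (\<Sum>v\<in>A. V v) \<in> J"
    unfolding sum_distrib_left by (rule sum) (rule all)
  then show False using mem_cong[OF A(2)] A(1) assms(2) by blast
qed

text \<open>The edge cancels the rightmost ghost edge or kills the monomial. Without ghost edges it
  prolongs the real path, and the ghost part remains empty.\<close>

lemma bounded_monomial_edge:
  assumes x: "x \<in> jspan J (bounded_monomials (Suc n))" and e: "e \<in> out_arcs G v"
  shows "x * V v * E e \<in> jspan J (bounded_monomials n)"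
proof -
  have e': "e \<in> arcs G" "tail G e = v" using e by auto
  have "x * (V v * E e) \<in> jspan J (bounded_monomials n)"
    using _ x
  proof (rule jspan_rmult)
    fix m assume "m \<in> bounded_monomials (Suc n)"
    then obtain u p v' r w where m: "m = rp u p * gp v' r" and p: "awalk u p w" and r: "awalk v' r w"
      and len: "length r \<le> Suc n"
      unfolding bounded_monomials_def by blast
    show "m * (V v * E e) \<in> jspan J (bounded_monomials n)"
    proof (cases "v' = v")
      case False
      have "rp u p * (gp v' r * V v) * E e \<approx> rp u p * 0 * E e"
        using False by (intro eqv_rmult eqv_lmult gp_vertex_orth[OF r]) auto
      then show ?thesis using jspan_zero by (auto simp: m mult.assoc intro: jspan_cong)
    next
      case v': True
      have ve: "awalk v [e] (head G e)" using e' by (auto simp: awalk_simps)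
      have mV: "m * (V v * E e) \<approx> m * E e"
        using tail_edge[of e] e' by (intro eqv_lmult) auto
      show ?thesis
      proof (cases r)
        case Nil
        then have w: "w = v" using r v' by (auto simp: awalk_Nil_iff)
        note mV
        also have "m * E e = (rp u p * V v) * E e" by (simp add: m Nil v')
        also have "\<dots> \<approx> rp u p * E e" using p w by (intro eqv_rmult rp_target) simp
        also have "\<dots> \<approx> rp u p * ((E e * V (head G e)) * V (head G e))"
          by (intro eqv_lmult eqv_sym[OF eqv_trans[OF eqv_rmult[OF edge_head] edge_head]])
        also have "\<dots> = (rp u p * rp v [e]) * V (head G e)" by (simp add: mult.assoc)
        also have "\<dots> \<approx> rp u (p @ [e]) * gp (head G e) []"
          using rp_append[OF _ ve] p w by (auto intro: eqv_rmult)
        finally have "m * (V v * E e) \<approx> rp u (p @ [e]) * gp (head G e) []" .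
        moreover have "rp u (p @ [e]) * gp (head G e) [] \<in> bounded_monomials n"
          using p w ve e' unfolding bounded_monomials_def
          by (intro CollectI exI[of _ u] exI[of _ "p @ [e]"] exI[of _ "head G e"] exI[of _ "[]"])
            (auto simp: awalk_Nil_iff)
        ultimately show ?thesis using jspan_base jspan_cong by blast
      next
        case (Cons f r')
        then have f: "f \<in> arcs G" "awalk (head G f) r' w" using r by (auto simp: awalk_Cons_iff)
        note mV
        also have "m * E e = rp u p * gp (head G f) r' * E' f * (E e * 1)"
          by (simp add: m Cons mult.assoc)
        also have "\<dots> \<approx> rp u p * gp (head G f) r' * (if f = e then V (head G f) else 0) * 1"
          by (intro eqv_mid ghost_edge f e')
        also have "\<dots> \<approx> (if f = e then rp u p * gp (head G f) r' else 0)"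
          using eqv_lmult[OF gp_source[OF f(2)], of "rp u p"] by (auto simp: mult.assoc)
        finally have "m * (V v * E e) \<approx> (if f = e then rp u p * gp (head G f) r' else 0)" .
        moreover have "rp u p * gp (head G f) r' \<in> bounded_monomials n"
        proof -
          have "length r' \<le> n" using len Cons by simp
          then show ?thesis using p f(2) unfolding bounded_monomials_def by blast
        qed
        ultimately show ?thesis
          by (cases "f = e") (auto intro: jspan_cong jspan_base jspan_zero)
      qed
    qed
  qed
  then show ?thesis by (simp add: mult.assoc)
qed

text \<open>Any edge that does not kill \<open>x * V v\<close> shortens the ghost parts. If all
  edges from \<open>v\<close> kill it, \<open>x * V v\<close> is \<open>b\<close> minus
  \<open>b\<close> times a partial sum of the \<open>E e * E' e\<close>, with \<open>b\<close> free
  of ghost edges; then \<open>gap_cancel\<close> settles a finite emitter and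
  \<open>edge_cancel\<close> an infinite one.\<close>

lemma ex_real_path_element:
  "\<lbrakk>x \<in> I; x \<notin> J; x \<in> jspan J (bounded_monomials n)\<rbrakk>
    \<Longrightarrow> \<exists>v y. y \<in> I \<and> y \<notin> J \<and> y \<in> jspan J (paths_to v)"
proof (induction n arbitrary: x)
  case 0
  obtain v where v: "x * V v \<notin> J" using ex_vertex_right 0 by blast
  have "x * V v \<in> jspan J (paths_to v)"
    using _ 0(3)
  proof (rule jspan_rmult)
    fix m assume "m \<in> bounded_monomials 0"
    then obtain u p v' where m: "m = rp u p * V v'" and p: "awalk u p v'"
      unfolding bounded_monomials_def by (auto simp: awalk_Nil_iff)
    have "m * V v \<approx> rp u p * V v" unfolding m by (intro eqv_rmult rp_target[OF p])
    also have "\<dots> \<approx> (if v = v' then rp u p else 0)"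
      using rp_target[OF p] rp_vertex_orth[OF p, of v] by auto
    finally have "m * V v \<approx> (if v = v' then rp u p else 0)" .
    moreover have "rp u p \<in> paths_to v'"
      using p unfolding paths_to_def by (intro image_eqI[of _ _ "(u, p)"]) auto
    ultimately show "m * V v \<in> jspan J (paths_to v)"
      by (cases "v = v'") (auto intro: jspan_cong jspan_base jspan_zero)
  qed
  then show ?case using v I.rmult[OF 0(1)] by blast
next
  case (Suc n)
  obtain v where v: "x * V v \<notin> J" using ex_vertex_right Suc.prems by blast
  show ?case
  proof (cases "\<exists>e\<in>out_arcs G v. x * V v * E e \<notin> J")
    case True
    then obtain e where e: "e \<in> out_arcs G v" "x * V v * E e \<notin> J" by blast
    show ?thesis
      using I.rmult[OF I.rmult[OF Suc.prems(1)]] bounded_monomial_edge[OF Suc.prems(3) e(1)] e(2)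
      by (intro Suc.IH)
  next
    case False
    then have all: "x * V v * E e \<in> J" if "e \<in> out_arcs G v" for e using that by blast
    obtain b A where b: "b \<in> jspan J (paths_to v)" and A: "finite A" "A \<subseteq> out_arcs G v" and
      stable: "\<And>B. finite B \<Longrightarrow> A \<subseteq> B \<Longrightarrow> B \<subseteq> out_arcs G v \<Longrightarrow>
        (x * V v - b) * (\<Sum>e\<in>B. E e * E' e) \<approx> x * V v - b"
      using split_ghost_terms[OF Suc.prems(3), of v] by auto
    \<comment> \<open>The partial sum fixes \<open>x * V v - b\<close> but, as all the
      \<open>x * V v * E e\<close> vanish, kills \<open>x * V v\<close>.\<close>
    have xb: "x * V v \<approx> b - b * (\<Sum>e\<in>B. E e * E' e)"
      if B: "finite B" "A \<subseteq> B" "B \<subseteq> out_arcs G v" for B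
    proof -
      define s where "s = (\<Sum>e\<in>B. E e * E' e)"
      have "(x * V v) * s = (\<Sum>e\<in>B. (x * V v * E e) * E' e)"
        unfolding s_def sum_distrib_left by (simp add: mult.assoc)
      also have "\<dots> \<in> J" using B by (intro sum rmult all) auto
      finally have "(x * V v) * s \<approx> 0" by (simp add: mem_iff_eqv_zero)
      have "x * V v = (x * V v - b) + b" by simp
      also have "\<dots> \<approx> (x * V v - b) * s + b"
        unfolding s_def by (intro eqv_add eqv_refl eqv_sym[OF stable[OF B]])
      also have "\<dots> = x * V v * s + (b - b * s)" by (simp add: left_diff_distrib)
      also have "\<dots> \<approx> 0 + (b - b * s)" by (intro eqv_add eqv_refl) fact
      finally show ?thesis by (simp add: s_def)
    qed
    have "x * V v \<in> J"
    proof (cases "finite (out_arcs G v)")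
      case True
      have "x * V v \<approx> b - b * (\<Sum>e\<in>out_arcs G v. E e * E' e)" using xb True A by blast
      also have "\<dots> \<approx> b * V v - b * (\<Sum>e\<in>out_arcs G v. E e * E' e)"
        by (intro eqv_diff eqv_refl eqv_sym[OF paths_to_target[OF b]])
      also have "\<dots> = b * q v" by (simp add: gap_def right_diff_distrib)
      finally have *: "x * V v \<approx> b * q v" .
      then have "b * q v \<in> I" using eqv_I I.rmult[OF Suc.prems(1)] by blast
      then show ?thesis using gap_cancel[OF True b] * mem_cong by blast
    next
      case False
      then have "\<not> out_arcs G v \<subseteq> A" using A(1) finite_subset by blast
      \<comment> \<open>An edge outside the partial sum is annihilated by it, so multiplying by
        \<open>E e\<close> leaves \<open>b * E e\<close>, which therefore lies in
        \<open>J\<close>.\<close>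
      then obtain e where e: "e \<in> out_arcs G v" "e \<notin> A" by blast
      have e': "e \<in> arcs G" using e by auto
      have "(\<Sum>f\<in>A. E f * E' f) * E e \<in> J"
        unfolding sum_distrib_right
      proof (rule sum)
        fix f assume "f \<in> A"
        then have "f \<in> arcs G" "f \<noteq> e" using A e by auto
        then have "E' f * E e \<approx> 0" using ghost_edge[OF _ e', of f] by simp
        from eqv_lmult[OF this, of "E f"] show "E f * E' f * E e \<in> J"
          by (simp add: mem_iff_eqv_zero mult.assoc)
      qed
      then have "b * ((\<Sum>f\<in>A. E f * E' f) * E e) \<approx> 0" using lmult mem_iff_eqv_zero by blast
      from eqv_diff[OF eqv_refl this, of "b * E e"]
      have "(b - b * (\<Sum>f\<in>A. E f * E' f)) * E e \<approx> b * E e"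
        by (simp add: left_diff_distrib mult.assoc)
      moreover have "x * V v * E e \<approx> (b - b * (\<Sum>f\<in>A. E f * E' f)) * E e"
        using A by (intro eqv_rmult xb) auto
      ultimately have "b * E e \<in> J" using all[OF e(1)] mem_cong by blast
      then have "b \<in> J" by (rule edge_cancel[OF b e(1)])
      then have "b - b * (\<Sum>f\<in>A. E f * E' f) \<in> J" by (intro diff rmult)
      then show ?thesis using xb[of A] A mem_cong by blast
    qed
    then show ?thesis using v by blast
  qed
qed

lemma ex_bounded: "x \<in> jspan J monomials \<Longrightarrow> \<exists>n. x \<in> jspan J (bounded_monomials n)"
proof (induction x rule: jspan.induct)
  case (mem x)
  then show ?case by (auto intro: jspan.mem)
next
  case (step m x c)
  then obtain n where n: "x \<in> jspan J (bounded_monomials n)" by blast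
  obtain u p v r w where m: "m = rp u p * gp v r" "awalk u p w" "awalk v r w"
    using step.hyps(1) unfolding monomials_def by blast
  define N where "N = max n (length r)"
  have "n \<le> N" "length r \<le> N" by (simp_all add: N_def)
  then have "bounded_monomials n \<subseteq> bounded_monomials N" "m \<in> bounded_monomials N"
    using m le_trans unfolding bounded_monomials_def by blast+
  moreover from this(1) have "x \<in> jspan J (bounded_monomials N)"
    using jspan_subset[OF _ n] jspan_base by blast
  ultimately show ?case using jspan.step by blast
qed

end

section \<open>Cycles without exits\<close>

text \<open>
  A closed walk \<open>c\<close> such that every walk \<open>s\<close> from its base point is an initial segment of \<open>c s\<close>,
  hence of a power of \<open>c\<close>: the cycle through the base point has no exit.
\<close>

locale exitless_closed_walk = cohn_ideal G J
  for G :: "('v, 'e) pre_digraph" and J :: "(('v, 'e) lpa_gen free_word \<Rightarrow>\<^sub>0 'k::field) set" +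
  fixes v :: 'v and c :: "'e list"
  assumes closed: "awalk v c v" "c \<noteq> []"
    and prefix: "awalk v s w \<Longrightarrow> prefix s (c @ s)"
    and gap: "\<lbrakk>awalk v s w; finite (out_arcs G w)\<rbrakk> \<Longrightarrow> gap G w \<in> J"
begin

definition cpow :: "nat \<Rightarrow> 'e list" where "cpow n = concat (replicate n c)"

lemma awalk_pow: "awalk v (cpow n) v"
proof (induction n)
  case 0
  then show ?case using closed awalk_hd_in_verts by (auto simp: cpow_def awalk_Nil_iff)
next
  case (Suc n)
  then show ?case using closed by (auto simp: cpow_def intro: awalk_appendI)
qed

lemma length_pow: "n \<le> length (cpow n)"
proof (induction n)
  case (Suc n)
  have "length (cpow (Suc n)) = length c + length (cpow n)" by (simp add: cpow_def)
  moreover have "1 \<le> length c" using closed by (cases c) auto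
  ultimately show ?case using Suc by linarith
qed simp

lemma prefix_pow: "awalk v s w \<Longrightarrow> prefix s (cpow n @ s)"
proof (induction n)
  case (Suc n)
  have "prefix s (c @ s)" using prefix Suc by blast
  also have "prefix (c @ s) (c @ (cpow n @ s))" using Suc by simp
  finally show ?case by (simp add: cpow_def)
qed (simp add: cpow_def)

lemma take_pow: "awalk v s w \<Longrightarrow> length s \<le> n \<Longrightarrow> s = take (length s) (cpow n)"
  using prefix_pow[of s w n] length_pow[of n] by (auto simp: prefix_def dest: arg_cong[of _ _ "take (length s)"])

text \<open>Both walks are initial segments of the same power of \<open>c\<close>. The absence of
  exits is used from here on mostly in this form.\<close>

lemma walk_unique: "\<lbrakk>awalk v s w; awalk v s' w'; length s = length s'\<rbrakk> \<Longrightarrow> s = s'"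
  using take_pow[of s w "length s"] take_pow[of s' w' "length s"] by simp

lemma walk_prefix:
  assumes s: "awalk v s w" and s': "awalk v s' w'" and le: "length s \<le> length s'"
  obtains r where "s' = s @ r" "awalk w r w'"
proof -
  have take: "awalk v (take (length s) s' @ drop (length s) s') w'" using s' by simp
  then have "awalk v (take (length s) s') (awlast v (take (length s) s'))"
    by (simp only: awalk_append_iff)
  then have ts: "take (length s) s' = s" using le by (intro walk_unique[OF _ s]) auto
  show thesis
  proof (rule that)
    show "s' = s @ drop (length s) s'" using append_take_drop_id[of "length s" s'] ts by simp
    show "awalk w (drop (length s) s') w'" using take s unfolding ts by simp
  qed
qed

text \<open>A power of \<open>c\<close> longer than \<open>s\<close> prolongs \<open>s\<close> and
  ends at \<open>v\<close>.\<close>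

lemma walk_extend:
  assumes "awalk v s w"
  obtains r where "awalk w r v" "r \<noteq> []"
proof -
  have "Suc (length s) \<le> length (cpow (Suc (length s)))" by (rule length_pow)
  then obtain r where r: "cpow (Suc (length s)) = s @ r" "awalk w r v"
    using walk_prefix[OF assms awalk_pow] by (metis Suc_leD)
  show thesis
  proof (rule that[OF r(2)])
    show "r \<noteq> []" using length_pow[of "Suc (length s)"] r(1) by auto
  qed
qed

text \<open>Uniqueness of walks leaves \<open>e\<close> as the only edge at \<open>w\<close>, so the
  gap there, which lies in \<open>J\<close>, is \<open>V w - E e * E' e\<close>.\<close>

lemma edge_ghost:
  assumes s: "awalk v s w" and e: "e \<in> out_arcs G w"
  shows "E e * E' e \<approx> V w"
proof -
  have "f = e" if "f \<in> out_arcs G w" for f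
  proof -
    have "awalk v (s @ [f]) (head G f)" "awalk v (s @ [e]) (head G e)"
      using s e that by (auto intro!: awalk_appendI simp: awalk_simps)
    from walk_unique[OF this] show ?thesis by simp
  qed
  then have out: "out_arcs G w = {e}" using e by blast
  then have "q w \<in> J" using gap[OF s] by simp
  then have "q w \<approx> 0" by (simp add: mem_iff_eqv_zero)
  then show ?thesis using eqv_sym by (auto simp: gap_def out eqv_def)
qed

lemma rp_gp: "\<lbrakk>awalk v s w; awalk w r x\<rbrakk> \<Longrightarrow> rp w r * gp w r \<approx> V w"
proof (induction r arbitrary: s w)
  case Nil
  then show ?case by (simp add: vertex_idem)
next
  case (Cons e r)
  then have e: "e \<in> arcs G" "tail G e = w" "awalk (head G e) r x" by (auto simp: awalk_Cons_iff)
  have se: "awalk v (s @ [e]) (head G e)"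
    using Cons.prems e by (auto intro!: awalk_appendI simp: awalk_simps)
  have "rp w (e # r) * gp w (e # r) = E e * (rp (head G e) r * gp (head G e) r) * E' e"
    by (simp add: mult.assoc)
  also have "\<dots> \<approx> E e * V (head G e) * E' e"
    by (intro eqv_rmult eqv_lmult Cons.IH[OF se e(3)])
  also have "\<dots> \<approx> E e * E' e" by (intro eqv_rmult edge_head)
  also have "\<dots> \<approx> V w" using e by (intro edge_ghost[OF Cons.prems(1)]) auto
  finally show ?case .
qed

text \<open>The monomials of the Laurent polynomial ring: closed walks, and their ghosts as
  inverses.\<close>

definition loops :: "(('v, 'e) lpa_gen free_word \<Rightarrow>\<^sub>0 'k) set" where
  "loops = rp v ` {d. awalk v d v} \<union> gp v ` {d. awalk v d v}"

lemma awalk_Nil: "awalk v [] v"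
  using awalk_pow[of 0] by (simp add: cpow_def)

text \<open>Insert the product of a walk \<open>s\<close> from \<open>w\<close> back to
  \<open>v\<close> with its ghost, which is \<open>V w\<close>. Both factors then become closed
  walks at \<open>v\<close>, and the shorter cancels against the longer.\<close>

lemma rp_gp_loops:
  assumes p: "awalk v p w" and r: "awalk v r w"
  shows "rp v p * gp v r \<in> jspan J loops"
proof -
  obtain s where s: "awalk w s v" using walk_extend[OF p] by blast
  define P R where "P = p @ s" and "R = r @ s"
  have P: "awalk v P v" and R: "awalk v R v"
    using p r s by (auto simp: P_def R_def intro: awalk_appendI)
  have loopI: "rp v d \<in> jspan J loops" "gp v d \<in> jspan J loops" if "awalk v d v" for d
    using that by (auto intro!: jspan_base simp: loops_def)
  have "rp v p * gp v r \<approx> rp v p * V w * gp v r" by (intro eqv_rmult eqv_sym[OF rp_target[OF p]])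
  also have "\<dots> \<approx> rp v p * (rp w s * gp w s) * gp v r"
    by (intro eqv_rmult eqv_lmult eqv_sym[OF rp_gp[OF p s]])
  also have "\<dots> = (rp v p * rp w s) * (gp w s * gp v r)" by (simp add: mult.assoc)
  also have "\<dots> \<approx> rp v P * gp v R"
    unfolding P_def R_def by (intro eqv_mult rp_append[OF p s] gp_append[OF r s])
  finally have PR: "rp v p * gp v r \<approx> rp v P * gp v R" .
  show ?thesis
  proof (cases "length R \<le> length P")
    case True
    then obtain d where d: "P = R @ d" "awalk v d v" using walk_prefix[OF R P] by blast
    \<comment> \<open>To cancel, \<open>R\<close> must stand next to its ghost. The two orders have
      equal length and therefore coincide.\<close>
    have "d @ R = R @ d" using R d by (intro walk_unique) (auto intro: awalk_appendI)
    then have "rp v P * gp v R \<approx> (rp v d * rp v R) * gp v R"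
      using eqv_rmult[OF eqv_sym[OF rp_append[OF d(2) R]]] by (simp add: d)
    also have "\<dots> = rp v d * (rp v R * gp v R)" by (simp add: mult.assoc)
    also have "\<dots> \<approx> rp v d * V v" by (intro eqv_lmult rp_gp[OF awalk_Nil R])
    also have "\<dots> \<approx> rp v d" by (rule rp_target[OF d(2)])
    finally show ?thesis using PR loopI[OF d(2)] jspan_cong by blast
  next
    case False
    then obtain d where d: "R = P @ d" "awalk v d v" using walk_prefix[OF P R] by auto
    have "d @ P = P @ d" using P d by (intro walk_unique) (auto intro: awalk_appendI)
    then have "rp v P * gp v R \<approx> rp v P * (gp v P * gp v d)"
      using eqv_lmult[OF eqv_sym[OF gp_append[OF d(2) P]]] by (simp add: d)
    also have "\<dots> = (rp v P * gp v P) * gp v d" by (simp add: mult.assoc)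
    also have "\<dots> \<approx> V v * gp v d" by (intro eqv_rmult rp_gp[OF awalk_Nil P])
    also have "\<dots> \<approx> gp v d" by (rule target_gp[OF d(2)])
    finally show ?thesis using PR loopI[OF d(2)] jspan_cong by blast
  qed
qed

lemma corner_loops: "V v * x * V v \<in> jspan J loops"
proof -
  define k where "k = Poly_Mapping.lookup x 0"
  have "x - scalar k \<in> jspan J monomials"
    by (rule span_monomials) (simp add: k_def lookup_minus)
  then have 1: "V v * (x - scalar k) * V v \<in> jspan J loops"
  proof (rule jspan_bind[rotated])
    fix m assume "m \<in> monomials"
    then obtain u p u' r w where m: "m = rp u p * gp u' r" and p: "awalk u p w" and r: "awalk u' r w"
      unfolding monomials_def by blast
    have *: "V v * m * V v = (V v * rp u p) * (gp u' r * V v)" by (simp add: m mult.assoc)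
    show "V v * m * V v \<in> jspan J loops"
    proof (cases "u = v \<and> u' = v")
      case True
      then have "(V v * rp u p) * (gp u' r * V v) \<approx> rp v p * gp v r"
        using source_rp[OF p] gp_source[OF r] by (intro eqv_mult) auto
      moreover have "rp v p * gp v r \<in> jspan J loops" using True p r rp_gp_loops by blast
      ultimately show ?thesis unfolding * by (rule jspan_cong)
    next
      case False
      have "(V v * rp u p) * (gp u' r * V v) \<approx> 0"
      proof (cases "u = v")
        case True
        then have "gp u' r * V v \<approx> 0" using False by (intro gp_vertex_orth[OF r]) auto
        from eqv_lmult[OF this] show ?thesis by simp
      next
        case False
        then have "V v * rp u p \<approx> 0" by (intro vertex_rp_orth[OF p]) auto
        from eqv_rmult[OF this] show ?thesis by simp
      qed
      then show ?thesis unfolding * using jspan_zero by (rule jspan_cong)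
    qed
  qed
  have "V v \<in> loops" using awalk_Nil unfolding loops_def by force
  then have 2: "scalar k * (V v * V v) \<in> jspan J loops"
    using jspan_scalar jspan_base jspan_cong[OF vertex_idem] by blast
  have "V v * x * V v = V v * (x - scalar k) * V v + scalar k * (V v * V v)"
    by (simp add: algebra_simps scalar_commute')
  then show ?thesis using jspan_add[OF 1 2] by simp
qed

text \<open>The walks \<open>d @ d'\<close> and \<open>d' @ d\<close> have equal length, hence are
  equal. In the mixed case \<open>gp v d\<close> is a two-sided inverse of \<open>rp v d\<close> in
  the corner, so it commutes with whatever \<open>rp v d\<close> commutes with.\<close>

lemma loops_commute:
  assumes "m \<in> loops" "m' \<in> loops"
  shows "m * m' \<approx> m' * m"
proof -
  have rr: "rp v d * rp v d' \<approx> rp v d' * rp v d" if d: "awalk v d v" "awalk v d' v" for d d'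
  proof -
    have "d @ d' = d' @ d" using d by (intro walk_unique) (auto intro: awalk_appendI)
    then show ?thesis
      using eqv_trans[OF rp_append[OF d(1,2)] eqv_sym] rp_append[OF d(2,1)] by simp
  qed
  have gg: "gp v d * gp v d' \<approx> gp v d' * gp v d" if d: "awalk v d v" "awalk v d' v" for d d'
  proof -
    have "d @ d' = d' @ d" using d by (intro walk_unique) (auto intro: awalk_appendI)
    then show ?thesis
      using eqv_trans[OF gp_append[OF d(2,1)] eqv_sym] gp_append[OF d(1,2)] by simp
  qed
  have gr: "gp v d * rp v d' \<approx> rp v d' * gp v d" if d: "awalk v d v" "awalk v d' v" for d d'
  proof -
    have "gp v d * rp v d' \<approx> gp v d * (rp v d' * V v)"
      by (intro eqv_lmult eqv_sym[OF rp_target[OF d(2)]])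
    also have "\<dots> \<approx> gp v d * (rp v d' * (rp v d * gp v d))"
      by (intro eqv_lmult eqv_sym[OF rp_gp[OF awalk_Nil d(1)]])
    also have "\<dots> = gp v d * (rp v d' * rp v d) * gp v d" by (simp add: mult.assoc)
    also have "\<dots> \<approx> gp v d * (rp v d * rp v d') * gp v d"
      by (intro eqv_rmult eqv_lmult rr d)
    also have "\<dots> = (gp v d * rp v d) * (rp v d' * gp v d)" by (simp add: mult.assoc)
    also have "\<dots> \<approx> V v * (rp v d' * gp v d)" by (intro eqv_rmult gp_rp[OF d(1)])
    also have "\<dots> = (V v * rp v d') * gp v d" by (simp add: mult.assoc)
    also have "\<dots> \<approx> rp v d' * gp v d" by (intro eqv_rmult source_rp[OF d(2)])
    finally show ?thesis .
  qed
  show ?thesis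
    using assms by (auto simp: loops_def intro: rr gg gr eqv_sym[OF gr])
qed

lemma commutative_corner_vertex: "commutative_corner J (V v)"
proof unfold_locales
  show "V v * V v \<approx> V v" by (rule vertex_idem)
  fix x y
  have "(V v * x * V v) * (V v * y * V v) \<approx> (V v * y * V v) * (V v * x * V v)"
    by (rule jspan_commute[OF loops_commute corner_loops corner_loops])
  moreover have "(V v * a * V v) * (V v * b * V v) \<approx> V v * a * V v * b * V v" for a b
    using eqv_mid[OF vertex_idem, of "V v * a" v "b * V v"] by (simp add: mult.assoc)
  ultimately show "V v * x * V v * y * V v \<approx> V v * y * V v * x * V v"
    by (meson eqv_sym eqv_trans)
qed

end

section \<open>Reduced polynomials in closed paths and their conjugates\<close>

context graded_cohn_ideal
begin

text \<open>The constant coefficient is normalised to 1, so that \<open>card A\<close> measures the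
  element; \<open>I_subset_J\<close> minimises it over all vertices.\<close>

definition reduced :: "'v \<Rightarrow> 'e list set \<Rightarrow> ('e list \<Rightarrow> 'k) \<Rightarrow> bool" where
  "reduced v A k \<longleftrightarrow> v \<in> verts G \<and> finite A \<and> (\<forall>c\<in>A. awalk v c v \<and> c \<noteq> [] \<and> k c \<noteq> 0) \<and>
     V v + (\<Sum>c\<in>A. scalar (k c) * rp v c) \<in> I"

lemma ex_reduced:
  assumes "\<not> I \<subseteq> J"
  shows "\<exists>v A k. reduced v A k"
proof -
  obtain x where x: "x \<in> I" "x \<notin> J" using assms by blast
  obtain n where "x \<in> jspan J (bounded_monomials n)"
    using ex_bounded span_monomials[OF no_constant_term[OF x(1)]] by blast
  then obtain v y where y: "y \<in> I" "y \<notin> J" "y \<in> jspan J (paths_to v)"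
    using ex_real_path_element x by blast
  obtain u p k where p: "awalk u p v" and k: "k \<noteq> 0"
    and cl: "gp u p * y - scalar k * V v \<in> jspan J (closed_paths v)"
    using ghost_of_shortest_path[OF y(3,2)] by metis
  obtain A l where A: "finite A" "A \<subseteq> {c. awalk v c v \<and> c \<noteq> []}" "\<forall>c\<in>A. l c \<noteq> 0"
    and l: "gp u p * y - scalar k * V v \<approx> (\<Sum>c\<in>A. scalar (l c) * rp v c)"
    by (rule jspan_family[OF cl[unfolded closed_paths_def]])
  define k' where "k' c = inverse k * l c" for c
  have kk: "scalar (inverse k) * (scalar k * V v) = V v"
    using k by (simp flip: mult.assoc scalar_mult)
  have "scalar (inverse k) * (gp u p * y) = scalar (inverse k) * (gp u p * y - scalar k * V v) + V v"
    by (simp add: right_diff_distrib kk)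
  also have "\<dots> \<approx> scalar (inverse k) * (\<Sum>c\<in>A. scalar (l c) * rp v c) + V v"
    by (intro eqv_add eqv_lmult l eqv_refl)
  also have "\<dots> = V v + (\<Sum>c\<in>A. scalar (k' c) * rp v c)"
    by (simp add: sum_distrib_left k'_def mult.assoc)
  finally have "V v + (\<Sum>c\<in>A. scalar (k' c) * rp v c) \<in> I"
    using eqv_I I.lmult[OF I.lmult[OF y(1)]] by blast
  moreover have "v \<in> verts G" using p awalk_last_in_verts by blast
  ultimately have "reduced v A k'" using A k by (auto simp: reduced_def k'_def)
  then show ?thesis by blast
qed

text \<open>Multiplying by the ghost of \<open>s\<close> and by \<open>s\<close> preserves the
  constant term, rotates along \<open>s\<close> the closed walks \<open>c\<close> for which
  \<open>s\<close> is an initial segment of \<open>c @ s\<close>, and kills the others. An element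
  with fewest terms can lose none, which excludes exits.\<close>

lemma reduced_conjugate:
  assumes red: "reduced v A k" and s: "awalk v s w"
  shows "\<exists>A' k'. reduced w A' k' \<and> card A' = card {c\<in>A. prefix s (c @ s)}"
proof -
  define B where "B = {c\<in>A. prefix s (c @ s)}"
  define f where "f c = drop (length s) (c @ s)" for c
  \<comment> \<open>The coefficients are carried along the rotation \<open>f\<close>: the walk
    \<open>c\<close> is recovered as the initial segment of length \<open>length c\<close> of
    \<open>s @ f c\<close>.\<close>
  define k' where "k' c = k (take (length c) (s @ c))" for c
  have A: "finite A" "\<And>c. c \<in> A \<Longrightarrow> awalk v c v" "\<And>c. c \<in> A \<Longrightarrow> c \<noteq> []" "\<And>c. c \<in> A \<Longrightarrow> k c \<noteq> 0"
    and z: "V v + (\<Sum>c\<in>A. scalar (k c) * rp v c) \<in> I"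
    using red by (auto simp: reduced_def)
  have fB: "c @ s = s @ f c" if "c \<in> B" for c
  proof -
    have "prefix s (c @ s)" using that unfolding B_def by blast
    then obtain r where r: "c @ s = s @ r" by (rule prefixE)
    have "f c = r" unfolding f_def r by simp
    then show ?thesis using r by simp
  qed
  have len: "length (f c) = length c" for c by (simp add: f_def)
  have cf: "take (length (f c)) (s @ f c) = c" if "c \<in> B" for c
    using fB[OF that, symmetric] by (simp add: len)
  have inj: "inj_on f B" using cf by (metis inj_onI)
  have walk: "awalk w (f c) w" if "c \<in> B" for c
  proof -
    have "c \<in> A" using that by (simp add: B_def)
    then have "awalk v (c @ s) w" by (intro awalk_appendI[OF A(2) s])
    then show ?thesis using s unfolding fB[OF that] by simp
  qed
  have conj: "gp v s * rp v c * rp v s \<approx> (if c \<in> B then rp w (f c) else 0)" if c: "c \<in> A" for c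
  proof -
    have cs: "awalk v (c @ s) w" using A(2)[OF c] s by (auto intro: awalk_appendI)
    have "gp v s * rp v c * rp v s = gp v s * (rp v c * rp v s)" by (simp add: mult.assoc)
    also have "\<dots> \<approx> gp v s * rp v (c @ s)" by (intro eqv_lmult rp_append[OF A(2)[OF c] s])
    also have "\<dots> \<approx> (if c \<in> B then rp w (f c) else 0)"
    proof (cases "c \<in> B")
      case True
      then show ?thesis using gp_rp_append(1)[OF s walk[OF True]] by (simp add: fB[OF True])
    next
      case False
      then have "\<not> prefix s (c @ s)" using c by (simp add: B_def)
      moreover have "\<not> prefix (c @ s) s" using A(3)[OF c] prefix_length_le[of "c @ s" s] by auto
      ultimately show ?thesis using gp_rp_incomparable[OF s cs] False by simp
    qed
    finally show ?thesis .
  qed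
  have "gp v s * (V v + (\<Sum>c\<in>A. scalar (k c) * rp v c)) * rp v s
      = (gp v s * V v) * rp v s + (\<Sum>c\<in>A. scalar (k c) * (gp v s * rp v c * rp v s))"
    by (simp add: distrib_left distrib_right sum_distrib_left sum_distrib_right mult.assoc scalar_commute')
  also have "\<dots> \<approx> gp v s * rp v s + (\<Sum>c\<in>A. scalar (k c) * (if c \<in> B then rp w (f c) else 0))"
    by (intro eqv_add eqv_sum eqv_lmult conj eqv_rmult gp_source[OF s])
  also have "\<dots> \<approx> V w + (\<Sum>c\<in>A. scalar (k c) * (if c \<in> B then rp w (f c) else 0))"
    by (intro eqv_add gp_rp[OF s] eqv_refl)
  also have "(\<Sum>c\<in>A. scalar (k c) * (if c \<in> B then rp w (f c) else 0)) = (\<Sum>c\<in>B. scalar (k c) * rp w (f c))"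
    using A(1) by (intro sum.mono_neutral_cong_right) (auto simp: B_def)
  also have "\<dots> = (\<Sum>c\<in>f ` B. scalar (k' c) * rp w c)"
    unfolding sum.reindex[OF inj] by (intro sum.cong refl) (simp add: k'_def cf del: take_append)
  finally have "V w + (\<Sum>c\<in>f ` B. scalar (k' c) * rp w c) \<in> I"
    using eqv_I I.rmult[OF I.lmult[OF z]] by blast
  moreover have "f c \<noteq> [] \<and> k' (f c) \<noteq> 0" if "c \<in> B" for c
    using that A(3,4)[of c] len[of c] cf[OF that] by (auto simp: k'_def B_def)
  ultimately have "reduced w (f ` B) k'"
    using walk A(1) s awalk_last_in_verts by (auto simp: reduced_def B_def)
  moreover have "card (f ` B) = card B" by (rule card_image[OF inj])
  ultimately show ?thesis unfolding B_def by blast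
qed

text \<open>The gap kills the nonempty closed paths from the left, so multiplying the reduced
  element by \<open>q v\<close> on both sides gives \<open>q v\<close>, which thus lies in
  \<open>I\<close>.\<close>

lemma reduced_gap:
  assumes red: "reduced v A k" and fin: "finite (out_arcs G v)"
  shows "q v \<in> J"
proof (rule gap_mem[OF fin])
  define z where "z = V v + (\<Sum>c\<in>A. scalar (k c) * rp v c)"
  have A: "\<And>c. c \<in> A \<Longrightarrow> awalk v c v \<and> c \<noteq> []" and z: "z \<in> I"
    using red by (auto simp: reduced_def z_def)
  have "q v * z * q v = (q v * V v) * q v + (\<Sum>c\<in>A. scalar (k c) * (q v * rp v c)) * q v"
    by (simp add: z_def distrib_left distrib_right sum_distrib_left scalar_commute' mult.assoc)
  also have "\<dots> \<approx> q v * q v + (\<Sum>c\<in>A. scalar (k c) * 0) * q v"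
    using A by (intro eqv_add eqv_rmult eqv_sum eqv_lmult gap_vertex gap_rp[OF fin]) auto
  also have "\<dots> \<approx> q v" using gap_idem[OF fin] by simp
  finally show "q v \<in> I" using eqv_I I.rmult[OF I.lmult[OF z]] by blast
qed

text \<open>
  Here the corner at \<open>v\<close> is a ring of Laurent polynomials, in which \<open>v - y c\<close>, for the
  given element \<open>y\<close> of \<open>I\<close>, has components of different degrees and so is not a unit.
\<close>

lemma exitless_closed_walk_not_reduced:
  assumes red: "reduced v A k" and c: "c \<in> A" and max: "\<And>d. d \<in> A \<Longrightarrow> length d \<le> length c"
    and exitless: "exitless_closed_walk G J v c"
  shows False
proof -
  interpret exitless_closed_walk G J v c by (rule exitless)
  define n where "n = int (length c)"
  have n: "n > 0" using closed by (simp add: n_def)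
  have A: "finite A" "\<And>d. d \<in> A \<Longrightarrow> awalk v d v" "k c \<noteq> 0" and v: "v \<in> verts G"
    using red c by (auto simp: reduced_def)
  define y where "y = V v + (\<Sum>d\<in>A. scalar (k d) * rp v d)"
  have y: "y \<in> I" using red by (simp add: reduced_def y_def)
  have Vy: "V v * y \<approx> y"
  proof -
    have "V v * y = V v * V v + (\<Sum>d\<in>A. scalar (k d) * (V v * rp v d))"
      by (simp add: y_def distrib_left sum_distrib_left scalar_commute')
    also have "\<dots> \<approx> y" unfolding y_def
      by (intro eqv_add eqv_sum eqv_lmult vertex_idem source_rp[OF A(2)])
    finally show ?thesis .
  qed
  \<comment> \<open>The factor \<open>c\<close> moves all terms of \<open>y\<close> to positive
    degree, so that \<open>V v - u\<close> keeps the constant term \<open>V v\<close>. Without it,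
    \<open>V v - y\<close> could be a multiple of one closed walk and hence a unit.\<close>
  define u where "u = y * rp v c"
  have "V v * u \<approx> u" using eqv_rmult[OF Vy] by (simp add: u_def mult.assoc)
  moreover have uV: "u * V v \<approx> u" using eqv_lmult[OF rp_target[OF closed(1)]] by (simp add: u_def mult.assoc)
  ultimately obtain z where z: "(V v - u) * z \<approx> V v"
    using quasi_regular[OF commutative_corner_vertex, of u] I.rmult[OF y] by (auto simp: u_def eqv_def)
  define s where "s = V v * z"
  have Vs: "V v * s \<approx> s" using eqv_rmult[OF vertex_idem] by (simp add: s_def mult.assoc)
  have "(V v - u) * s = (V v * V v) * z - (u * V v) * z" by (simp add: s_def algebra_simps)
  also have "\<dots> \<approx> V v * z - u * z" by (intro eqv_diff eqv_rmult vertex_idem uV)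
  also have "\<dots> = (V v - u) * z" by (simp add: algebra_simps)
  finally have us: "(V v - u) * s \<approx> V v" using z eqv_trans by blast
  have graded_eqv: "hcomp d a \<approx> hcomp d b" if "a \<approx> b" for a b d
    using graded[of "a - b" d] that by (simp add: eqv_def hcomp_diff)
  have homV: "homogeneous 0 (V v)" using homogeneous_gen[of "Vertex v"] by simp
  have hcompV: "V v * hcomp d s \<approx> hcomp d s" for d
    using graded_eqv[OF Vs, of d] hcomp_homogeneous_mult[OF homV, of d s] by simp
  have hom_rp: "hcomp d (rp v p * x) = rp v p * hcomp (d - int (length p)) x" for d p x
    by (rule hcomp_homogeneous_mult[OF homogeneous_rpath])
  have hom_sc: "hcomp d (scalar l * x) = scalar l * hcomp d x" for d l x
    using hcomp_homogeneous_mult[OF homogeneous_scalar, of d l x] by simp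
  have expand: "(V v - u) * s = V v * s - V v * (rp v c * s)
      - (\<Sum>d\<in>A. scalar (k d) * (rp v d * (rp v c * s)))"
    by (simp add: u_def y_def algebra_simps sum_distrib_right)
  \<comment> \<open>The component of degree \<open>d\<close> of
    \<open>(V v - u) * s \<approx> V v\<close>: each real path shifts degrees by its length.\<close>
  have comp: "V v * hcomp d s - V v * (rp v c * hcomp (d - n) s)
      - (\<Sum>e\<in>A. scalar (k e) * (rp v e * (rp v c * hcomp (d - int (length e) - n) s)))
      \<approx> (if d = 0 then V v else 0)" for d
  proof -
    have "hcomp d ((V v - u) * s) \<approx> (if d = 0 then V v else 0)"
      using graded_eqv[OF us, of d] hcomp_homogeneous[OF homV, of d] by simp
    moreover have "hcomp d ((V v - u) * s) = V v * hcomp d s - V v * (rp v c * hcomp (d - n) s)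
      - (\<Sum>e\<in>A. scalar (k e) * (rp v e * (rp v c * hcomp (d - int (length e) - n) s)))"
      unfolding expand n_def
      by (simp add: hcomp_diff hcomp_sum hom_rp hom_sc hcomp_homogeneous_mult[OF homV])
    ultimately show ?thesis by simp
  qed
  define D where "D = {d. hcomp d s \<notin> J}"
  have DK: "D \<subseteq> word_degree ` Poly_Mapping.keys s"
  proof
    fix d assume "d \<in> D"
    then have "hcomp d s \<noteq> 0" using zero unfolding D_def by auto
    then show "d \<in> word_degree ` Poly_Mapping.keys s" using hcomp_eq_zero[of d s] by blast
  qed
  then have finD: "finite D" by (rule finite_subset) simp
  have "D \<noteq> {}"
  proof
    assume "D = {}"
    then have "(\<Sum>d\<in>word_degree ` Poly_Mapping.keys s. hcomp d s) \<in> J" by (intro sum) (simp add: D_def)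
    then have "s \<in> J" by (simp add: sum_hcomp)
    then have "V v \<in> J" using mem_cong[OF us] lmult by blast
    then show False using vertex_not_mem[OF v] subset by blast
  qed
  define l h where "l = Min D" and "h = Max D"
  have l: "hcomp l s \<notin> J" and h: "hcomp h s \<notin> J"
    using Min_in[OF finD \<open>D \<noteq> {}\<close>] Max_in[OF finD \<open>D \<noteq> {}\<close>] by (auto simp: D_def l_def h_def)
  have lower: "hcomp d s \<in> J" if "d < l" for d
  proof (rule ccontr)
    assume "hcomp d s \<notin> J"
    then have "l \<le> d" unfolding l_def by (intro Min_le finD) (simp add: D_def)
    then show False using that by simp
  qed
  have upper: "hcomp d s \<in> J" if "h < d" for d
  proof (rule ccontr)
    assume "hcomp d s \<notin> J"
    then have "d \<le> h" unfolding h_def by (intro Max_ge finD) (simp add: D_def)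
    then show False using that by simp
  qed
  \<comment> \<open>In the lowest degree of \<open>s\<close> only the constant term of
    \<open>V v - u\<close> contributes, so this degree must occur in \<open>V v\<close>.\<close>
  have "l = 0"
  proof (rule ccontr)
    assume "l \<noteq> 0"
    then have *: "V v * hcomp l s - V v * (rp v c * hcomp (l - n) s)
      - (\<Sum>e\<in>A. scalar (k e) * (rp v e * (rp v c * hcomp (l - int (length e) - n) s))) \<in> J"
      using comp[of l] by (simp add: mem_iff_eqv_zero)
    have 1: "V v * (rp v c * hcomp (l - n) s) \<in> J"
      using n by (intro lmult lower) simp
    have 2: "(\<Sum>e\<in>A. scalar (k e) * (rp v e * (rp v c * hcomp (l - int (length e) - n) s))) \<in> J"
      using n by (intro sum lmult lower) simp
    have "V v * hcomp l s \<in> J"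
      using add[OF add[OF * 2] 1] by simp
    then show False using l mem_cong[OF hcompV] by blast
  qed
  moreover have "l \<le> h" unfolding l_def h_def using finD \<open>D \<noteq> {}\<close> by (simp add: Min_le_iff)
  ultimately have hn: "h + n + n \<noteq> 0" using n by linarith
  \<comment> \<open>This degree is positive, so the right-hand side is 0. It is reached only by the
    longest walk in \<open>A\<close> times the extra factor \<open>c\<close> times the top component
    of \<open>s\<close>, whose three lengths or degrees are \<open>n\<close>, \<open>n\<close> and
    \<open>h\<close>.\<close>
  have *: "V v * hcomp (h + n + n) s - V v * (rp v c * hcomp (h + n) s)
      - (\<Sum>e\<in>A. scalar (k e) * (rp v e * (rp v c * hcomp (h + n - int (length e)) s))) \<in> J"
  proof -
    have "h + n + n - n = h + n" "\<And>x. h + n + n - x - n = h + n - x" by simp_all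
    then show ?thesis using comp[of "h + n + n"] hn by (simp only: mem_iff_eqv_zero if_False)
  qed
  have 1: "V v * hcomp (h + n + n) s - V v * (rp v c * hcomp (h + n) s) \<in> J"
    using n by (intro diff lmult upper) simp_all
  have 2: "(\<Sum>e\<in>A - {c}. scalar (k e) * (rp v e * (rp v c * hcomp (h + n - int (length e)) s))) \<in> J"
  proof (intro sum lmult upper)
    fix e assume e: "e \<in> A - {c}"
    \<comment> \<open>Walks from \<open>v\<close> are determined by their lengths, so
      \<open>c\<close> alone attains the maximum in \<open>A\<close> and its term cannot
      cancel.\<close>
    then have "length e \<noteq> length c" using walk_unique[OF A(2) A(2)[OF c], of e] by auto
    then show "h < h + n - int (length e)" using max[of e] e by (simp add: n_def)
  qed
  have 3: "(\<Sum>e\<in>A. scalar (k e) * (rp v e * (rp v c * hcomp (h + n - int (length e)) s))) \<in> J"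
    using diff[OF 1 *] by simp
  have "scalar (k c) * (rp v c * (rp v c * hcomp (h + n - int (length c)) s)) \<in> J"
    using diff[OF 3 2] by (simp add: sum.remove[OF A(1) c])
  then have "scalar (k c) * (rp v c * (rp v c * hcomp h s)) \<in> J" by (simp add: n_def)
  then have rr: "rp v c * (rp v c * hcomp h s) \<in> J" by (rule scalar_cancel[OF A(3)])
  have cancel: "V v * x \<in> J" if "rp v c * x \<in> J" for x
  proof -
    have "gp v c * (rp v c * x) \<approx> V v * x"
      using eqv_rmult[OF gp_rp[OF closed(1)]] by (simp add: mult.assoc)
    then show ?thesis using lmult[OF that] mem_cong by blast
  qed
  have "(V v * rp v c) * hcomp h s \<in> J" using cancel[OF rr] by (simp add: mult.assoc)
  then have "rp v c * hcomp h s \<in> J" using mem_cong[OF eqv_rmult[OF source_rp[OF closed(1)]]] by blast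
  then show False using cancel h mem_cong[OF hcompV] by blast
qed

theorem I_subset_J: "I \<subseteq> J"
proof (rule ccontr)
  assume "\<not> I \<subseteq> J"
  then obtain v A k where "reduced v A k" using ex_reduced by blast
  then have "\<exists>n v A k. reduced v A k \<and> card A = n" by blast
  then obtain n where n: "\<exists>v A k. reduced v A k \<and> card A = n"
    and least: "\<And>m. m < n \<Longrightarrow> \<not> (\<exists>v A k. reduced v A k \<and> card A = m)"
    using exists_least_iff[of "\<lambda>n. \<exists>v A k. reduced v A k \<and> card A = n"] by auto
  then obtain v A k where red: "reduced v A k" and card: "card A = n" by blast
  have finA: "finite A" and walks: "\<And>c. c \<in> A \<Longrightarrow> awalk v c v \<and> c \<noteq> []"
    using red by (auto simp: reduced_def)
  have "A \<noteq> {}"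
  proof
    assume "A = {}"
    then have "V v \<in> I" "v \<in> verts G" using red by (auto simp: reduced_def)
    then show False using vertex_not_mem by blast
  qed
  then obtain c0 where "c0 \<in> A" by blast
  \<comment> \<open>The minimality argument works for every member of \<open>A\<close>; the longest
    is taken for the comparison of top degrees.\<close>
  then obtain c where c: "c \<in> A" and max: "\<And>d. d \<in> A \<Longrightarrow> length d \<le> length c"
    using ex_has_greatest_nat[of "\<lambda>c. c \<in> A" c0 length "Suc (Max (length ` A))"] finA
    by (auto simp: le_imp_less_Suc)
  have "exitless_closed_walk G J v c"
  proof unfold_locales
    show "awalk v c v" "c \<noteq> []" using walks c by auto
    fix s w assume s: "awalk v s w"
    then obtain A' k' where red': "reduced w A' k'" and card': "card A' = card {c\<in>A. prefix s (c @ s)}"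
      using reduced_conjugate[OF red] by blast
    show "prefix s (c @ s)"
    proof (rule ccontr)
      assume "\<not> prefix s (c @ s)"
      then have "{c\<in>A. prefix s (c @ s)} \<subset> A" using c by blast
      from psubset_card_mono[OF finA this] have "card A' < n" using card card' by simp
      then show False using least red' by blast
    qed
    show "finite (out_arcs G w) \<Longrightarrow> q w \<in> J" by (rule reduced_gap[OF red'])
  qed
  then show False using exitless_closed_walk_not_reduced[OF red c max] by blast
qed

end

section \<open>Leavitt path algebras as quotients of the free unital algebra\<close>

lemma rng_ideal_abelian_subgroup:
  assumes "rng R" "rng_ideal I R"
  shows "abelian_subgroup I R"
  using assms by (intro abelian_subgroupI3) (simp_all add: rng_ideal_def rng_def)

lemma rng_ideal_subset: "rng_ideal I R \<Longrightarrow> I \<subseteq> carrier R"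
  by (simp add: rng_ideal_def additive_subgroup.a_subset)

lemma quot_eqI:
  fixes R (structure)
  assumes "rng R" "rng_ideal I R" "i \<in> I" "y \<in> carrier R" "x = i \<oplus> y"
  shows "I +> x = I +> y"
proof -
  interpret rng R by fact
  interpret abelian_subgroup I R using assms(1,2) by (rule rng_ideal_abelian_subgroup)
  have "x \<in> I +> y" using assms by (auto simp: a_r_coset_def')
  then show ?thesis using a_repr_independence[of x I y] assms(4) a_subgroup by simp
qed

lemma quot_eqD:
  fixes R (structure)
  assumes "rng R" "rng_ideal I R" "x \<in> carrier R" "I +> x = I +> y"
  obtains i where "i \<in> I" "x = i \<oplus> y"
proof -
  interpret rng R by fact
  interpret abelian_subgroup I R using assms(1,2) by (rule rng_ideal_abelian_subgroup)
  have "x \<in> I +> y" using a_rcos_self[OF assms(3)] assms(4) by simp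
  then show thesis using that by (auto simp: a_r_coset_def')
qed

lemma quot_carrier: "carrier (R Quot I) = (\<lambda>x. I +>\<^bsub>R\<^esub> x) ` carrier R"
  by (auto simp: FactRing_def A_RCOSETS_def')

lemma quot_zero:
  fixes R (structure)
  assumes "rng R" "rng_ideal I R"
  shows "\<zero>\<^bsub>R Quot I\<^esub> = I +> \<zero>"
proof -
  interpret rng R by fact
  show ?thesis using rng_ideal_subset[OF assms(2)] by (simp add: FactRing_def a_coset_add_zero)
qed

lemma quot_add:
  fixes R (structure)
  assumes "rng R" "rng_ideal I R" "x \<in> carrier R" "y \<in> carrier R"
  shows "(I +> x) \<oplus>\<^bsub>R Quot I\<^esub> (I +> y) = I +> (x \<oplus> y)"
proof -
  interpret rng R by fact
  interpret abelian_subgroup I R using assms(1,2) by (rule rng_ideal_abelian_subgroup)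
  show ?thesis using assms(3,4) by (simp add: FactRing_def a_rcos_sum)
qed

lemma quot_mult:
  fixes R (structure)
  assumes R: "rng R" and I: "rng_ideal I R" and xy: "x \<in> carrier R" "y \<in> carrier R"
  shows "(I +> x) \<otimes>\<^bsub>R Quot I\<^esub> (I +> y) = I +> (x \<otimes> y)"
proof -
  interpret rng R by fact
  interpret abelian_subgroup I R using R I by (rule rng_ideal_abelian_subgroup)
  have mem: "i \<in> carrier R" "z \<otimes> i \<in> I" "i \<otimes> z \<in> I" if "i \<in> I" "z \<in> carrier R" for i z
    using I that rng_ideal_subset[OF I] by (auto simp: rng_ideal_def)
  have "I +> (a \<otimes> b) = I +> (x \<otimes> y)" if ab: "a \<in> I +> x" "b \<in> I +> y" for a b
  proof -
    obtain i j where i: "i \<in> I" "a = i \<oplus> x" and j: "j \<in> I" "b = j \<oplus> y"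
      using ab by (auto simp: a_r_coset_def')
    note c = mem(1)[OF i(1) xy(1)] mem(1)[OF j(1) xy(1)]
    have "a \<otimes> b = (i \<otimes> (j \<oplus> y) \<oplus> x \<otimes> j) \<oplus> x \<otimes> y"
      using c xy by (simp add: i j l_distr r_distr m_closed a_ac)
    then show ?thesis
      using mem i j c xy m_closed by (intro quot_eqI[OF R I]) auto
  qed
  then have "(\<Union>a\<in>I +> x. \<Union>b\<in>I +> y. I +> (a \<otimes> b)) = (\<Union>a\<in>I +> x. \<Union>b\<in>I +> y. I +> (x \<otimes> y))"
    by (intro SUP_cong refl) blast
  also have "\<dots> = I +> (x \<otimes> y)"
    using a_rcos_self[OF xy(1)] a_rcos_self[OF xy(2)] by blast
  finally show ?thesis by (simp add: FactRing_def rcoset_mult_def)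
qed

locale leavitt_ideal = wf_digraph G
  for G :: "('v, 'e) pre_digraph" +
  fixes I :: "('v, 'e, 'k::field) lpa set"
  assumes ideal_I: "rng_ideal I (leavitt_path_algebra G)"
begin

abbreviation "F \<equiv> free_rng (lpa_gens G) :: (('v, 'e) lpa_gen free_word \<Rightarrow>\<^sub>0 'k) ring"
abbreviation "L \<equiv> leavitt_path_algebra G :: ('v, 'e, 'k) lpa ring"
abbreviation "R \<equiv> lpa_rel_ideal G :: (('v, 'e) lpa_gen free_word \<Rightarrow>\<^sub>0 'k) set"
abbreviation "cls \<equiv> lpa_class G :: _ \<Rightarrow> ('v, 'e, 'k) lpa"

lemma free_rng_simps [simp]: "x \<oplus>\<^bsub>F\<^esub> y = x + y" "x \<otimes>\<^bsub>F\<^esub> y = x * y" "\<zero>\<^bsub>F\<^esub> = 0"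
  by (simp_all add: free_rng_def)

lemma rng_F: "rng F"
  by (rule rng_free_rng)

lemma rng_L: "rng L"
  by (rule rng_leavitt_path_algebra) unfold_locales

lemma ideal_R: "rng_ideal R F"
  by (rule rng_ideal_lpa_rel_ideal) unfold_locales

lemma cls_add: "\<lbrakk>p \<in> carrier F; q \<in> carrier F\<rbrakk> \<Longrightarrow> cls p \<oplus>\<^bsub>L\<^esub> cls q = cls (p + q)"
  using quot_add[OF rng_F ideal_R] by (simp add: leavitt_path_algebra_def lpa_class_def)

lemma cls_mult: "\<lbrakk>p \<in> carrier F; q \<in> carrier F\<rbrakk> \<Longrightarrow> cls p \<otimes>\<^bsub>L\<^esub> cls q = cls (p * q)"
  using quot_mult[OF rng_F ideal_R] by (simp add: leavitt_path_algebra_def lpa_class_def)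

lemma carrier_L: "carrier L = cls ` carrier F"
  by (simp add: leavitt_path_algebra_def lpa_class_def quot_carrier)

lemma cls_zero: "\<zero>\<^bsub>L\<^esub> = cls 0"
  using quot_zero[OF rng_F ideal_R] by (simp add: leavitt_path_algebra_def lpa_class_def)

lemma cls_eqI: "\<lbrakk>p - q \<in> R; q \<in> carrier F\<rbrakk> \<Longrightarrow> cls p = cls q"
  unfolding lpa_class_def by (rule quot_eqI[OF rng_F ideal_R, of "p - q"]) simp_all

lemma cls_eqD: "\<lbrakk>cls p = cls q; p \<in> carrier F\<rbrakk> \<Longrightarrow> p - q \<in> R"
  unfolding lpa_class_def by (erule quot_eqD[OF rng_F ideal_R, rotated]) simp_all

lemma mem_carrier_F: "p \<in> carrier F \<longleftrightarrow> (\<forall>w\<in>Poly_Mapping.keys p. w \<noteq> 0 \<and> set (letters w) \<subseteq> lpa_gens G)"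
proof -
  have "letters w = [] \<longleftrightarrow> w = 0" for w :: "('v, 'e) lpa_gen free_word"
    by (cases w) (simp add: zero_free_word_def)
  then show ?thesis by (auto simp: free_rng_def)
qed

lemma gen_carrier: "g \<in> lpa_gens G \<Longrightarrow> gen g \<in> carrier F"
  by (simp add: mem_carrier_F gen_def zero_free_word_def)

lemma carrier_F_closed:
  shows "0 \<in> carrier F" and "\<lbrakk>p \<in> carrier F; q \<in> carrier F\<rbrakk> \<Longrightarrow> p + q \<in> carrier F"
    and "\<lbrakk>p \<in> carrier F; q \<in> carrier F\<rbrakk> \<Longrightarrow> p * q \<in> carrier F"
    and "\<lbrakk>p \<in> carrier F; q \<in> carrier F\<rbrakk> \<Longrightarrow> p - q \<in> carrier F"
    and "p \<in> carrier F \<Longrightarrow> scalar c * p \<in> carrier F"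
proof -
  interpret rng F by (rule rng_F)
  show "0 \<in> carrier F" using zero_closed by simp
  show "p + q \<in> carrier F" "p * q \<in> carrier F" if "p \<in> carrier F" "q \<in> carrier F"
    using a_closed[OF that] m_closed[OF that] by simp_all
  show "p - q \<in> carrier F" if "p \<in> carrier F" "q \<in> carrier F"
    using that keys_diff[of p q] unfolding mem_carrier_F by blast
  show "scalar c * p \<in> carrier F" if "p \<in> carrier F"
    using that keys_mult[of "scalar c" p] unfolding mem_carrier_F
    by (auto split: if_splits dest!: subsetD)
qed

lemma R_closed:
  shows "0 \<in> R" and "\<lbrakk>p \<in> R; q \<in> R\<rbrakk> \<Longrightarrow> p + q \<in> R"
    and "\<lbrakk>p \<in> R; q \<in> carrier F\<rbrakk> \<Longrightarrow> p * q \<in> R" and "\<lbrakk>p \<in> R; q \<in> carrier F\<rbrakk> \<Longrightarrow> q * p \<in> R"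
    and "p \<in> R \<Longrightarrow> scalar c * p \<in> R"
proof -
  interpret additive_subgroup R F using ideal_R by (simp add: rng_ideal_def)
  show "0 \<in> R" using zero_closed by simp
  show "p + q \<in> R" if "p \<in> R" "q \<in> R" using a_closed[OF that] by simp
  show "p * q \<in> R" "q * p \<in> R" if "p \<in> R" "q \<in> carrier F"
    using ideal_R that by (auto simp: rng_ideal_def)
  show "p \<in> R \<Longrightarrow> scalar c * p \<in> R"
    by (simp add: lpa_rel_ideal_def free_genideal_def)
qed

text \<open>
  Ideals \<open>S\<close> of the free algebra without unit on the generators are extended to the free unital
  algebra on the whole type, so that no carrier conditions remain: the words that use letters outside
  \<open>lpa_gens G\<close> are added.
\<close>

definition retract :: "(('v, 'e) lpa_gen free_word \<Rightarrow>\<^sub>0 'k) \<Rightarrow> (('v, 'e) lpa_gen free_word \<Rightarrow>\<^sub>0 'k)" where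
  "retract = restrict_words {w. set (letters w) \<subseteq> lpa_gens G}"

definition extension :: "(('v, 'e) lpa_gen free_word \<Rightarrow>\<^sub>0 'k) set \<Rightarrow> (('v, 'e) lpa_gen free_word \<Rightarrow>\<^sub>0 'k) set" where
  "extension S = {p. retract p \<in> S}"

lemma retract_add: "retract (p + q) = retract p + retract q"
  and retract_diff: "retract (p - q) = retract p - retract q"
  and retract_zero [simp]: "retract 0 = 0"
  by (simp_all add: retract_def restrict_words_add restrict_words_diff)

lemma retract_mult: "retract (p * q) = retract p * retract q"
  unfolding retract_def by (rule restrict_words_mult) (auto simp: plus_free_word_def)

lemma retract_carrier [simp]: "p \<in> carrier F \<Longrightarrow> retract p = p"
  unfolding retract_def by (rule restrict_words_idem) (auto simp: mem_carrier_F)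

lemma retract_idem [simp]: "retract (retract p) = retract p"
  unfolding retract_def by (rule restrict_words_idem) (auto simp: keys_restrict_words)

lemma lookup_retract_zero: "Poly_Mapping.lookup (retract p) 0 = Poly_Mapping.lookup p 0"
  by (simp add: retract_def lookup_restrict_words zero_free_word_def)

lemma retract_gen_outside: "g \<notin> lpa_gens G \<Longrightarrow> retract (gen g) = 0"
  by (simp add: retract_def gen_def restrict_words_single)

text \<open>After retraction a multiplier from the unital algebra is a scalar plus an element of
  \<open>F\<close>. Closure under arbitrary multipliers thus splits into closure under scalars and
  under \<open>F\<close>.\<close>

lemma retract_unital:
  obtains p where "p \<in> carrier F" "retract a = scalar (Poly_Mapping.lookup a 0) + p"
proof (rule that)
  define p where "p = retract a - scalar (Poly_Mapping.lookup a 0)"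
  show "retract a = scalar (Poly_Mapping.lookup a 0) + p" by (simp add: p_def)
  have "Poly_Mapping.lookup p 0 = 0" by (simp add: p_def lookup_minus lookup_retract_zero)
  then have "0 \<notin> Poly_Mapping.keys p" by (simp add: in_keys_iff)
  moreover have "set (letters w) \<subseteq> lpa_gens G" if "w \<in> Poly_Mapping.keys p" for w
    using that keys_diff[of "retract a" "scalar (Poly_Mapping.lookup a 0)"]
    by (auto simp: p_def retract_def keys_restrict_words zero_free_word_def split: if_splits)
  ultimately show "p \<in> carrier F" by (auto simp: mem_carrier_F)
qed

lemma two_sided_ideal_extension:
  assumes S: "rng_ideal S F" and scalar: "\<And>c p. p \<in> S \<Longrightarrow> scalar c * p \<in> S"
  shows "two_sided_ideal (extension S)"
proof -
  interpret additive_subgroup S F using S by (simp add: rng_ideal_def)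
  have zero: "0 \<in> S" and add: "p + q \<in> S" if "p \<in> S" "q \<in> S" for p q
    using zero_closed a_closed[OF that] by simp_all
  have mult: "p * q \<in> S" "q * p \<in> S" if "p \<in> S" "q \<in> carrier F" for p q
    using S that by (auto simp: rng_ideal_def)
  show ?thesis
  proof
    show "0 \<in> extension S" using zero_closed by (simp add: extension_def)
    fix x y assume "x \<in> extension S" "y \<in> extension S"
    then show "x + y \<in> extension S" by (auto simp: extension_def retract_add intro: add)
  next
    fix x a assume x: "x \<in> extension S"
    obtain p where p: "p \<in> carrier F" "retract a = scalar (Poly_Mapping.lookup a 0) + p"
      by (rule retract_unital)
    show "a * x \<in> extension S" "x * a \<in> extension S"
      using x add[OF scalar mult(2)[OF _ p(1)]] add[OF scalar mult(1)[OF _ p(1)]]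
      by (auto simp: extension_def retract_mult p(2) distrib_left distrib_right scalar_commute)
  qed
qed

definition P :: "(('v, 'e) lpa_gen free_word \<Rightarrow>\<^sub>0 'k) set" where
  "P = extension R"

lemma two_sided_ideal_P: "two_sided_ideal P"
  unfolding P_def by (rule two_sided_ideal_extension[OF ideal_R R_closed(5)])

lemma relators_subset: "lpa_relators G \<subseteq> R"
  by (auto simp: lpa_rel_ideal_def free_genideal_def)

lemma relator_mem_P: "r \<in> lpa_relators G \<Longrightarrow> r \<in> P"
proof -
  assume r: "r \<in> lpa_relators G"
  have "r \<in> carrier F" using lpa_relators_carrier r by (meson subsetD wf_digraph_axioms)
  then show "r \<in> P" using r relators_subset by (auto simp: P_def extension_def)
qed

lemma retract_cong: "p - retract p \<in> P"
  by (simp add: P_def extension_def retract_diff R_closed)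

lemma rng_ideal_F:
  assumes S: "S \<subseteq> carrier F" "0 \<in> S"
    and add: "\<And>p q. \<lbrakk>p \<in> S; q \<in> S\<rbrakk> \<Longrightarrow> p + q \<in> S" and scalar: "\<And>c p. p \<in> S \<Longrightarrow> scalar c * p \<in> S"
    and mult: "\<And>p q. \<lbrakk>p \<in> S; q \<in> carrier F\<rbrakk> \<Longrightarrow> p * q \<in> S \<and> q * p \<in> S"
  shows "rng_ideal S F"
proof -
  interpret F: rng F by (rule rng_F)
  have "subgroup S (add_monoid F)"
  proof (rule F.add.subgroupI)
    show "S \<subseteq> carrier F" by fact
    show "S \<noteq> {}" using S(2) by blast
    show "a \<oplus>\<^bsub>F\<^esub> b \<in> S" if "a \<in> S" "b \<in> S" for a b using add[OF that] by simp
    fix a assume a: "a \<in> S"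
    have um: "- a \<in> S" using scalar[OF a, of "-1"] by (simp add: single_uminus)
    have "\<ominus>\<^bsub>F\<^esub> a = - a"
      using a um S(1) by (intro F.minus_equality) auto
    then show "\<ominus>\<^bsub>F\<^esub> a \<in> S" using um by simp
  qed
  then show ?thesis
    using mult by (simp add: rng_ideal_def additive_subgroup_def)
qed

text \<open>Carries the minimality of \<open>R\<close> over to ideals of the larger unital algebra;
  \<open>hcomp_P\<close> applies it to a graded part.\<close>

lemma rel_ideal_minimal:
  assumes M: "two_sided_ideal M" "lpa_relators G \<subseteq> M"
  shows "R \<subseteq> M"
proof -
  interpret M: two_sided_ideal M by fact
  have "rng_ideal (M \<inter> carrier F) F"
    by (rule rng_ideal_F)
      (blast intro: M.zero M.add M.lmult M.rmult carrier_F_closed)+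
  moreover have "scalar c * p \<in> M \<inter> carrier F" if "p \<in> M \<inter> carrier F" for c p
    using that M.lmult carrier_F_closed(5) by blast
  moreover have "lpa_relators G \<subseteq> M \<inter> carrier F"
    using M(2) lpa_relators_carrier[OF wf_digraph_axioms] by blast
  ultimately have "M \<inter> carrier F \<in> {J. rng_ideal J F \<and> (\<forall>c. \<forall>p\<in>J. scalar c * p \<in> J) \<and> lpa_relators G \<subseteq> J}"
    by blast
  then have "R \<subseteq> M \<inter> carrier F"
    unfolding lpa_rel_ideal_def free_genideal_def by (rule Inter_lower)
  then show ?thesis by blast
qed

end

section \<open>Ideals of the Leavitt path algebra pulled back to the free unital algebra\<close>

context leavitt_ideal
begin

lemma outside_mem_P: "g \<notin> lpa_gens G \<Longrightarrow> gen g \<in> P"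
  by (simp add: P_def extension_def retract_gen_outside R_closed)

text \<open>For letters that are not generators of the graph the relations hold because both sides
  lie in \<open>P\<close>.\<close>

lemma cohn_ideal_P: "cohn_ideal G P"
proof -
  interpret P: free_ideal P by (simp add: free_ideal_def two_sided_ideal_P)
  show ?thesis
  proof unfold_locales
    fix v w
    show "P.eqv (gen (Vertex v) * gen (Vertex w)) (if v = w then gen (Vertex v) else 0)"
    proof (cases "v \<in> verts G \<and> w \<in> verts G")
      case True
      then have "gen (Vertex v) * gen (Vertex w) - (if v = w then gen (Vertex v) else 0) \<in> lpa_relators G"
        unfolding lpa_relators_def by blast
      then show ?thesis unfolding P.eqv_def by (rule relator_mem_P)
    next
      case False
      then have "Vertex v \<notin> lpa_gens G \<or> Vertex w \<notin> lpa_gens G" by (auto simp: lpa_gens_def)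
      then have "gen (Vertex v) \<in> P \<or> gen (Vertex w) \<in> P" using outside_mem_P by blast
      then show ?thesis by (auto simp: P.eqv_def intro!: P.diff intro: P.lmult P.rmult)
    qed
  next
    fix e
    have "P.eqv (gen (Vertex (tail G e)) * gen (Edge e)) (gen (Edge e)) \<and>
      P.eqv (gen (Edge e) * gen (Vertex (head G e))) (gen (Edge e)) \<and>
      P.eqv (gen (Vertex (head G e)) * gen (Ghost e)) (gen (Ghost e)) \<and>
      P.eqv (gen (Ghost e) * gen (Vertex (tail G e))) (gen (Ghost e))"
    proof (cases "e \<in> arcs G")
      case True
      then show ?thesis
        unfolding P.eqv_def by (intro conjI relator_mem_P) (unfold lpa_relators_def, blast+)
    next
      case False
      then have "gen (Edge e) \<in> P" "gen (Ghost e) \<in> P"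
        by (auto intro!: outside_mem_P simp: lpa_gens_def)
      then show ?thesis
        unfolding P.eqv_def by (intro conjI P.diff) (simp_all add: P.lmult P.rmult)
    qed
    then show "P.eqv (gen (Vertex (tail G e)) * gen (Edge e)) (gen (Edge e))"
      "P.eqv (gen (Edge e) * gen (Vertex (head G e))) (gen (Edge e))"
      "P.eqv (gen (Vertex (head G e)) * gen (Ghost e)) (gen (Ghost e))"
      "P.eqv (gen (Ghost e) * gen (Vertex (tail G e))) (gen (Ghost e))"
      by blast+
  next
    fix e f assume "e \<in> arcs G" "f \<in> arcs G"
    then have "gen (Ghost e) * gen (Edge f) - (if e = f then gen (Vertex (head G e)) else 0) \<in> lpa_relators G"
      unfolding lpa_relators_def by blast
    then show "P.eqv (gen (Ghost e) * gen (Edge f)) (if e = f then gen (Vertex (head G e)) else 0)"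
      unfolding P.eqv_def by (rule relator_mem_P)
  qed (auto intro!: outside_mem_P simp: lpa_gens_def)
qed

interpretation P: cohn_ideal G P
  by (rule cohn_ideal_P)

definition preimage :: "('v, 'e, 'k) lpa set \<Rightarrow> (('v, 'e) lpa_gen free_word \<Rightarrow>\<^sub>0 'k) set" where
  "preimage N = extension {p \<in> carrier F. cls p \<in> N}"

lemma mem_preimage: "p \<in> carrier F \<Longrightarrow> p \<in> preimage N \<longleftrightarrow> cls p \<in> N"
  by (simp add: preimage_def extension_def)

lemma preimageD: "p \<in> preimage N \<Longrightarrow> retract p \<in> carrier F \<and> cls (retract p) \<in> N"
  by (simp add: preimage_def extension_def)

lemma retract_eqv: "P.eqv p (retract p)"
  using retract_cong by (simp add: P.eqv_def)

lemma cls_eq_iff: "\<lbrakk>p \<in> carrier F; q \<in> carrier F\<rbrakk> \<Longrightarrow> cls p = cls q \<longleftrightarrow> P.eqv p q"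
proof -
  assume pq: "p \<in> carrier F" "q \<in> carrier F"
  then have "P.eqv p q \<longleftrightarrow> p - q \<in> R"
    unfolding P.eqv_def by (simp add: P_def extension_def retract_diff)
  then show ?thesis using cls_eqI[of p q] cls_eqD[of p q] pq by blast
qed

text \<open>A ring ideal of \<open>L\<close> is closed under scalars because of local units: if a
  sum \<open>s\<close> of vertices fixes \<open>p\<close> from the left, then
  \<open>scalar c * p\<close> is congruent to \<open>(scalar c * s) * p\<close>, a product in
  \<open>L\<close> with one factor in the ideal.\<close>

lemma two_sided_ideal_preimage:
  assumes N: "rng_ideal N L"
  shows "two_sided_ideal (preimage N)"
proof -
  interpret N: additive_subgroup N L using N by (simp add: rng_ideal_def)
  have mult: "a \<otimes>\<^bsub>L\<^esub> x \<in> N" "x \<otimes>\<^bsub>L\<^esub> a \<in> N" if "a \<in> N" "x \<in> carrier L" for a x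
    using N that by (auto simp: rng_ideal_def)
  define S where "S = {p \<in> carrier F. cls p \<in> N}"
  have scalar: "scalar c * p \<in> S" if p: "p \<in> S" for c p
  proof -
    have pF: "p \<in> carrier F" and pN: "cls p \<in> N" using p by (auto simp: S_def)
    have "Poly_Mapping.lookup p 0 = 0" using pF by (auto simp: mem_carrier_F in_keys_iff)
    from P.local_units[OF this] obtain A where "finite A"
      and "\<forall>B. finite B \<longrightarrow> A \<subseteq> B \<longrightarrow> P.eqv (p * (\<Sum>v\<in>B. gen (Vertex v))) p \<and> P.eqv ((\<Sum>v\<in>B. gen (Vertex v)) * p) p"
      by (elim exE conjE)
    then have A: "P.eqv ((\<Sum>v\<in>A. gen (Vertex v)) * p) p" by simp
    define s where "s = (\<Sum>v\<in>A. gen (Vertex v) :: ('v, 'e) lpa_gen free_word \<Rightarrow>\<^sub>0 'k)"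
    have s0: "Poly_Mapping.lookup s 0 = 0"
      by (simp add: s_def lookup_sum gen_def lookup_single zero_free_word_def when_def)
    obtain t where t: "t \<in> carrier F" "retract s = scalar (Poly_Mapping.lookup s 0) + t"
      by (rule retract_unital)
    then have ts: "retract s = t" using s0 by simp
    have "P.eqv (t * p) (s * p)" by (rule P.eqv_rmult[OF P.eqv_sym[OF retract_eqv[of s, unfolded ts]]])
    from P.eqv_trans[OF this A[folded s_def]] have "P.eqv (t * p) p" .
    from P.eqv_lmult[OF this, of "scalar c"]
    have "P.eqv ((scalar c * t) * p) (scalar c * p)" by (simp add: mult.assoc)
    then have "cls (scalar c * p) = cls ((scalar c * t) * p)"
      using t(1) pF carrier_F_closed by (subst cls_eq_iff) (auto intro: P.eqv_sym)
    also have "\<dots> = cls (scalar c * t) \<otimes>\<^bsub>L\<^esub> cls p"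
      using t pF carrier_F_closed by (simp add: cls_mult)
    also have "\<dots> \<in> N" using t pN carrier_F_closed by (intro mult) (auto simp: carrier_L)
    finally show ?thesis using pF carrier_F_closed by (simp add: S_def)
  qed
  have "rng_ideal S F"
  proof (rule rng_ideal_F)
    show "0 \<in> S" using N.zero_closed carrier_F_closed by (simp add: S_def cls_zero)
    show "p + q \<in> S" if "p \<in> S" "q \<in> S" for p q
    proof -
      have pq: "p \<in> carrier F" "q \<in> carrier F" and N': "cls p \<in> N" "cls q \<in> N"
        using that by (simp_all add: S_def)
      show ?thesis
        using N.a_closed[OF N'] carrier_F_closed(2)[OF pq] cls_add[OF pq] by (simp add: S_def)
    qed
    show "p * q \<in> S \<and> q * p \<in> S" if "p \<in> S" "q \<in> carrier F" for p q
      using mult[of "cls p" "cls q"] that carrier_F_closed by (auto simp: S_def cls_mult carrier_L)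
  qed (use scalar in \<open>auto simp: S_def\<close>)
  then show ?thesis
    unfolding preimage_def S_def[symmetric] using scalar by (rule two_sided_ideal_extension)
qed

lemma P_subset_preimage:
  assumes N: "rng_ideal N L"
  shows "P \<subseteq> preimage N"
proof
  fix p assume "p \<in> P"
  then have r: "retract p \<in> R" by (simp add: P_def extension_def)
  then have F: "retract p \<in> carrier F" using rng_ideal_subset[OF ideal_R] by blast
  interpret N: additive_subgroup N L using N by (simp add: rng_ideal_def)
  have "cls (retract p) = cls 0" using r carrier_F_closed by (intro cls_eqI) simp_all
  then show "p \<in> preimage N"
    using F N.zero_closed by (simp add: preimage_def extension_def cls_zero)
qed

abbreviation "Ih \<equiv> preimage I"

lemma two_sided_ideal_Ih: "two_sided_ideal Ih"
  by (rule two_sided_ideal_preimage[OF ideal_I])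

interpretation I: two_sided_ideal Ih
  by (rule two_sided_ideal_Ih)

lemma retract_mem: "x \<in> Ih \<Longrightarrow> retract x \<in> carrier F \<and> cls (retract x) \<in> I"
  by (rule preimageD)

lemma I_cls: "a \<in> I \<Longrightarrow> \<exists>p. p \<in> carrier F \<and> p \<in> Ih \<and> a = cls p"
proof -
  assume a: "a \<in> I"
  then have "a \<in> cls ` carrier F" using rng_ideal_subset[OF ideal_I] carrier_L by blast
  then obtain p where "p \<in> carrier F" "a = cls p" by blast
  then show ?thesis using a mem_preimage[of p I] by auto
qed

abbreviation "RI \<equiv> L\<lparr>carrier := I\<rparr>"

lemma rng_RI: "rng RI"
  by (rule rng_ideal_imp_rng[OF rng_L ideal_I])

lemma sandwich:
  assumes pi: "purely_infinite RI" and a: "a \<in> Ih" and x: "x \<in> Ih" "y \<in> Ih" "x' \<in> Ih" "y' \<in> Ih"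
  shows "\<exists>s\<in>Ih. \<exists>t\<in>Ih. s * a * t - (x * a * y + x' * a * y') \<in> P"
proof -
  interpret RI: rng RI by (rule rng_RI)
  \<comment> \<open>The map \<open>cls\<close> respects products of elements of the carrier of
    \<open>F\<close>, so everything is retracted into it first; modulo \<open>P\<close> this changes
    nothing.\<close>
  define r where "r = (retract :: _ \<Rightarrow> (('v, 'e) lpa_gen free_word \<Rightarrow>\<^sub>0 'k))"
  have r: "r z \<in> carrier F" "cls (r z) \<in> I" "r z \<in> Ih" if "z \<in> Ih" for z
    using retract_mem[OF that] mem_preimage by (auto simp: r_def)
  define X where "X i = cls (if i = 0 then r x else r x')" for i :: nat
  define Y where "Y i = cls (if i = 0 then r y else r y')" for i :: nat
  define b where "b = (\<Oplus>\<^bsub>RI\<^esub>i\<in>{..<2::nat}. X i \<otimes>\<^bsub>RI\<^esub> cls (r a) \<otimes>\<^bsub>RI\<^esub> Y i)"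
  have XY: "X i \<in> I" "Y i \<in> I" for i using r x by (auto simp: X_def Y_def)
  have "b \<in> rng_sandwich RI (cls (r a))"
    unfolding rng_sandwich_def b_def using XY by (intro CollectI exI[of _ "2::nat"] exI[of _ X] exI[of _ Y]) auto
  moreover have "\<forall>a\<in>carrier RI. \<forall>b\<in>rng_sandwich RI a. \<exists>s\<in>carrier RI. \<exists>t\<in>carrier RI. b = s \<otimes>\<^bsub>RI\<^esub> a \<otimes>\<^bsub>RI\<^esub> t"
    using pi unfolding purely_infinite_def by blast
  ultimately have "\<exists>s\<in>carrier RI. \<exists>t\<in>carrier RI. b = s \<otimes>\<^bsub>RI\<^esub> cls (r a) \<otimes>\<^bsub>RI\<^esub> t"
    using r(2)[OF a] by simp
  then obtain s t where st: "s \<in> I" "t \<in> I" and b: "b = s \<otimes>\<^bsub>L\<^esub> cls (r a) \<otimes>\<^bsub>L\<^esub> t"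
    by auto
  obtain s' t' where s': "s' \<in> carrier F" "s' \<in> Ih" "s = cls s'" and t': "t' \<in> carrier F" "t' \<in> Ih" "t = cls t'"
    using I_cls st by meson
  have term_mem: "X i \<otimes>\<^bsub>L\<^esub> cls (r a) \<otimes>\<^bsub>L\<^esub> Y i \<in> I" for i
    using RI.m_closed XY r(2)[OF a] by simp
  have "{..<2::nat} = {0, 1}" by auto
  then have "b = (X 0 \<otimes>\<^bsub>L\<^esub> cls (r a) \<otimes>\<^bsub>L\<^esub> Y 0) \<oplus>\<^bsub>L\<^esub> (X 1 \<otimes>\<^bsub>L\<^esub> cls (r a) \<otimes>\<^bsub>L\<^esub> Y 1)"
    unfolding b_def using term_mem by (simp add: RI.finsum_insert RI.finsum_empty Pi_def RI.r_zero[simplified])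
  also have "\<dots> = cls (r x * r a * r y + r x' * r a * r y')"
    using r a x carrier_F_closed by (simp add: X_def Y_def cls_mult cls_add)
  finally have "cls (s' * r a * t') = cls (r x * r a * r y + r x' * r a * r y')"
    using b s' t' r(1)[OF a] carrier_F_closed by (simp add: cls_mult)
  then have "P.eqv (s' * r a * t') (r x * r a * r y + r x' * r a * r y')"
    using s' t' r(1) a x carrier_F_closed by (subst (asm) cls_eq_iff) simp_all
  moreover have "P.eqv (s' * a * t') (s' * r a * t')"
    unfolding r_def by (intro P.eqv_rmult P.eqv_lmult retract_eqv)
  moreover have "P.eqv (r x * r a * r y + r x' * r a * r y') (x * a * y + x' * a * y')"
    unfolding r_def by (intro P.eqv_add P.eqv_mult P.eqv_sym[OF retract_eqv])
  ultimately have "P.eqv (s' * a * t') (x * a * y + x' * a * y')" using P.eqv_trans by blast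
  then show ?thesis using s' t' unfolding P.eqv_def by blast
qed

text \<open>The image \<open>Q\<close> of \<open>M\<close> in \<open>I\<close> is an ideal of the
  ring \<open>I\<close>. The hypotheses say that the class of \<open>u\<close> is a nonzero unit of
  the quotient by \<open>Q\<close> and that all nonzero classes are invertible.\<close>

lemma no_division_quotient:
  assumes pi: "purely_infinite RI" and M: "two_sided_ideal M" "P \<subseteq> M" and u: "u \<in> Ih" "u \<notin> M"
    and unit: "\<And>x. x \<in> Ih \<Longrightarrow> u * x - x \<in> M" "\<And>x. x \<in> Ih \<Longrightarrow> x * u - x \<in> M"
    and inverse: "\<And>x. \<lbrakk>x \<in> Ih; x \<notin> M\<rbrakk> \<Longrightarrow> \<exists>y\<in>Ih. x * y - u \<in> M \<and> y * x - u \<in> M"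
  shows False
proof -
  interpret M: two_sided_ideal M by (rule M)
  interpret RI: rng RI by (rule rng_RI)
  have PM: "M.eqv a b" if "P.eqv a b" for a b
    using that M(2) by (auto simp: P.eqv_def M.eqv_def)
  define Q where "Q = {cls p | p. p \<in> M \<and> p \<in> carrier F \<and> p \<in> Ih}"
  have mem_Q: "cls p \<in> Q" if "p \<in> M" "p \<in> carrier F" "p \<in> Ih" for p
    using that by (auto simp: Q_def)
  have QI: "Q \<subseteq> I" using mem_preimage by (auto simp: Q_def)
  \<comment> \<open>Since \<open>M\<close> contains \<open>P\<close>, membership in \<open>Q\<close>
    does not depend on the representative.\<close>
  have memQ: "p \<in> M" if p: "p \<in> carrier F" "cls p \<in> Q" for p
  proof -
    obtain p' where p': "cls p = cls p'" "p' \<in> M" "p' \<in> carrier F" using p by (auto simp: Q_def)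
    then have "M.eqv p p'" using cls_eq_iff p PM by blast
    then show ?thesis using p' M.mem_cong by blast
  qed
  have Q: "rng_ideal Q RI"
    unfolding rng_ideal_def
  proof (intro conjI ballI)
    have "subgroup Q (add_monoid RI)"
    proof (rule RI.add.subgroupI)
      show "Q \<subseteq> carrier RI" using QI by simp
      show "Q \<noteq> {}" using M.zero I.zero carrier_F_closed by (auto simp: Q_def)
      fix a assume "a \<in> Q"
      then obtain p where p: "a = cls p" "p \<in> M" "p \<in> carrier F" "p \<in> Ih" by (auto simp: Q_def)
      have m: "- p \<in> carrier F" using carrier_F_closed(4)[OF carrier_F_closed(1) p(3)] by simp
      have mQ: "cls (- p) \<in> Q" using m p M.uminus I.uminus by (auto simp: Q_def)
      have "\<ominus>\<^bsub>RI\<^esub> a = cls (- p)"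
      proof (rule RI.minus_equality)
        show "cls (- p) \<oplus>\<^bsub>RI\<^esub> a = \<zero>\<^bsub>RI\<^esub>" using p m by (simp add: cls_add cls_zero)
      qed (use p mQ QI \<open>a \<in> Q\<close> in auto)
      then show "\<ominus>\<^bsub>RI\<^esub> a \<in> Q" using mQ by simp
      fix b assume "b \<in> Q"
      then obtain p' where p': "b = cls p'" "p' \<in> M" "p' \<in> carrier F" "p' \<in> Ih" by (auto simp: Q_def)
      have "a \<oplus>\<^bsub>RI\<^esub> b = cls (p + p')" using p p' by (simp add: cls_add)
      then show "a \<oplus>\<^bsub>RI\<^esub> b \<in> Q"
        using mem_Q[OF M.add[OF p(2) p'(2)] carrier_F_closed(2)[OF p(3) p'(3)] I.add[OF p(4) p'(4)]]
        by simp
    qed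
    then show "additive_subgroup Q RI" by (simp add: additive_subgroup_def)
    fix a x assume "a \<in> Q" "x \<in> carrier RI"
    obtain p where p: "a = cls p" "p \<in> M" "p \<in> carrier F" "p \<in> Ih"
      using \<open>a \<in> Q\<close> by (auto simp: Q_def)
    obtain p' where p': "x = cls p'" "p' \<in> carrier F"
      using I_cls[of x] \<open>x \<in> carrier RI\<close> by auto
    have "x \<otimes>\<^bsub>RI\<^esub> a = cls (p' * p)" "a \<otimes>\<^bsub>RI\<^esub> x = cls (p * p')"
      using p p' by (simp_all add: cls_mult)
    then show "x \<otimes>\<^bsub>RI\<^esub> a \<in> Q" "a \<otimes>\<^bsub>RI\<^esub> x \<in> Q"
      using mem_Q[OF M.lmult[OF p(2)] carrier_F_closed(3)[OF p'(2) p(3)] I.lmult[OF p(4)]]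
        mem_Q[OF M.rmult[OF p(2)] carrier_F_closed(3)[OF p(3) p'(2)] I.rmult[OF p(4)]] by simp_all
  qed
  define q where "q p = Q +>\<^bsub>RI\<^esub> cls p" for p
  have qI: "q a = q b" if ab: "a \<in> carrier F" "b \<in> carrier F" "a \<in> Ih" "b \<in> Ih" "a - b \<in> M" for a b
    unfolding q_def
  proof (rule quot_eqI[OF rng_RI Q])
    show "cls (a - b) \<in> Q" by (rule mem_Q[OF ab(5) carrier_F_closed(4)[OF ab(1,2)] I.diff[OF ab(3,4)]])
    show "cls b \<in> carrier RI" using ab mem_preimage by simp
    show "cls a = cls (a - b) \<oplus>\<^bsub>RI\<^esub> cls b" using ab carrier_F_closed by (simp add: cls_add)
  qed
  have q_eqv: "q a = q b"
    if "M.eqv a b" "a \<in> carrier F" "b \<in> carrier F" "a \<in> Ih" "b \<in> Ih" for a b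
    using qI that by (simp add: M.eqv_def)
  have q_mult: "q a \<otimes>\<^bsub>RI Quot Q\<^esub> q b = q (a * b)"
    if "a \<in> carrier F" "b \<in> carrier F" "a \<in> Ih" "b \<in> Ih" for a b
    using quot_mult[OF rng_RI Q, of "cls a" "cls b"] that mem_preimage by (simp add: q_def cls_mult)
  have q_zero: "\<zero>\<^bsub>RI Quot Q\<^esub> = q 0"
    using quot_zero[OF rng_RI Q] by (simp add: q_def cls_zero)
  have q_carrier: "carrier (RI Quot Q) = q ` (carrier F \<inter> Ih)"
    unfolding quot_carrier q_def using I_cls mem_preimage by force
  define u' where "u' = retract u"
  have u': "u' \<in> carrier F" "u' \<in> Ih" "M.eqv u u'"
    using retract_mem[OF u(1)] mem_preimage PM[OF retract_eqv] by (auto simp: u'_def)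
  have q_nonzero: "q u' \<noteq> q 0"
  proof
    assume "q u' = q 0"
    then have eq: "Q +>\<^bsub>RI\<^esub> cls u' = Q +>\<^bsub>RI\<^esub> cls 0" by (simp add: q_def)
    have "cls u' \<in> carrier RI" using u' mem_preimage by simp
    then obtain i where i: "i \<in> Q" "cls u' = i \<oplus>\<^bsub>RI\<^esub> cls 0"
      using eq by (rule quot_eqD[OF rng_RI Q])
    from i(1) obtain p where p: "i = cls p" "p \<in> carrier F" unfolding Q_def by blast
    have "cls u' = i" using i(2) p carrier_F_closed(1) by (simp add: cls_add)
    then have "u' \<in> M" using i(1) u'(1) memQ by blast
    then show False using u(2) u'(3) M.mem_cong by blast
  qed
  have q_unit: "q u' \<otimes>\<^bsub>RI Quot Q\<^esub> q a = q a" "q a \<otimes>\<^bsub>RI Quot Q\<^esub> q u' = q a"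
    if a: "a \<in> carrier F" "a \<in> Ih" for a
  proof -
    have "M.eqv (u' * a) a" "M.eqv (a * u') a"
      using unit[OF a(2)] M.eqv_trans[OF M.eqv_rmult[OF M.eqv_sym[OF u'(3)]], of a a]
        M.eqv_trans[OF M.eqv_lmult[OF M.eqv_sym[OF u'(3)]], of a a]
      by (simp_all add: M.eqv_def)
    then show "q u' \<otimes>\<^bsub>RI Quot Q\<^esub> q a = q a" "q a \<otimes>\<^bsub>RI Quot Q\<^esub> q u' = q a"
      by (simp_all only: q_mult a u' q_eqv I.lmult carrier_F_closed)
  qed
  have q_inverse: "\<exists>y\<in>carrier (RI Quot Q). q a \<otimes>\<^bsub>RI Quot Q\<^esub> y = q u' \<and> y \<otimes>\<^bsub>RI Quot Q\<^esub> q a = q u'"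
    if a: "a \<in> carrier F" "a \<in> Ih" "q a \<noteq> q 0" for a
  proof -
    have "a \<notin> M" using qI[of a 0] a carrier_F_closed I.zero by auto
    then obtain y where y: "y \<in> Ih" "M.eqv (a * y) u" "M.eqv (y * a) u"
      using inverse[OF a(2)] by (auto simp: M.eqv_def)
    define y' where "y' = retract y"
    have y': "y' \<in> carrier F" "y' \<in> Ih" "M.eqv y' y"
      using retract_mem[OF y(1)] mem_preimage M.eqv_sym[OF PM[OF retract_eqv]] by (auto simp: y'_def)
    have "M.eqv (a * y') u'" "M.eqv (y' * a) u'"
      using M.eqv_trans[OF M.eqv_trans[OF M.eqv_lmult[OF y'(3)] y(2)] u'(3)]
        M.eqv_trans[OF M.eqv_trans[OF M.eqv_rmult[OF y'(3)] y(3)] u'(3)] by auto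
    then have "q a \<otimes>\<^bsub>RI Quot Q\<^esub> q y' = q u'" "q y' \<otimes>\<^bsub>RI Quot Q\<^esub> q a = q u'"
      by (simp_all only: q_mult a u' y' q_eqv I.lmult carrier_F_closed)
    then show ?thesis using y'(1,2) q_carrier by blast
  qed
  have "\<forall>x\<in>carrier (RI Quot Q). q u' \<otimes>\<^bsub>RI Quot Q\<^esub> x = x \<and> x \<otimes>\<^bsub>RI Quot Q\<^esub> q u' = x"
    unfolding q_carrier using q_unit by simp
  moreover have "\<forall>x\<in>carrier (RI Quot Q) - {q 0}.
      \<exists>y\<in>carrier (RI Quot Q). x \<otimes>\<^bsub>RI Quot Q\<^esub> y = q u' \<and> y \<otimes>\<^bsub>RI Quot Q\<^esub> x = q u'"
  proof
    fix x assume "x \<in> carrier (RI Quot Q) - {q 0}"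
    then obtain a where "a \<in> carrier F" "a \<in> Ih" "x = q a" "q a \<noteq> q 0" unfolding q_carrier by blast
    then show "\<exists>y\<in>carrier (RI Quot Q). x \<otimes>\<^bsub>RI Quot Q\<^esub> y = q u' \<and> y \<otimes>\<^bsub>RI Quot Q\<^esub> x = q u'"
      using q_inverse by simp
  qed
  moreover have "q u' \<in> carrier (RI Quot Q)" using u' q_carrier by blast
  ultimately have "rng_division (RI Quot Q)"
    unfolding rng_division_def q_zero
    by (intro conjI[OF rng_Quot[OF rng_RI Q]] bexI[of _ "q u'"] conjI[OF q_nonzero] conjI)
  then show False using pi Q unfolding purely_infinite_def by blast
qed

lemma purely_infinite_ideal_Ih: "purely_infinite RI \<Longrightarrow> purely_infinite_ideal P Ih"
  by (intro purely_infinite_ideal.intro purely_infinite_ideal_axioms.intro two_sided_ideal_P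
      two_sided_ideal_Ih) (rule no_division_quotient sandwich; assumption)+

text \<open>The relators are homogeneous, so they lie in the graded part of \<open>P\<close>, and
  therefore \<open>R\<close> does. Retraction commutes with taking components, which extends this to
  \<open>P\<close>.\<close>

lemma hcomp_P:
  assumes "p \<in> P"
  shows "hcomp d p \<in> P"
proof -
  have "lpa_relators G \<subseteq> {x. \<forall>d. hcomp d x \<in> P}"
  proof
    fix r :: "('v, 'e) lpa_gen free_word \<Rightarrow>\<^sub>0 'k" assume r: "r \<in> lpa_relators G"
    obtain m where "homogeneous m r" using homogeneous_relator[OF r] by blast
    then show "r \<in> {x. \<forall>d. hcomp d x \<in> P}"
      using relator_mem_P[OF r] by (simp add: hcomp_homogeneous P.zero)
  qed
  then have "R \<subseteq> {x. \<forall>d. hcomp d x \<in> P}"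
    by (intro rel_ideal_minimal two_sided_ideal_graded_part two_sided_ideal_P)
  then have "hcomp d (retract p) \<in> P" using assms by (auto simp: P_def extension_def)
  moreover have "retract (hcomp d p) = hcomp d (retract p)"
    by (intro poly_mapping_eqI) (simp add: retract_def hcomp_def lookup_restrict_words)
  ultimately show ?thesis by (metis P.mem_cong retract_eqv)
qed

section \<open>The vertices of the ideal and the graph outside them\<close>

definition H :: "'v set" where
  "H = {v \<in> verts G. gen (Vertex v) \<in> Ih}"

lemma P_eqv_Ih: "P.eqv p q \<Longrightarrow> p \<in> Ih \<longleftrightarrow> q \<in> Ih"
  using P_subset_preimage[OF ideal_I] I.mem_cong[of p q] by (auto simp: P.eqv_def I.eqv_def)

text \<open>For a path from \<open>v\<close> to \<open>w\<close>, its ghost times \<open>V v\<close>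
  times the path is congruent to \<open>V w\<close>.\<close>

lemma hereditary_H: "hereditary G H"
  unfolding hereditary_def
proof (intro ballI allI impI)
  fix v w p assume v: "v \<in> H" and p: "awalk v p w"
  have "gpath G v p * (gen (Vertex v) * rpath G v p) \<in> Ih"
    using v by (intro I.lmult I.rmult) (simp add: H_def)
  moreover have "P.eqv (gpath G v p * (gen (Vertex v) * rpath G v p)) (gen (Vertex w))"
    by (rule P.eqv_trans[OF P.eqv_lmult[OF P.source_rp[OF p]] P.gp_rp[OF p]])
  ultimately show "w \<in> H" using P_eqv_Ih awalk_last_in_verts[OF p] by (simp add: H_def)
qed

text \<open>An edge is congruent to its product with its head, so every edge from \<open>v\<close>
  lies in the ideal; the relation at \<open>v\<close> writes the vertex through these edges.\<close>

lemma saturated_H: "saturated G H"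
  unfolding saturated_def
proof (intro allI impI)
  fix v assume v: "regular_vertex G v" and sub: "head G ` out_arcs G v \<subseteq> H"
  have "gen (Vertex v) - (\<Sum>e\<in>out_arcs G v. gen (Edge e) * gen (Ghost e)) \<in> lpa_relators G"
    unfolding lpa_relators_def using v by blast
  then have "P.eqv (gen (Vertex v)) (\<Sum>e\<in>out_arcs G v. gen (Edge e) * gen (Ghost e))"
    unfolding P.eqv_def by (rule relator_mem_P)
  moreover have "(\<Sum>e\<in>out_arcs G v. gen (Edge e) * gen (Ghost e)) \<in> Ih"
  proof (intro I.sum I.rmult)
    fix e assume "e \<in> out_arcs G v"
    then have "head G e \<in> H" using sub by blast
    then have "gen (Edge e) * gen (Vertex (head G e)) \<in> Ih"
      by (intro I.lmult) (simp add: H_def)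
    then show "gen (Edge e) \<in> Ih" using P_eqv_Ih[OF P.edge_head] by blast
  qed
  ultimately show "v \<in> H" using P_eqv_Ih v by (simp add: H_def regular_vertex_def)
qed

abbreviation "vtx \<equiv> lpa_vertex G :: 'v \<Rightarrow> ('v, 'e, 'k) lpa"

lemma vertices_subset: "vtx ` H \<subseteq> I"
proof
  fix x assume "x \<in> vtx ` H"
  then obtain v where v: "v \<in> H" "x = cls (gen (Vertex v))" by (auto simp: lpa_vertex_def)
  then have "P.V v \<in> carrier F" by (intro gen_carrier) (simp add: H_def lpa_gens_def)
  then show "x \<in> I" using v mem_preimage by (auto simp: H_def)
qed

definition J :: "(('v, 'e) lpa_gen free_word \<Rightarrow>\<^sub>0 'k) set" where
  "J = ideal_gen (P \<union> (\<lambda>v. gen (Vertex v)) ` H)"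

interpretation J: free_ideal J
  by (simp add: free_ideal_def J_def two_sided_ideal_gen)

lemma P_subset_J: "P \<subseteq> J"
  using ideal_gen_superset[of "P \<union> (\<lambda>v. gen (Vertex v)) ` H"] by (simp add: J_def)

lemma vertex_mem_J: "v \<in> H \<Longrightarrow> gen (Vertex v) \<in> J"
  using ideal_gen_superset[of "P \<union> (\<lambda>v. gen (Vertex v)) ` H"] by (auto simp: J_def)

text \<open>Used twice: with \<open>N = I\<close> it gives \<open>J \<subseteq> Ih\<close>, and with
  any ideal \<open>N\<close> that contains the vertices of \<open>H\<close> it turns
  \<open>Ih \<subseteq> J\<close> into the inclusion of \<open>I\<close> in the generated
  ideal.\<close>

lemma J_subset_preimage:
  assumes N: "rng_ideal N L" "vtx ` H \<subseteq> N"
  shows "J \<subseteq> preimage N"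
  unfolding J_def
proof (rule ideal_gen_minimal[OF two_sided_ideal_preimage[OF N(1)]])
  have "gen (Vertex v) \<in> preimage N" if "v \<in> H" for v
  proof -
    have "gen (Vertex v) \<in> carrier F" using that by (intro gen_carrier) (simp add: H_def lpa_gens_def)
    then show ?thesis using N(2) that by (auto simp: mem_preimage lpa_vertex_def)
  qed
  then show "P \<union> (\<lambda>v. gen (Vertex v)) ` H \<subseteq> preimage N"
    using P_subset_preimage[OF N(1)] by blast
qed

lemma hcomp_J:
  assumes "p \<in> J"
  shows "hcomp d p \<in> J"
proof -
  have "gen (Vertex v) \<in> {x. \<forall>d. hcomp d x \<in> J}" if "v \<in> H" for v
  proof -
    have "homogeneous 0 (P.V v)" using homogeneous_gen[of "Vertex v"] by simp
    from hcomp_homogeneous[OF this] show ?thesis using vertex_mem_J[OF that] J.zero by simp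
  qed
  then have "P \<union> (\<lambda>v. gen (Vertex v)) ` H \<subseteq> {x. \<forall>d. hcomp d x \<in> J}"
    using hcomp_P P_subset_J by blast
  then have "J \<subseteq> {x. \<forall>d. hcomp d x \<in> J}"
    by (subst (1) J_def) (intro ideal_gen_minimal two_sided_ideal_graded_part J.two_sided_ideal_axioms)
  then show ?thesis using assms by blast
qed

text \<open>Removing the edges that end in \<open>H\<close> also removes those that start there,
  because \<open>H\<close> is hereditary.\<close>

definition G' :: "('v, 'e) pre_digraph" where
  "G' = \<lparr>verts = verts G - H, arcs = {e \<in> arcs G. head G e \<notin> H}, tail = tail G, head = head G\<rparr>"

lemma wf_digraph_G': "wf_digraph G'"
proof
  fix e assume e: "e \<in> arcs G'"
  then have e': "e \<in> arcs G" "head G e \<notin> H" by (auto simp: G'_def)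
  have "awalk (tail G e) [e] (head G e)" using e' by (auto simp: awalk_simps)
  then have "tail G e \<notin> H" using hereditary_H e' by (auto simp: hereditary_def)
  then show "tail G' e \<in> verts G'" "head G' e \<in> verts G'" using e' by (auto simp: G'_def)
qed

lemma eqv_J: "P.eqv p q \<Longrightarrow> J.eqv p q"
  using P_subset_J by (auto simp: P.eqv_def J.eqv_def)

text \<open>An edge into \<open>H\<close> is congruent to its product with a vertex of
  \<open>H\<close>, so it vanishes modulo \<open>J\<close>, and so does its ghost. An infinite
  emitter of \<open>G\<close> may keep only finitely many edges in \<open>G'\<close>, so that
  \<open>G'\<close> brings no relation at its regular vertices.\<close>

lemma cohn_ideal_J: "cohn_ideal G' J"
proof -
  interpret G': wf_digraph G' by (rule wf_digraph_G')
  have ht: "head G' = head G" "tail G' = tail G" by (simp_all add: G'_def)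
  have out: "gen (Edge e) \<in> J \<and> gen (Ghost e) \<in> J" if "e \<notin> arcs G'" for e
  proof (cases "e \<in> arcs G")
    case True
    then have "gen (Vertex (head G e)) \<in> J" using that vertex_mem_J by (simp add: G'_def)
    then have "gen (Edge e) * gen (Vertex (head G e)) \<in> J" "gen (Vertex (head G e)) * gen (Ghost e) \<in> J"
      by (simp_all add: J.lmult J.rmult)
    then show ?thesis
      using J.mem_cong[OF eqv_J[OF P.edge_head]] J.mem_cong[OF eqv_J[OF P.head_ghost]] by blast
  next
    case False
    then show ?thesis using P.outside P_subset_J by blast
  qed
  have out_v: "gen (Vertex v) \<in> J" if "v \<notin> verts G'" for v
    using that P.outside(1) P_subset_J vertex_mem_J by (auto simp: G'_def)
  show ?thesis
  proof (intro cohn_ideal.intro cohn_ideal_axioms.intro wf_digraph_G' J.free_ideal_axioms)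
    show "J.eqv (gen (Ghost e) * gen (Edge f)) (if e = f then gen (Vertex (head G' e)) else 0)"
      if "e \<in> arcs G'" "f \<in> arcs G'" for e f
      unfolding ht using that by (intro eqv_J P.ghost_edge) (simp_all add: G'_def)
  qed (unfold ht, (rule eqv_J P.vertex_vertex P.tail_edge P.edge_head P.head_ghost P.ghost_tail)+,
      use out out_v in auto)
qed

lemma graded_cohn_ideal_J:
  assumes pi: "purely_infinite RI"
  shows "graded_cohn_ideal G' J Ih"
proof -
  interpret pi: purely_infinite_ideal P Ih by (rule purely_infinite_ideal_Ih[OF pi])
  show ?thesis
  proof (intro graded_cohn_ideal.intro graded_cohn_ideal_axioms.intro cohn_ideal_J two_sided_ideal_Ih)
    show "J \<subseteq> Ih" by (rule J_subset_preimage[OF ideal_I vertices_subset])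
    show "hcomp d x \<in> J" if "x \<in> J" for x d by (rule hcomp_J[OF that])
    show "gen (Vertex v) \<notin> Ih" if "v \<in> verts G'" for v using that by (simp add: G'_def H_def)
    show "Poly_Mapping.lookup x 0 = 0" if "x \<in> Ih" for x
      using retract_mem[OF that] lookup_retract_zero[of x] by (auto simp: mem_carrier_F in_keys_iff)
    show "\<exists>z. (w - u) * z - w \<in> J"
      if "commutative_corner J w" "u \<in> Ih" "w * u - u \<in> J" "u * w - u \<in> J" for w u
      using pi.commutative_corner_quasi_regular[OF that(1) P_subset_J that(2-4)] .
  qed
qed

lemma ideal_eq_genideal:
  assumes pi: "purely_infinite RI"
  shows "I = rng_genideal L (vtx ` H)"
proof
  interpret gc: graded_cohn_ideal G' J Ih by (rule graded_cohn_ideal_J[OF pi])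
  show "rng_genideal L (vtx ` H) \<subseteq> I"
    unfolding rng_genideal_def using ideal_I vertices_subset by blast
  show "I \<subseteq> rng_genideal L (vtx ` H)"
    unfolding rng_genideal_def
  proof (intro Inter_greatest subsetI)
    fix N x assume N: "N \<in> {N. rng_ideal N L \<and> vtx ` H \<subseteq> N}" and x: "x \<in> I"
    obtain p where p: "p \<in> carrier F" "p \<in> Ih" "x = cls p" using I_cls[OF x] by blast
    have "p \<in> preimage N" using J_subset_preimage[of N] N p(2) gc.I_subset_J by blast
    then show "x \<in> N" using mem_preimage p by simp
  qed
qed

lemma vertex_component:
  assumes "v \<in> verts G"
  shows "vtx v \<in> lpa_component G 0"
proof -
  have "P.V v \<in> carrier F" using assms by (intro gen_carrier) (simp add: lpa_gens_def)
  then show ?thesis unfolding lpa_component_def lpa_vertex_def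
    by (intro image_eqI[OF refl]) (auto simp: gen_def)
qed

text \<open>The generators found for \<open>I\<close> are vertices, which are homogeneous of degree
  0.\<close>

lemma graded_ideal_I:
  assumes pi: "purely_infinite RI"
  shows "graded_ideal G I"
proof -
  let ?S = "I \<inter> (\<Union>n. lpa_component G n)"
  have gen: "I = rng_genideal L (vtx ` H)" by (rule ideal_eq_genideal[OF pi])
  have "vtx ` H \<subseteq> ?S" using vertices_subset vertex_component by (auto simp: H_def)
  then have "rng_genideal L (vtx ` H) \<subseteq> rng_genideal L ?S"
    unfolding rng_genideal_def by blast
  moreover have "rng_genideal L ?S \<subseteq> I"
    unfolding rng_genideal_def using ideal_I by blast
  ultimately show ?thesis using gen ideal_I by (auto simp: graded_ideal_def)
qed

end

theorem proposition4p2: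
  fixes G :: "('v, 'e) pre_digraph"
    and I :: "('v, 'e, 'k::field) lpa set"
  assumes "wf_digraph G"
    and "rng_ideal I (leavitt_path_algebra G)"
    and "purely_infinite ((leavitt_path_algebra G)\<lparr>carrier := I\<rparr>)"
  shows "graded_ideal G I \<and>
    (\<exists>H \<subseteq> verts G. hereditary G H \<and> saturated G H \<and>
      I = rng_genideal (leavitt_path_algebra G) (lpa_vertex G ` H))"
proof -
  interpret leavitt_ideal G I
    using assms(1,2) by (simp add: leavitt_ideal_def leavitt_ideal_axioms_def)
  have "H \<subseteq> verts G" by (auto simp: H_def)
  then show ?thesis
    using graded_ideal_I[OF assms(3)] hereditary_H saturated_H ideal_eq_genideal[OF assms(3)] by blast
qed

end
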